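(* Let $\{x^k\}_{k\ge0}$ be generated by the algorithm MBTFWGSC (described in the context) applied to $\min_{x\in\mathcal X}f(x)$, under the standing assumptions listed in the context. For $x^0\in\mathcal X\cap\operatorname{dom}f$ and $\varepsilon>0$, put $h_k=f(x^k)-f^*$ and $N_\varepsilon(x^0)=\inf\{k\ge0:h_k\le\varepsilon\}$. Then, for all $\varepsilon>0$, $$N_{\varepsilon}(x^{0})\leq \frac{\ln\left(\frac{c_{1}(\bar M,\nu)}{h_{0}\,c_{2}(\bar M,\nu)}\right)}{\ln(1-c_{1}(\bar M,\nu))}+\frac{1}{c_{2}(\bar M,\nu)\,\varepsilon},$$ where $\bar M=\max\{\gamma_uM_f,\mu_{-1}\}$ and $c_1,c_2$ are the constants defined in the context.
   Context: **Generalized self-concordance (GSC).** For $\nu\in[2,3]$ and $M_f\ge0$, $\mathcal F_{M_f,\nu}$ is the class of closed (lower semicontinuous) convex functions $f:\mathbb R^n\to(-\infty,+\infty]$ with $\operatorname{dom}f=\{f<\infty\}$ open and nonempty, $f$ three times continuously differentiable on $\operatorname{dom}f$, and $|\langle D^3f(x)[v]u,u\rangle|\le M_f\|u\|_x^2\|v\|_x^{\nu-2}\|v\|_2^{3-\nu}$ for all $x\in\operatorname{dom}f$, $u,v\in\mathbb R^n$, where $\|u\|_x=\sqrt{\langle\nabla^2f(x)u,u\rangle}$. **Standing assumptions.** $f\in\mathcal F_{M_f,\nu}$ with $\nu\in[2,3]$; $\mathcal X\subset\mathbb R^n$ is convex and compact, and linear functions can be minimized over it efficiently and accurately; $\min_{x\in\mathcal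 X}f(x)$ has a solution $x^*$, $f^*=f(x^* )$; $\nabla^2f$ is continuous and positive definite on $\mathcal X\cap\operatorname{dom}f$; given a point $x$, it is easy to decide whether $x\in\operatorname{dom}f$ (a domain oracle). **Frank-Wolfe quantities** for $x\in\mathcal X\cap\operatorname{dom}f$: $s(x)\in\arg\min_{d\in\mathcal X}\langle\nabla f(x),d\rangle$ (a fixed selection), $\mathsf{Gap}(x)=\max_{s\in\mathcal X}\langle\nabla f(x),x-s\rangle$, $v_{FW}(x)=s(x)-x$, $e(x)=\|v_{FW}(x)\|_x$, $\beta(x)=\|v_{FW}(x)\|_2$; $\delta_2(x)=\beta(x)$ and $\delta_\nu(x)=\frac{\nu-2}{2}\beta(x)^{3-\nu}e(x)^{\nu-2}$ for $\nu\in(2,3]$. **The function $\omega_\nu$.** $\omega_2(t)=\frac{e^t-t-1}{t^2}$; $\omega_3(t)=\frac{-t-\ln(1-t)}{t^2}$; $\omega_\nu(t)=\frac{\nu-2}{4-\nu}\frac1t\left[\frac{\nu-2}{2(3-\nu)t}\left((1-t)^{\frac{2(3-\nu)}{2-\nu}}-1\right)-1\right]$ for $\nu\in(2,3)$ (extended by continuity at $t=0$; for $\nu>2$ the value is $+\infty$ for $t\ge1$). **Step size.** $\alpha_{M,\nu}(x)=\min\{1,t_{M,\nu}(x)\}$, where $t_{M,2}(x)=\frac{1}{M\delta_2(x)}\ln\left(1+\frac{\mathsf{Gap}(x)M\delta_2(x)}{e(x)^2}\right)$; $t_{M,\nu}(x)=\frac{1}{M\delta_\nu(x)}\left[1-\left(1+\frac{M\delta_\nu(x)\mathsf{Gap}(x)}{e(x)^2}\frac{4-\nu}{\nu-2}\right)^{-\frac{\nu-2}{4-\nu}}\right]$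 for $\nu\in(2,3)$; $t_{M,3}(x)=\frac{\mathsf{Gap}(x)}{M\delta_3(x)\mathsf{Gap}(x)+e(x)^2}$. **Upper model.** $Q_M(x,t,\mu)=f(x)-t\,\mathsf{Gap}(x)+t^2e(x)^2\omega_\nu(t\mu\delta_\nu(x))$. **Algorithm MBTFWGSC.** Inputs: $x^0\in\mathcal X\cap\operatorname{dom}f$, an initial GSC-parameter estimate $\mu_{-1}>0$, fixed scaling parameters $\gamma_u>1$ and $\gamma_d<1$, and an error tolerance $\varepsilon>0$. For $k=0,1,\dots$: if $\mathsf{Gap}(x^k)>\varepsilon$, put $v^k=v_{FW}(x^k)$; choose $\tilde M\in[\gamma_d\mu_{k-1},\mu_{k-1}]$ and set $\alpha=\alpha_{\tilde M,\nu}(x^k)$; while $x^k+\alpha v^k\notin\operatorname{dom}f$ or $f(x^k+\alpha v^k)>Q_M(x^k,\alpha,\tilde M)$, replace $\tilde M$ by $\gamma_u\tilde M$ and recompute $\alpha=\alpha_{\tilde M,\nu}(x^k)$. On exit set $\alpha_k=\alpha$, $\mu_k=\tilde M$, $x^{k+1}=x^k+\alpha_kv^k$. **Constants.** $\mathcal S(x^0)=\{x\in\mathcal X\cap\operatorname{dom}f: f(x)\le f(x^0)\}$ (compact), $L_{\nabla f}=\max_{x\in\mathcal S(x^0)}\lambda_{\max}(\nabla^2f(x))$, $D=\operatorname{diam}(\mathcal X)$. For $\nu\in(2,3)$: $\tilde\gamma_\nu=1+\frac{4-\nu}{2(3-\nu)}\left(1-2^{2(3-\nu)/(4-\nu)}\right)$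 and $b=\frac{2-\nu}{4-\nu}$. For $(M,\nu)\in(0,\infty)\times[2,3]$: $c_1(M,2)=\min\{\frac12,\frac{2\ln2-1}{MD}\}$; $c_1(M,\nu)=\min\{\frac12,\frac{\tilde\gamma_\nu}{D(\nu/2-1)ML_{\nabla f}^{(\nu-2)/2}}\}$ for $\nu\in(2,3)$; $c_1(M,3)=\min\{\frac12,\frac{2(1-\ln2)}{M\sqrt{L_{\nabla f}}D}\}$; $c_2(M,2)=\frac{2\ln2-1}{L_{\nabla f}D^2}$; $c_2(M,\nu)=\frac{-1}{b}\frac{\tilde\gamma_\nu}{L_{\nabla f}D^2}$ for $\nu\in(2,3)$; $c_2(M,3)=\frac{2(1-\ln2)}{L_{\nabla f}D^2}$.
   Formalization: The displayed bound is stated for ε < h_0 only; for h_0 ≤ ε the claim becomes N_ε(x^0) = 0, because there the right-hand side can be negative (f = x²/2 on [-1,1], x^0 = 0.01, ε = 100, ν = 3, M_f = 0, small μ_{-1}) or undefined (h_0 = 0). *)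

theory Defs
  imports "HOL-Analysis.Analysis" "HOL-Library.While_Combinator" "HOL-Library.Extended_Nat"
begin

section \<open>Generalized self-concordant functions\<close>

definition effdom :: "('a \<Rightarrow> ereal) \<Rightarrow> 'a set" where
  "effdom f = {x. f x < \<infinity>}"

text \<open>Derivatives are those of the real-valued function underlying \<open>f\<close>; they are only
  used on the (open) effective domain.\<close>

definition grad :: "(real^'n \<Rightarrow> ereal) \<Rightarrow> real^'n \<Rightarrow> real^'n" where
  "grad f x = (\<chi> i. frechet_derivative (\<lambda>y. real_of_ereal (f y)) (at x) (axis i 1))"

definition hess :: "(real^'n \<Rightarrow> ereal) \<Rightarrow> real^'n \<Rightarrow> real^'n^'n" where
  "hess f x = jacobian (grad f) (at x)"

text \<open>\<open>D3 f x v\<close> is the matrix \<open>D^3 f(x)[v]\<close>, the derivative of the Hessian in direction \<open>v\<close>.\<close>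

definition D3 :: "(real^'n \<Rightarrow> ereal) \<Rightarrow> real^'n \<Rightarrow> real^'n \<Rightarrow> real^'n^'n" where
  "D3 f x v = frechet_derivative (hess f) (at x) v"

definition C3_on :: "(real^'n) set \<Rightarrow> (real^'n \<Rightarrow> ereal) \<Rightarrow> bool" where
  "C3_on U f \<longleftrightarrow>
     (\<lambda>x. real_of_ereal (f x)) differentiable_on U \<and>
     grad f differentiable_on U \<and>
     hess f differentiable_on U \<and>
     (\<forall>v. continuous_on U (\<lambda>x. D3 f x v))"

definition local_norm :: "(real^'n \<Rightarrow> ereal) \<Rightarrow> real^'n \<Rightarrow> real^'n \<Rightarrow> real" where
  "local_norm f x u = sqrt ((hess f x *v u) \<bullet> u)"

text \<open>Real powers with the convention \<open>0^0 = 1\<close>; the library has \<open>0 powr 0 = 0\<close>, which would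
  change the self-concordance inequality for \<open>\<nu> = 2\<close> at degenerate Hessians.\<close>

definition rpow :: "real \<Rightarrow> real \<Rightarrow> real" where
  "rpow a p = (if p = 0 then 1 else a powr p)"

definition ereal_convex :: "('a::real_vector \<Rightarrow> ereal) \<Rightarrow> bool" where
  "ereal_convex f \<longleftrightarrow>
     (\<forall>x y. \<forall>t\<in>{0..1}. f ((1 - t) *\<^sub>R x + t *\<^sub>R y) \<le> ereal (1 - t) * f x + ereal t * f y)"

definition lower_semicont :: "('a::topological_space \<Rightarrow> ereal) \<Rightarrow> bool" where
  "lower_semicont f \<longleftrightarrow> (\<forall>x. f x \<le> Liminf (at x) f)"

definition gsc_class :: "real \<Rightarrow> real \<Rightarrow> (real^'n \<Rightarrow> ereal) set" where
  "gsc_class Mf \<nu> = {f.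
     (\<forall>x. f x \<noteq> -\<infinity>) \<and> lower_semicont f \<and> ereal_convex f \<and>
     open (effdom f) \<and> effdom f \<noteq> {} \<and> C3_on (effdom f) f \<and>
     (\<forall>x\<in>effdom f. \<forall>u v.
        \<bar>(D3 f x v *v u) \<bullet> u\<bar>
          \<le> Mf * (local_norm f x u)\<^sup>2 * rpow (local_norm f x v) (\<nu> - 2) * rpow (norm v) (3 - \<nu>))}"

section \<open>Frank-Wolfe quantities\<close>

text \<open>In what follows \<open>s\<close> is the fixed selection of the linear minimization oracle over \<open>X\<close>.\<close>

definition lin_oracle :: "(real^'n \<Rightarrow> ereal) \<Rightarrow> (real^'n) set \<Rightarrow> (real^'n \<Rightarrow> real^'n) \<Rightarrow> bool" where
  "lin_oracle f X s \<longleftrightarrow>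
     (\<forall>x \<in> X \<inter> effdom f. is_arg_min (\<lambda>d. grad f x \<bullet> d) (\<lambda>d. d \<in> X) (s x))"

definition Gap :: "(real^'n \<Rightarrow> ereal) \<Rightarrow> (real^'n) set \<Rightarrow> real^'n \<Rightarrow> real" where
  "Gap f X x = (SUP d\<in>X. grad f x \<bullet> (x - d))"

definition v_FW :: "(real^'n \<Rightarrow> real^'n) \<Rightarrow> real^'n \<Rightarrow> real^'n" where
  "v_FW s x = s x - x"

definition e_FW :: "(real^'n \<Rightarrow> ereal) \<Rightarrow> (real^'n \<Rightarrow> real^'n) \<Rightarrow> real^'n \<Rightarrow> real" where
  "e_FW f s x = local_norm f x (v_FW s x)"

definition beta_FW :: "(real^'n \<Rightarrow> real^'n) \<Rightarrow> real^'n \<Rightarrow> real" where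
  "beta_FW s x = norm (v_FW s x)"

definition delta_FW ::
  "(real^'n \<Rightarrow> ereal) \<Rightarrow> (real^'n \<Rightarrow> real^'n) \<Rightarrow> real \<Rightarrow> real^'n \<Rightarrow> real" where
  "delta_FW f s \<nu> x =
     (if \<nu> = 2 then beta_FW s x
      else (\<nu> - 2) / 2 * rpow (beta_FW s x) (3 - \<nu>) * rpow (e_FW f s x) (\<nu> - 2))"

text \<open>The value \<open>1/2\<close> is the continuous extension to \<open>t = 0\<close> for every \<open>\<nu>\<close>.\<close>

definition omega :: "real \<Rightarrow> real \<Rightarrow> ereal" where
  "omega \<nu> t =
     (if t = 0 then ereal (1 / 2)
      else if \<nu> = 2 then ereal ((exp t - t - 1) / t\<^sup>2)
      else if t \<ge> 1 then \<infinity>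
      else if \<nu> = 3 then ereal ((- t - ln (1 - t)) / t\<^sup>2)
      else ereal ((\<nu> - 2) / (4 - \<nu>) * (1 / t) *
             ((\<nu> - 2) / (2 * (3 - \<nu>) * t) * ((1 - t) powr (2 * (3 - \<nu>) / (2 - \<nu>)) - 1) - 1)))"

definition t_step ::
  "(real^'n \<Rightarrow> ereal) \<Rightarrow> (real^'n) set \<Rightarrow> (real^'n \<Rightarrow> real^'n) \<Rightarrow> real \<Rightarrow> real \<Rightarrow> real^'n \<Rightarrow> real" where
  "t_step f X s \<nu> M x =
     (let G = Gap f X x; e = e_FW f s x; \<delta> = delta_FW f s \<nu> x in
      if \<nu> = 2 then 1 / (M * \<delta>) * ln (1 + G * M * \<delta> / e\<^sup>2)
      else if \<nu> = 3 then G / (M * \<delta> * G + e\<^sup>2)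
      else 1 / (M * \<delta>) *
        (1 - (1 + M * \<delta> * G / e\<^sup>2 * ((4 - \<nu>) / (\<nu> - 2))) powr (- ((\<nu> - 2) / (4 - \<nu>)))))"

definition alpha_step ::
  "(real^'n \<Rightarrow> ereal) \<Rightarrow> (real^'n) set \<Rightarrow> (real^'n \<Rightarrow> real^'n) \<Rightarrow> real \<Rightarrow> real \<Rightarrow> real^'n \<Rightarrow> real" where
  "alpha_step f X s \<nu> M x = min 1 (t_step f X s \<nu> M x)"

definition Q_model ::
  "(real^'n \<Rightarrow> ereal) \<Rightarrow> (real^'n) set \<Rightarrow> (real^'n \<Rightarrow> real^'n) \<Rightarrow> real
    \<Rightarrow> real^'n \<Rightarrow> real \<Rightarrow> real \<Rightarrow> ereal" where
  "Q_model f X s \<nu> x t \<mu> =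
     f x - ereal (t * Gap f X x)
       + ereal (t\<^sup>2 * (e_FW f s x)\<^sup>2) * omega \<nu> (t * \<mu> * delta_FW f s \<nu> x)"

section \<open>Algorithm MBTFWGSC\<close>

definition reject_step ::
  "(real^'n \<Rightarrow> ereal) \<Rightarrow> (real^'n) set \<Rightarrow> (real^'n \<Rightarrow> real^'n) \<Rightarrow> real \<Rightarrow> real^'n \<Rightarrow> real \<Rightarrow> bool" where
  "reject_step f X s \<nu> x M \<longleftrightarrow>
     (let \<alpha> = alpha_step f X s \<nu> M x; y = x + \<alpha> *\<^sub>R v_FW s x in
      y \<notin> effdom f \<or> f y > Q_model f X s \<nu> x \<alpha> M)"

definition backtrack ::
  "(real^'n \<Rightarrow> ereal) \<Rightarrow> (real^'n) set \<Rightarrow> (real^'n \<Rightarrow> real^'n) \<Rightarrow> real \<Rightarrow> real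
    \<Rightarrow> real^'n \<Rightarrow> real \<Rightarrow> real" where
  "backtrack f X s \<nu> \<gamma>u x M = while (reject_step f X s \<nu> x) (\<lambda>M'. \<gamma>u * M') M"

text \<open>
  The estimates are shifted by one index: \<open>\<mu> 0\<close> is the initial estimate \<open>\<mu>_{-1}\<close>
  and \<open>\<mu> (Suc k)\<close> is the estimate \<open>\<mu>_k\<close> accepted in iteration \<open>k\<close>.
  The initial guess of the line search is an arbitrary positive element of
  \<open>[\<gamma>d * \<mu> k, \<mu> k]\<close>; positivity is automatic for \<open>\<gamma>d > 0\<close>.
  After the stopping test succeeds the iterates are continued as a constant sequence.
\<close>

definition MBTFWGSC_run ::
  "(real^'n \<Rightarrow> ereal) \<Rightarrow> (real^'n) set \<Rightarrow> (real^'n \<Rightarrow> real^'n) \<Rightarrow> real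
    \<Rightarrow> real \<Rightarrow> real \<Rightarrow> real \<Rightarrow> real \<Rightarrow> real^'n
    \<Rightarrow> (nat \<Rightarrow> real^'n) \<Rightarrow> (nat \<Rightarrow> real) \<Rightarrow> bool" where
  "MBTFWGSC_run f X s \<nu> \<gamma>u \<gamma>d \<mu>init \<epsilon> x0 x \<mu> \<longleftrightarrow>
     x 0 = x0 \<and> \<mu> 0 = \<mu>init \<and>
     (\<forall>k. if Gap f X (x k) > \<epsilon>
          then \<exists>M>0. M \<in> {\<gamma>d * \<mu> k .. \<mu> k} \<and>
                 \<mu> (Suc k) = backtrack f X s \<nu> \<gamma>u (x k) M \<and>
                 x (Suc k) = x k + alpha_step f X s \<nu> (\<mu> (Suc k)) (x k) *\<^sub>R v_FW s (x k)
          else x (Suc k) = x k \<and> \<mu> (Suc k) = \<mu> k)"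

section \<open>Iteration count and constants\<close>

definition h_gap :: "(real^'n \<Rightarrow> ereal) \<Rightarrow> real^'n \<Rightarrow> (nat \<Rightarrow> real^'n) \<Rightarrow> nat \<Rightarrow> ereal" where
  "h_gap f xstar x k = f (x k) - f xstar"

text \<open>The infimum is taken in \<open>enat\<close>, so it is \<open>\<infinity>\<close> if no iterate is \<open>\<epsilon>\<close>-optimal.\<close>

definition N_eps :: "(real^'n \<Rightarrow> ereal) \<Rightarrow> real^'n \<Rightarrow> (nat \<Rightarrow> real^'n) \<Rightarrow> real \<Rightarrow> enat" where
  "N_eps f xstar x \<epsilon> = Inf (enat ` {k. h_gap f xstar x k \<le> ereal \<epsilon>})"

definition lambda_max :: "real^'n^'n \<Rightarrow> real" where
  "lambda_max A = Sup {l. \<exists>v. v \<noteq> 0 \<and> A *v v = l *\<^sub>R v}"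

definition sublevel :: "(real^'n \<Rightarrow> ereal) \<Rightarrow> (real^'n) set \<Rightarrow> real^'n \<Rightarrow> (real^'n) set" where
  "sublevel f X x0 = {x \<in> X \<inter> effdom f. f x \<le> f x0}"

definition L_grad :: "(real^'n \<Rightarrow> ereal) \<Rightarrow> (real^'n) set \<Rightarrow> real^'n \<Rightarrow> real" where
  "L_grad f X x0 = (SUP x\<in>sublevel f X x0. lambda_max (hess f x))"

definition gamma_tilde :: "real \<Rightarrow> real" where
  "gamma_tilde \<nu> = 1 + (4 - \<nu>) / (2 * (3 - \<nu>)) * (1 - 2 powr (2 * (3 - \<nu>) / (4 - \<nu>)))"

definition b_const :: "real \<Rightarrow> real" where
  "b_const \<nu> = (2 - \<nu>) / (4 - \<nu>)"

definition c1 :: "real \<Rightarrow> real \<Rightarrow> real \<Rightarrow> real \<Rightarrow> real" where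
  "c1 L D M \<nu> =
     (if \<nu> = 2 then min (1 / 2) ((2 * ln 2 - 1) / (M * D))
      else if \<nu> = 3 then min (1 / 2) (2 * (1 - ln 2) / (M * sqrt L * D))
      else min (1 / 2) (gamma_tilde \<nu> / (D * (\<nu> / 2 - 1) * M * L powr ((\<nu> - 2) / 2))))"

definition c2 :: "real \<Rightarrow> real \<Rightarrow> real \<Rightarrow> real \<Rightarrow> real" where
  "c2 L D M \<nu> =
     (if \<nu> = 2 then (2 * ln 2 - 1) / (L * D\<^sup>2)
      else if \<nu> = 3 then 2 * (1 - ln 2) / (L * D\<^sup>2)
      else - 1 / b_const \<nu> * (gamma_tilde \<nu> / (L * D\<^sup>2)))"

end

theory Submission
  imports Defs
begin

text \<open>
  Write \<open>h\<close> for the primal gap, \<open>G\<close> for the Frank-Wolfe gap and \<open>v\<close> for the Frank-Wolfe direction at an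
  iterate, \<open>e\<close> for its local and \<open>\<beta>\<close> for its Euclidean norm. Convexity gives \<open>h \<le> G\<close>.

  Along the segment from an iterate \<open>x\<close> in direction \<open>v\<close> generalized self-concordance is a scalar differential
  inequality for the curvature \<open>p t = D\<^sup>2f(x + t v)[v, v]\<close>. Integrating it three times bounds \<open>f\<close> by the upper model
  with any parameter \<open>M \<ge> Mf\<close>; the bound also keeps the segment inside the domain, because \<open>f\<close> cannot stay
  bounded up to a boundary point outside its domain (\<open>gsc_line_bound\<close>). Hence backtracking stops, all accepted parameters
  stay below \<open>Mbar\<close>, and an accepted step decreases \<open>f\<close> at least by the decrease of the model at the chosen step
  (\<open>accepted_step\<close>). Here \<open>e\<^sup>2 \<le> L \<beta>\<^sup>2\<close>, since a symmetric matrix attains the maximum of its Rayleigh quotient at an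
  eigenvector and all iterates stay in the initial sublevel set (\<open>local_norm_le_L_grad\<close>).

  A full step gains at least \<open>G / 2\<close>. A shorter step maximizes the model, so its gain is a scaled Legendre conjugate
  of the model profile; the conjugate grows at least like the minimum of a linear and a quadratic function with
  the same value at 1 (\<open>conjugate_growth\<close>). For \<open>\<nu> < 3\<close> this yields a gain of at least
  \<open>min (c1 G) (c2 G\<^sup>2)\<close>, and a potential in \<open>h\<close> that grows by 1 per iteration gives the
  bound (\<open>iteration_count_min_decrease\<close>). The potential is logarithmic in \<open>1 / h\<close> while \<open>h \<ge> c1 / c2\<close> and linear in
  \<open>1 / h\<close> from there on; since \<open>c1 \<le> 1 / 2\<close>, the switch gains enough to absorb the last iteration, so no rounding terms
  appear.

  For \<open>\<nu> = 3\<close> this argument gives only half of the constant \<open>c2\<close>: for a short step with small \<open>G\<close> the model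
  promises only about \<open>G\<^sup>2 / (2 e\<^sup>2)\<close>, and \<open>c2 = 2 (1 - ln 2) / (L D\<^sup>2)\<close> is larger than \<open>1 / (2 L D\<^sup>2)\<close>. So the
  estimate can fall short in an iteration with \<open>\<beta>\<close> close to the diameter \<open>D\<close>. It cannot do so all the time:
  the iterate is a convex combination of \<open>x0\<close> and of earlier solutions of the linear subproblems, and if \<open>w D\<^sup>2\<close>
  is the variance of this combination, then every point of the feasible set has squared distance at most
  \<open>(1 - w) D\<^sup>2\<close> from the iterate. Small steps along long directions increase the variance and so limit the
  length of later directions, while large steps shrink \<open>h\<close> by themselves. The pair of \<open>h\<close> and \<open>w\<close> admits a
  potential that grows by 1 per iteration (\<open>short_step_potential\<close>, \<open>iteration_count_with_spread\<close>), with room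
  to spare for the stated constants.
\<close>

section \<open>Elementary inequalities for the logarithm\<close>

text \<open>
  The right-hand side is a Pade approximant of the logarithm; it is exact to third order at 0, which
  keeps the loss small enough for the constants of the case \<open>\<nu> = 3\<close>.
\<close>

lemma ln_one_plus_le_pade:
  assumes "0 \<le> (y::real)"
  shows "ln (1 + y) \<le> y * (y + 6) / (4 * y + 6)"
proof -
  let ?F = "\<lambda>y. y * (y + 6) / (4 * y + 6) - ln (1 + y)"
  have "?F 0 \<le> ?F y"
  proof (rule DERIV_nonneg_imp_nondecreasing[OF assms])
    fix z :: real assume z: "0 \<le> z" "z \<le> y"
    have "(?F has_real_derivative
        ((2 * z + 6) * (4 * z + 6) - z * (z + 6) * 4) / ((4 * z + 6) * (4 * z + 6)) - 1 / (1 + z)) (at z)"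
      using z by (intro derivative_eq_intros | simp add: algebra_simps)+
    also have "((2 * z + 6) * (4 * z + 6) - z * (z + 6) * 4) / ((4 * z + 6) * (4 * z + 6)) - 1 / (1 + z)
        = 4 * z ^ 3 / ((4 * z + 6)\<^sup>2 * (1 + z))"
    proof -
      have nz: "(4 * z + 6) * (4 * z + 6) \<noteq> 0" "1 + z \<noteq> 0" using z by auto
      show ?thesis unfolding diff_frac_eq[OF nz] power2_eq_square
        by (rule arg_cong2[of _ _ _ _ "(/)"]) (simp_all add: algebra_simps power3_eq_cube)
    qed
    finally have "(?F has_real_derivative 4 * z ^ 3 / ((4 * z + 6)\<^sup>2 * (1 + z))) (at z)" .
    moreover have "4 * z ^ 3 / ((4 * z + 6)\<^sup>2 * (1 + z)) \<ge> 0" using z by simp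
    ultimately show "\<exists>d. (?F has_real_derivative d) (at z) \<and> 0 \<le> d" by blast
  qed
  then show ?thesis by simp
qed

lemma ln2_ge: "69 / 100 \<le> ln (2::real)"
proof -
  have "ln (2::real) \<in> {307/443<..<4615/6658}"
    using ln_approx_bounds[of 2 3] by (simp add: eval_nat_numeral)
  then show ?thesis by simp
qed

lemma powr_young:
  fixes Y z :: real
  assumes "0 < Y" "0 \<le> z" "z \<le> 1"
  shows "Y powr z \<le> 1 - z + z * Y"
proof -
  have "convex_on UNIV (exp :: real \<Rightarrow> real)" by (rule exp_convex)
  from convex_onD[OF this, of z 0 "ln Y"] assms
  show ?thesis by (simp add: powr_def mult.commute)
qed

section \<open>Counting iterations with a potential\<close>

lemma potential_count:
  fixes P :: "nat \<Rightarrow> real"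
  assumes "\<And>k. k < n \<Longrightarrow> P k + 1 \<le> P (Suc k)"
  shows "real n \<le> P n - P 0"
  using assms
proof (induction n)
  case (Suc n)
  have "P n + 1 \<le> P (Suc n)" "real n \<le> P n - P 0" using Suc by auto
  then show ?case by simp
qed simp

text \<open>
  The upper bound is the chord of the convex function \<open>- ln (1 - c)\<close> on \<open>[0, 1/2]\<close>.
\<close>

lemma ln_complement_bounds:
  fixes c :: real
  assumes "0 < c" "c \<le> 1 / 2"
  shows "c \<le> - ln (1 - c)" "- ln (1 - c) \<le> 2 * ln 2 * c"
proof -
  show "c \<le> - ln (1 - c)" using ln_add_one_self_le_self2[of "- c"] assms by simp
  have "(1/2::real) powr (2 * c) \<le> 1 - 2 * c + 2 * c * (1/2)"
    using powr_young[of "1/2" "2 * c"] assms by simp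
  then have "ln ((1/2::real) powr (2 * c)) \<le> ln (1 - c)" using assms by (subst ln_le_cancel_iff) auto
  then show "- ln (1 - c) \<le> 2 * ln 2 * c" by (simp add: ln_powr ln_div mult_ac)
qed

text \<open>
  Ending in the logarithmic phase is no worse than the linear term of the final bound; the summand 1 pays for the
  iteration that reaches the target accuracy.
\<close>

lemma logarithmic_phase_le_linear:
  fixes c r :: real
  assumes "0 < c" "c \<le> 1 / 2" "0 < r" "r \<le> 1"
  shows "ln r / (- ln (1 - c)) + 1 \<le> r / c"
proof -
  let ?a = "- ln (1 - c)"
  have "2 * ln 2 * c \<le> 2 * 1 * (1/2)"
    using assms ln2_le_25_over_36 by (intro mult_mono) auto
  then have a: "0 < ?a" "?a \<le> 1" using ln_complement_bounds[OF assms(1,2)] assms(1) by linarith+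
  have "ln r \<le> 0" using assms by simp
  then have "ln r * 1 \<le> ln r * ?a" using a by (intro mult_left_mono_neg) auto
  then have "ln r / ?a \<le> ln r" using a by (subst pos_divide_le_eq) auto
  also have "\<dots> \<le> r - 1" using ln_le_minus_one assms by blast
  finally have "ln r / ?a + 1 \<le> r" by simp
  also have "r \<le> r / c" using assms by (simp add: le_divide_eq)
  finally show ?thesis .
qed

text \<open>
  With \<open>r = cl / (cq h)\<close> the decrease is linear in \<open>h\<close> for \<open>r \<le> 1\<close> and quadratic for \<open>r \<ge> 1\<close>. The potential
  \<open>P\<close> is \<open>ln r / a\<close> below 1 and \<open>(r - 1) / cl\<close> above; it dominates \<open>ln r / a\<close> everywhere because \<open>cl \<le> a\<close>, so it also
  grows by 1 in a step that crosses \<open>r = 1\<close>.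
\<close>

lemma iteration_count_min_decrease:
  fixes h :: "nat \<Rightarrow> real"
  assumes cl: "0 < cl" "cl \<le> 1 / 2" and cq: "0 < cq" and eps: "0 < \<epsilon>"
    and h: "\<And>k. k \<le> n \<Longrightarrow> \<epsilon> < h k"
    and step: "\<And>k. k < n \<Longrightarrow> h (Suc k) \<le> h k - min (cl * h k) (cq * (h k)\<^sup>2)"
  shows "real (Suc n) \<le> ln (cl / (h 0 * cq)) / ln (1 - cl) + 1 / (cq * \<epsilon>)"
proof -
  define a where "a = - ln (1 - cl)"
  define r where "r k = cl / (h k * cq)" for k
  define P where "P x = (if x \<le> 1 then ln x / a else (x - 1) / cl)" for x
  have a: "cl \<le> a" "0 < a" using ln_complement_bounds(1)[OF cl] cl by (auto simp: a_def)
  have hp: "0 < h k" if "k \<le> n" for k using h[OF that] eps by simp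
  have rp: "0 < r k" if "k \<le> n" for k using hp[OF that] cl cq by (simp add: r_def)
  have Pln: "ln x / a \<le> P x" if "0 < x" for x
  proof (cases "x \<le> 1")
    case False
    have "ln x / a \<le> (x - 1) / a" using that a ln_le_minus_one by (simp add: divide_right_mono)
    also have "\<dots> \<le> (x - 1) / cl" using False a cl by (simp add: frac_le)
    finally show ?thesis using False by (simp add: P_def)
  qed (simp add: P_def)
  have "P (r k) + 1 \<le> P (r (Suc k))" if k: "k < n" for k
  proof -
    have pos: "0 < h k" "0 < h (Suc k)" "0 < r k" "0 < r (Suc k)" using hp rp k by auto
    show ?thesis
    proof (cases "r k \<le> 1")
      case True
      then have "cl \<le> cq * h k" using pos cq by (simp add: r_def divide_le_eq mult.commute)
      then have "cl * h k \<le> cq * (h k)\<^sup>2"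
        using mult_right_mono[of cl "cq * h k" "h k"] pos by (simp add: power2_eq_square mult.assoc)
      then have "h (Suc k) \<le> (1 - cl) * h k" using step[OF k] by (simp add: algebra_simps)
      then have "1 / h k \<le> (1 - cl) / h (Suc k)" using pos by (simp add: divide_simps mult.commute)
      from mult_left_mono[OF this, of "cl / cq"] have "r k \<le> (1 - cl) * r (Suc k)"
        using cl cq by (simp add: r_def mult.commute)
      then have "ln (r k) \<le> ln ((1 - cl) * r (Suc k))" using pos cl by (subst ln_le_cancel_iff) auto
      also have "\<dots> = ln (r (Suc k)) - a" using pos cl by (simp add: ln_mult a_def)
      finally have "(ln (r k) + a) / a \<le> ln (r (Suc k)) / a" using a by (intro divide_right_mono) auto
      then have "ln (r k) / a + 1 \<le> ln (r (Suc k)) / a" using a by (simp add: add_divide_distrib)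
      with Pln[OF pos(4)] True show ?thesis by (simp add: P_def)
    next
      case False
      then have "cq * h k \<le> cl" using pos cq by (simp add: r_def divide_le_eq mult.commute)
      then have "cq * (h k)\<^sup>2 \<le> cl * h k"
        using mult_right_mono[of "cq * h k" cl "h k"] pos by (simp add: power2_eq_square mult.assoc)
      then have d: "h (Suc k) \<le> h k - cq * (h k)\<^sup>2" using step[OF k] by simp
      have "h (Suc k) * (1 + cq * h k) \<le> (h k - cq * (h k)\<^sup>2) * (1 + cq * h k)"
        using d pos cq by (intro mult_right_mono) auto
      also have "\<dots> = h k - h k * (cq * h k)\<^sup>2" by (simp add: algebra_simps power2_eq_square)
      also have "\<dots> \<le> h k" using pos by simp
      finally have A: "1 + cq * h k \<le> h k / h (Suc k)" using pos by (simp add: le_divide_eq mult.commute)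
      have "r k + cl = cl / (cq * h k) * (1 + cq * h k)" using pos cq by (simp add: r_def distrib_left mult.commute add_divide_distrib)
      also have "\<dots> \<le> cl / (cq * h k) * (h k / h (Suc k))" using A pos cl cq by (intro mult_left_mono) auto
      also have "\<dots> = r (Suc k)" using pos by (simp add: r_def mult.commute)
      finally have "r k + cl \<le> r (Suc k)" .
      then have "(r k + cl - 1) / cl \<le> (r (Suc k) - 1) / cl" using cl by (intro divide_right_mono) auto
      moreover have "(r k + cl - 1) / cl = (r k - 1) / cl + 1" using cl by (simp add: diff_divide_distrib add_divide_distrib)
      ultimately show ?thesis using False cl \<open>r k + cl \<le> r (Suc k)\<close> by (simp add: P_def)
    qed
  qed
  then have "real n \<le> P (r n) - P (r 0)" by (rule potential_count)
  also have "\<dots> \<le> P (r n) - ln (r 0) / a" using Pln[OF rp[of 0]] by simp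
  finally have "real (Suc n) \<le> P (r n) + 1 - ln (r 0) / a" by simp
  moreover have "P (r n) + 1 \<le> r n / cl"
  proof (cases "r n \<le> 1")
    case True then show ?thesis using logarithmic_phase_le_linear[OF cl rp[of n]] by (simp add: P_def a_def)
  next
    case False then show ?thesis using cl by (simp add: P_def diff_divide_distrib)
  qed
  moreover have "r n / cl = 1 / (cq * h n)" using cl by (simp add: r_def)
  moreover have "1 / (cq * h n) \<le> 1 / (cq * \<epsilon>)" using h[of n] eps cq by (simp add: frac_le)
  ultimately have "real (Suc n) \<le> 1 / (cq * \<epsilon>) - ln (r 0) / a" by linarith
  then show ?thesis by (simp add: r_def a_def)
qed

section \<open>Counting iterations when the iterates spread\<close>

text \<open>
  Here \<open>u\<close> is the reciprocal of the normalized primal gap, \<open>w\<close> the normalized variance, \<open>m\<close> the normalized squared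
  length of the direction, \<open>q \<le> m\<close> its normalized squared local norm, and \<open>\<tau>\<close> the step length relative to the pole of the
  model. The factor \<open>3 / (2 (3 - \<tau>))\<close> bounds the gain of the step per unit of \<open>t G\<close>.

  The coefficients are tuned. After elimination of \<open>u\<close> and \<open>m\<close> the claim is affine in \<open>q\<close> and in \<open>t\<close>, so it only
  has to be checked for \<open>q = 0\<close> and for \<open>q = 1\<close> with \<open>t = 0\<close> or \<open>t = 1\<close>, where it is a polynomial inequality in \<open>\<tau>\<close>. At the
  same time \<open>105/100 + 55/100 w\<close> must stay below \<open>1 / (2 (1 - ln 2))\<close> for \<open>w \<le> 1/2\<close>, which is the price per unit of
  \<open>u\<close> in the final bound.
\<close>

lemma short_step_potential:
  fixes t m w q \<tau> u u' K :: real
  assumes t: "0 < t" "t < 1" and q: "0 < q" "q \<le> m" "m \<le> 1 - w"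
    and w: "0 \<le> w" and tau: "0 < \<tau>" "\<tau> < 1" "\<tau> \<le> K * sqrt q * t"
    and u: "0 < u" "1 - \<tau> \<le> u * (q * t)"
    and u': "u \<le> u' * (1 - t * (3 / (2 * (3 - \<tau>))))"
  shows "u * (105/100 + 55/100 * w) + 14/10 * K * ln u + 1
     \<le> u' * (105/100 + 55/100 * ((1 - t) * (w + t * m))) + 14/10 * K * ln u'"
proof -
  define \<rho> where "\<rho> = 3 / (2 * (3 - \<tau>))"
  define \<sigma> where "\<sigma> = 1 - t * \<rho>"
  define A B c :: real where "A = 105/100" and "B = 55/100" and "c = 14/10"
  define w' where "w' = (1 - t) * (w + t * m)"
  have rho: "1/2 \<le> \<rho>" "\<rho> \<le> 3/4" using tau by (auto simp: \<rho>_def field_simps)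
  have sig: "0 < \<sigma>" "\<sigma> < 1"
  proof -
    have "t * \<rho> \<le> 1 * (3/4)" using t rho by (intro mult_mono) auto
    then show "0 < \<sigma>" by (simp add: \<sigma>_def)
    show "\<sigma> < 1" using t rho by (simp add: \<sigma>_def)
  qed
  have ABc: "0 < A" "0 < B" "0 < c" by (auto simp: A_def B_def c_def)
  have qle: "q \<le> 1" using q w by simp
  have "0 < K * sqrt q * t" using tau by linarith
  then have K: "0 < K" using q t by (simp add: zero_less_mult_iff)
  have w'0: "0 \<le> w'" using w t q by (simp add: w'_def)
  have u'1: "u \<le> u' * \<sigma>" using u' by (simp add: \<sigma>_def \<rho>_def)
  then have u'pos: "0 < u'" using u sig by (metis zero_less_mult_pos2 order_less_le_trans)
  \<comment> \<open>The logarithm contributes at least \<open>c \<tau> \<rho>\<close>, because \<open>K t \<ge> \<tau>\<close>.\<close>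
  have "ln u \<le> ln (u' * \<sigma>)" using u'1 u sig u'pos by (subst ln_le_cancel_iff) auto
  also have "\<dots> = ln u' + ln \<sigma>" using u'pos sig by (simp add: ln_mult)
  also have "ln \<sigma> \<le> - (t * \<rho>)" using ln_le_minus_one[OF sig(1)] by (simp add: \<sigma>_def)
  finally have "t * \<rho> \<le> ln u' - ln u" by simp
  then have "c * K * (t * \<rho>) \<le> c * K * (ln u' - ln u)" using K ABc by (intro mult_left_mono) auto
  moreover have "c * \<tau> * \<rho> \<le> c * K * (t * \<rho>)"
  proof -
    have "K * sqrt q * t \<le> K * 1 * t" using K q t qle by (intro mult_right_mono mult_left_mono) auto
    then have "\<tau> \<le> K * t" using tau by simp
    then have "c * \<rho> * \<tau> \<le> c * \<rho> * (K * t)" using ABc rho by (intro mult_left_mono) auto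
    then show ?thesis by (simp add: mult_ac)
  qed
  ultimately have lnpart: "c * \<tau> * \<rho> \<le> c * K * (ln u' - ln u)" by linarith
  \<comment> \<open>The gap shrinks at least by the factor \<open>\<sigma>\<close>, so the linear part gains from the excess
    of \<open>A + B w'\<close> over \<open>(A + B w) \<sigma>\<close>, which is \<open>t N\<close>.\<close>
  define N where "N = \<rho> * A + B * (1 - t) * m - B * w * (1 - \<rho>)"
  have N1: "N \<ge> \<rho> * A + B * (1 - t) * q - B * (1 - q) * (1 - \<rho>)"
    unfolding N_def using ABc t q rho by (intro add_mono diff_mono mult_right_mono mult_left_mono) auto
  have "B * (1 - q) * (1 - \<rho>) \<le> B * 1 * (1 - \<rho>)" using ABc q rho
    by (intro mult_right_mono mult_left_mono) auto
  moreover have "0 \<le> B * (1 - t) * q" using ABc t q by simp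
  ultimately have N0: "0 < N" using N1 rho by (simp add: A_def B_def)
  have eq: "(A + B * w') - (A + B * w) * \<sigma> = t * N"
    by (simp add: w'_def \<sigma>_def N_def algebra_simps)
  have "u * (A + B * w') \<le> u' * \<sigma> * (A + B * w')"
    using u'1 ABc w'0 by (intro mult_right_mono) auto
  then have "u * (t * N) \<le> \<sigma> * (u' * (A + B * w') - u * (A + B * w))"
    unfolding eq[symmetric] by (simp add: algebra_simps)
  moreover have "(1 - \<tau>) * N \<le> q * (u * (t * N))"
    using mult_right_mono[OF u(2), of N] N0 by (simp add: mult_ac)
  moreover have "q * (u * (t * N)) \<le> q * (\<sigma> * (u' * (A + B * w') - u * (A + B * w)))"
    using calculation(1) q by (intro mult_left_mono) auto
  ultimately have lin: "(1 - \<tau>) * N \<le> q * \<sigma> * (u' * (A + B * w') - u * (A + B * w))"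
    by (simp add: mult_ac)
  \<comment> \<open>The two endpoint cases \<open>t = 0\<close> and \<open>t = 1\<close> at \<open>q = 1\<close>.\<close>
  have e0: "(1 - \<tau>) * (\<rho> * A + B) \<ge> 1 - c * \<tau> * \<rho>"
  proof -
    define d where "d = 3 - \<tau>"
    have d: "\<rho> * d = 3/2" using tau by (simp add: \<rho>_def d_def divide_simps)
    have "((1 - \<tau>) * (\<rho> * A + B) - (1 - c * \<tau> * \<rho>)) * d
       = (1 - \<tau>) * (\<rho> * d * A + B * d) - (d - c * \<tau> * (\<rho> * d))"
      by (simp add: algebra_simps)
    also have "\<dots> = 225/1000 - 675/1000 * \<tau> + 55/100 * \<tau>\<^sup>2"
      unfolding d by (simp add: d_def A_def B_def c_def field_simps power2_eq_square)
    also have "\<dots> = 55/100 * (\<tau> - 675/1100)\<^sup>2 + (225/1000 - 55/100 * (675/1100)\<^sup>2)"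
      by (simp add: power2_eq_square algebra_simps)
    also have "\<dots> \<ge> 0" by (simp add: power2_eq_square)
    finally show ?thesis using tau by (simp add: zero_le_mult_iff d_def)
  qed
  have e1: "(1 - \<tau>) * (\<rho> * A) \<ge> (1 - \<rho>) * (1 - c * \<tau> * \<rho>)"
  proof -
    have "((1 - \<tau>) * (\<rho> * A) - (1 - \<rho>) * (1 - c * \<tau> * \<rho>)) * (2 * (3 - \<tau>)\<^sup>2)
       = 2 * (225/1000 + 135/100 * \<tau> - 1525/1000 * \<tau>\<^sup>2)"
    proof -
      define d where "d = 3 - \<tau>"
      have d: "d \<noteq> 0" "\<rho> * d = 3/2" "\<tau> = 3 - d" using tau by (auto simp: \<rho>_def d_def divide_simps)
      have "((1 - \<tau>) * (\<rho> * A) - (1 - \<rho>) * (1 - c * \<tau> * \<rho>)) * (2 * d\<^sup>2)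
        = 2 * ((1 - \<tau>) * (\<rho> * d * A) * d - (d - \<rho> * d) * (d - c * \<tau> * (\<rho> * d)))"
        by (simp add: algebra_simps power2_eq_square)
      also have "\<dots> = 2 * (225/1000 + 135/100 * \<tau> - 1525/1000 * \<tau>\<^sup>2)"
        unfolding d(2) by (simp add: d_def A_def c_def field_simps power2_eq_square)
      finally show ?thesis by (simp add: d_def)
    qed
    also have "225/1000 + 135/100 * \<tau> - 1525/1000 * \<tau>\<^sup>2
      = (1 - \<tau>) * (225/1000 + 1525/1000 * \<tau>) + 5/100 * \<tau>"
      by (simp add: power2_eq_square field_simps)
    also have "2 * \<dots> \<ge> 0" using tau by simp
    finally show ?thesis using tau by (simp add: zero_le_mult_iff)
  qed
  have e: "(1 - \<tau>) * (\<rho> * A + B * (1 - t)) \<ge> \<sigma> * (1 - c * \<tau> * \<rho>)"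
  proof -
    have "(1 - t) * (1 - c * \<tau> * \<rho>) + t * ((1 - \<rho>) * (1 - c * \<tau> * \<rho>))
      \<le> (1 - t) * ((1 - \<tau>) * (\<rho> * A + B)) + t * ((1 - \<tau>) * (\<rho> * A))"
      using e0 e1 t by (intro add_mono mult_left_mono) auto
    then show ?thesis by (simp add: \<sigma>_def algebra_simps)
  qed
  have "(1 - \<tau>) * N \<ge> (1 - \<tau>) * (\<rho> * A + B * (1 - t) * q - B * (1 - q) * (1 - \<rho>))"
    using N1 tau by (intro mult_left_mono) auto
  also have "(1 - \<tau>) * (\<rho> * A + B * (1 - t) * q - B * (1 - q) * (1 - \<rho>))
     = q * ((1 - \<tau>) * (\<rho> * A + B * (1 - t))) + (1 - q) * ((1 - \<tau>) * (\<rho> * A - B * (1 - \<rho>)))"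
    by (simp add: algebra_simps)
  also have "\<dots> \<ge> q * (\<sigma> * (1 - c * \<tau> * \<rho>))"
  proof -
    have "0 \<le> (1 - q) * ((1 - \<tau>) * (\<rho> * A - B * (1 - \<rho>)))"
      using qle tau rho by (intro mult_nonneg_nonneg) (auto simp: A_def B_def)
    moreover have "q * (\<sigma> * (1 - c * \<tau> * \<rho>)) \<le> q * ((1 - \<tau>) * (\<rho> * A + B * (1 - t)))"
      using e q by (intro mult_left_mono) auto
    ultimately show ?thesis by linarith
  qed
  finally have "q * \<sigma> * (1 - c * \<tau> * \<rho>) \<le> q * \<sigma> * (u' * (A + B * w') - u * (A + B * w))"
    using lin by (simp add: mult_ac)
  then have "1 - c * \<tau> * \<rho> \<le> u' * (A + B * w') - u * (A + B * w)"
    using q sig by simp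
  with lnpart show ?thesis unfolding w'_def A_def B_def c_def by (simp add: algebra_simps)
qed


text \<open>
  A direction of normalized squared length at most \<open>1 - w\<close> can never push the variance beyond one half:
  \<open>(1 - t) (t + (1 - t) / 2) = (1 - t\<^sup>2) / 2\<close>.
\<close>

lemma spread_bounds:
  fixes t m w :: "nat \<Rightarrow> real"
  assumes "w 0 = 0"
    and t: "\<And>k. k < n \<Longrightarrow> 0 < t k \<and> t k \<le> 1"
    and m: "\<And>k. k < n \<Longrightarrow> 0 \<le> m k \<and> m k \<le> 1 - w k"
    and w: "\<And>k. k < n \<Longrightarrow> w (Suc k) = (1 - t k) * (w k + t k * m k)"
    and "k \<le> n"
  shows "0 \<le> w k \<and> w k \<le> 1 / 2"
  using \<open>k \<le> n\<close>
proof (induction k)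
  case (Suc k)
  then have k: "k < n" and IH: "0 \<le> w k" "w k \<le> 1 / 2" by auto
  have "w k + t k * m k \<le> w k + t k * (1 - w k)"
    using t[OF k] m[OF k] by (intro add_left_mono mult_left_mono) auto
  also have "\<dots> = t k + (1 - t k) * w k" by (simp add: algebra_simps)
  also have "\<dots> \<le> t k + (1 - t k) * (1 / 2)"
    using t[OF k] IH by (intro add_left_mono mult_left_mono) auto
  finally have "w (Suc k) \<le> (1 - t k) * (t k + (1 - t k) * (1 / 2))"
    unfolding w[OF k] using t[OF k] by (intro mult_left_mono) auto
  also have "\<dots> = 1 / 2 - (t k)\<^sup>2 / 2" by (simp add: power2_eq_square field_simps)
  also have "\<dots> \<le> 1 / 2" by simp
  finally show ?case using w[OF k] t[OF k] m[OF k] IH by simp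
qed (use assms in simp)

text \<open>
  The scale \<open>K = (1 - ln 2) / cl\<close> bounds the strength \<open>\<tau> / (sqrt q t)\<close> of the pole, and \<open>u = 2 K\<close> is the level
  \<open>h = cl / c2\<close> where the target bound has logarithmic term 0. The potential is logarithmic while
  \<open>u \<le> 9/10 K\<close>: there every step shrinks the gap at least by the factor \<open>1 - cl\<close>. Beyond that level
  \<open>short_step_potential\<close> takes over; its additive constant \<open>- 16/10 K\<close> is small enough for the upper end of the count
  and large enough for the potential to dominate the logarithm at its start.
\<close>

lemma iteration_count_with_spread:
  fixes h t m w :: "nat \<Rightarrow> real"
  assumes cl: "0 < cl" "cl \<le> 1 / 2" and Lam: "0 < \<Lambda>" and eps: "0 < \<epsilon>"
    and h: "\<And>k. k \<le> n \<Longrightarrow> \<epsilon> < h k"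
    and w0: "w 0 = 0"
    and t: "\<And>k. k < n \<Longrightarrow> 0 < t k \<and> t k \<le> 1"
    and m: "\<And>k. k < n \<Longrightarrow> 0 \<le> m k \<and> m k \<le> 1 - w k"
    and w: "\<And>k. k < n \<Longrightarrow> w (Suc k) = (1 - t k) * (w k + t k * m k)"
    and full: "\<And>k. k < n \<Longrightarrow> t k = 1 \<Longrightarrow> h (Suc k) \<le> h k / 2"
    and short: "\<And>k. k < n \<Longrightarrow> t k < 1 \<Longrightarrow> \<exists>q \<tau>. 0 < q \<and> q \<le> m k \<and> 0 < \<tau> \<and> \<tau> < 1 \<and>
        \<tau> \<le> (1 - ln 2) / cl * sqrt q * t k \<and> h k * (1 - \<tau>) \<le> \<Lambda> * (q * t k) \<and>
        h (Suc k) \<le> h k * (1 - t k * (3 / (2 * (3 - \<tau>))))"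
  shows "real (Suc n) \<le> ln (cl / (h 0 * (2 * (1 - ln 2) / \<Lambda>))) / ln (1 - cl)
            + 1 / (2 * (1 - ln 2) / \<Lambda> * \<epsilon>)"
proof -
  define l2 where "l2 = ln (2::real)"
  have l2: "69/100 \<le> l2" "l2 \<le> 25/36" using ln2_ge ln2_le_25_over_36 by (auto simp: l2_def)
  define K where "K = (1 - l2) / cl"
  define a where "a = - ln (1 - cl)"
  define u where "u k = \<Lambda> / h k" for k
  define r where "r k = u k / (2 * K)" for k
  define P where "P k = (if u k \<le> 9/10 * K then ln (r k) / a
     else u k * (105/100 + 55/100 * w k) + 14/10 * K * ln (r k) - 16/10 * K)" for k
  have "11/36 / cl \<le> K" unfolding K_def using l2 cl by (intro divide_right_mono) auto
  moreover have "11/18 \<le> 11/36 / cl" using cl by (simp add: field_simps)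
  ultimately have K: "11/18 \<le> K" by linarith
  have Kcl: "K * cl = 1 - l2" using cl by (simp add: K_def)
  have a: "cl \<le> a" "a \<le> 2 * l2 * cl" "0 < a"
    using ln_complement_bounds[OF cl] cl by (auto simp: a_def l2_def)
  have a_le: "1 / a \<le> 33/10 * K"
  proof -
    have "1 / a \<le> 1 / cl" using a cl by (simp add: frac_le)
    also have "\<dots> \<le> (33/10 * (1 - l2)) / cl" using cl l2 by (intro divide_right_mono) auto
    finally show ?thesis by (simp add: K_def)
  qed
  have a_ge: "23/10 * K \<le> 1 / a"
  proof -
    have "0 \<le> (l2 - 69/100) * (l2 - 31/100)" using l2 by simp
    then have "l2 * (1 - l2) \<le> 69/100 * (31/100)" by (simp add: field_simps)
    then have "23/10 * (1 - l2) * (2 * l2) \<le> 1" by (simp add: algebra_simps)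
    have "23/10 * K * a \<le> 23/10 * K * (2 * l2 * cl)" using a K by (intro mult_left_mono) auto
    also have "\<dots> = 23/10 * (K * cl) * (2 * l2)" by simp
    also have "\<dots> \<le> 1" unfolding Kcl by fact
    finally show ?thesis using a by (simp add: le_divide_eq)
  qed
  have hp: "0 < h k" if "k \<le> n" for k using h[OF that] eps by simp
  have up: "0 < u k" if "k \<le> n" for k using hp[OF that] Lam by (simp add: u_def)
  have rp: "0 < r k" if "k \<le> n" for k using up[OF that] K by (simp add: r_def)
  have lnr: "ln (r k) = ln (u k) - ln (2 * K)" if "k \<le> n" for k
    using up[OF that] K by (simp add: r_def ln_div)
  have wb: "0 \<le> w k" "w k \<le> 1 / 2" if "k \<le> n" for k
    using spread_bounds[of w n t m k] w0 t m w that by auto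
  have Pln: "ln (r k) / a \<le> P k" if k: "k \<le> n" for k
  proof (cases "u k \<le> 9/10 * K")
    case False
    define z where "z = r k"
    have z: "0 < z" "u k = 2 * K * z" using rp[OF k] K by (auto simp: z_def r_def)
    have "ln z * (1 / a - 14/10 * K) \<le> K * (21/10 * z - 16/10)"
    proof (cases "1 \<le> z")
      case True
      then have "0 \<le> ln z" by simp
      then have "ln z * (1 / a - 14/10 * K) \<le> ln z * (19/10 * K)"
        using a_le by (intro mult_left_mono) auto
      also have "\<dots> \<le> (z - 1) * (19/10 * K)"
        using K ln_le_minus_one[OF z(1)] by (intro mult_right_mono) auto
      also have "\<dots> = K * (19/10 * z - 19/10)" by (simp add: field_simps)
      also have "\<dots> \<le> K * (21/10 * z - 16/10)" using K True by (intro mult_left_mono) auto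
      finally show ?thesis .
    next
      case False
      then have "ln z \<le> 0" using z by simp
      then have "ln z * (1 / a - 14/10 * K) \<le> ln z * (9/10 * K)"
        using a_ge by (intro mult_left_mono_neg) auto
      moreover have "ln z * (9/10 * K) \<le> K * (21/10 * z - 16/10)"
      proof -
        have "ln z = ln (7/3 * z * (6/7) * (1/2))" by (rule arg_cong[of _ _ ln]) simp
        also have "\<dots> = ln (7/3 * z * (6/7)) + ln (1/2)" by (rule ln_mult_pos) (use z in auto)
        also have "ln (7/3 * z * (6/7)) = ln (7/3 * z) + ln (6/7)" by (rule ln_mult_pos) (use z in auto)
        finally have "ln z = ln (7/3 * z) + ln (6/7) + ln (1/2)" .
        moreover have "ln (7/3 * z) \<le> 7/3 * z - 1" by (rule ln_le_minus_one) (use z in simp)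
        moreover have "ln (6/7::real) \<le> 6/7 - 1" by (rule ln_le_minus_one) simp
        moreover have "ln (1/2::real) = - l2" by (simp add: l2_def ln_div)
        ultimately have "ln z * (9/10) \<le> 21/10 * z - 16/10" using l2 by simp
        from mult_left_mono[OF this, of K] K have "K * (ln z * (9/10)) \<le> K * (21/10 * z - 16/10)" by simp
        moreover have "ln z * (9/10 * K) = K * (ln z * (9/10))" by simp
        ultimately show ?thesis by linarith
      qed
      ultimately show ?thesis by linarith
    qed
    moreover have "0 \<le> K * z * w k" using K z wb[OF k] by simp
    moreover have "P k = 21/10 * (K * z) + 11/10 * (K * z * w k) + 14/10 * (K * ln z) - 16/10 * K"
      using False z by (simp add: P_def z_def[symmetric] distrib_left)
    moreover have "ln z * (1 / a - 14/10 * K) = ln z / a - 14/10 * (K * ln z)"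
      by (simp add: right_diff_distrib)
    moreover have "K * (21/10 * z - 16/10) = 21/10 * (K * z) - 16/10 * K"
      by (simp add: right_diff_distrib)
    ultimately show ?thesis unfolding z_def[symmetric] by linarith
  qed (simp add: P_def)
  have Pstep: "P k + 1 \<le> P (Suc k)" if k: "k < n" for k
  proof -
    have kn: "k \<le> n" "Suc k \<le> n" using k by auto
    note pos = hp[OF kn(1)] hp[OF kn(2)] up[OF kn(1)] up[OF kn(2)] rp[OF kn(1)] rp[OF kn(2)]
    note tk = t[OF k]
    have mono: "u k \<le> s * u (Suc k)" if "h (Suc k) \<le> s * h k" for s
      using that pos Lam by (simp add: u_def divide_simps mult.commute)
    show ?thesis
    proof (cases "u k \<le> 9/10 * K")
      case True
      have "h (Suc k) \<le> (1 - cl) * h k"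
      proof (cases "t k = 1")
        case True
        have "h k * (1 / 2) \<le> h k * (1 - cl)" using pos cl by (intro mult_left_mono) auto
        with full[OF k True] show ?thesis by (simp add: mult.commute)
      next
        case False
        then have t1: "t k < 1" using tk by simp
        from short[OF k t1] obtain q \<tau> where q: "0 < q" "q \<le> m k" and tau: "0 < \<tau>" "\<tau> < 1"
          and tau2: "\<tau> \<le> (1 - ln 2) / cl * sqrt q * t k"
          and h1: "h k * (1 - \<tau>) \<le> \<Lambda> * (q * t k)"
          and h2: "h (Suc k) \<le> h k * (1 - t k * (3 / (2 * (3 - \<tau>))))" by blast
        have q1: "q \<le> 1" using q m[OF k] wb[OF kn(1)] by linarith
        have "\<tau> \<le> K * sqrt q * t k" using tau2 by (simp add: K_def l2_def)
        also have "\<dots> \<le> K * 1 * t k" using K q1 tk q by (intro mult_right_mono mult_left_mono) auto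
        finally have i1: "\<tau> \<le> K * t k" by simp
        have "1 - \<tau> \<le> u k * (q * t k)" using h1 pos by (simp add: u_def divide_simps mult.commute)
        also have "\<dots> \<le> (9/10 * K) * (1 * t k)"
          using True q1 q tk pos by (intro mult_mono) auto
        finally have i2: "1 - \<tau> \<le> 9/10 * (K * t k)" by simp
        define x where "x = K * t k"
        \<comment> \<open>Both a large and a small \<open>\<tau>\<close> force a long step: \<open>x \<ge> max \<tau> (10/9 (1 - \<tau>))\<close>.\<close>
        have "31/100 * (2 * (3 - \<tau>)) \<le> x * 3"
          using i1 i2 tau unfolding x_def[symmetric] by (simp add: field_simps)
        then have "31/100 * (2 * (3 - \<tau>)) \<le> K * t k * 3" by (simp add: x_def)
        then have "31/100 \<le> K * t k * 3 / (2 * (3 - \<tau>))" using tau by (subst pos_le_divide_eq) auto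
        then have "K * cl \<le> K * (t k * (3 / (2 * (3 - \<tau>))))" using Kcl l2 by simp
        then have "cl \<le> t k * (3 / (2 * (3 - \<tau>)))" using K by (simp del: times_divide_eq_right)
        then have "h k * (1 - t k * (3 / (2 * (3 - \<tau>)))) \<le> h k * (1 - cl)"
          using pos by (intro mult_left_mono) auto
        then show ?thesis using h2 by (simp add: mult.commute)
      qed
      from mono[OF this] have "r k \<le> (1 - cl) * r (Suc k)"
        using K by (simp add: r_def divide_right_mono)
      then have "ln (r k) \<le> ln ((1 - cl) * r (Suc k))" using pos cl by (subst ln_le_cancel_iff) auto
      also have "\<dots> = ln (r (Suc k)) - a" using pos cl by (simp add: ln_mult a_def)
      finally have "(ln (r k) + a) / a \<le> ln (r (Suc k)) / a" using a by (intro divide_right_mono) auto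
      then have "ln (r k) / a + 1 \<le> ln (r (Suc k)) / a" using a by (simp add: add_divide_distrib)
      with Pln[OF kn(2)] True show ?thesis by (simp add: P_def)
    next
      case False
      have goal: ?thesis if "u k \<le> u (Suc k)"
        "u k * (105/100 + 55/100 * w k) + 14/10 * K * ln (u k) + 1
         \<le> u (Suc k) * (105/100 + 55/100 * w (Suc k)) + 14/10 * K * ln (u (Suc k))"
        using that False by (simp add: P_def lnr[OF kn(1)] lnr[OF kn(2)] right_diff_distrib)
      show ?thesis
      proof (cases "t k = 1")
        case True
        have "u k \<le> 1/2 * u (Suc k)" by (rule mono) (use full[OF k True] in simp)
        then have u2: "2 * u k \<le> u (Suc k)" by simp
        then have "ln (2 * u k) \<le> ln (u (Suc k))" using pos by (subst ln_le_cancel_iff) auto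
        then have "l2 \<le> ln (u (Suc k)) - ln (u k)" using pos by (simp add: ln_mult l2_def)
        then have "K * (69/100) \<le> K * (ln (u (Suc k)) - ln (u k))"
          using K l2 by (intro mult_left_mono) auto
        moreover have "u k * (105/100 + 55/100 * w k) \<le> u k * (105/100 + 55/100 * (1/2))"
          using pos wb[OF kn(1)] by (intro mult_left_mono add_left_mono) auto
        moreover have "u k * (105/100 + 55/100 * (1/2)) = 1325/1000 * u k" by simp
        moreover have "w (Suc k) = 0" using w[OF k] True by simp
        ultimately have "u k * (105/100 + 55/100 * w k) + 14/10 * (K * ln (u k)) + 1
            \<le> u (Suc k) * (105/100) + 14/10 * (K * ln (u (Suc k)))"
          using u2 False K unfolding right_diff_distrib by linarith
        then show ?thesis using u2 pos(3) \<open>w (Suc k) = 0\<close> by (intro goal) simp_all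
      next
        case f: False
        then have t1: "t k < 1" using tk by simp
        from short[OF k t1] obtain q \<tau> where q: "0 < q" "q \<le> m k" and tau: "0 < \<tau>" "\<tau> < 1"
          and tau2: "\<tau> \<le> (1 - ln 2) / cl * sqrt q * t k"
          and h1: "h k * (1 - \<tau>) \<le> \<Lambda> * (q * t k)"
          and h2: "h (Suc k) \<le> h k * (1 - t k * (3 / (2 * (3 - \<tau>))))" by blast
        have i2: "1 - \<tau> \<le> u k * (q * t k)" using h1 pos by (simp add: u_def divide_simps mult.commute)
        have i1: "\<tau> \<le> K * sqrt q * t k" using tau2 by (simp add: K_def l2_def)
        have i3: "u k \<le> u (Suc k) * (1 - t k * (3 / (2 * (3 - \<tau>))))"
          using mono[of "1 - t k * (3 / (2 * (3 - \<tau>)))"] h2 by (simp add: mult.commute)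
        have "0 \<le> u (Suc k) * (t k * (3 / (2 * (3 - \<tau>))))" using pos tk tau by simp
        then have "u k \<le> u (Suc k)" using i3 by (simp add: right_diff_distrib del: times_divide_eq_right)
        then show ?thesis
          using short_step_potential[of "t k" q "m k" "w k" \<tau> K "u k" "u (Suc k)"]
            tk t1 q m[OF k] wb[OF kn(1)] tau i1 i2 i3 pos w[OF k]
          by (intro goal) auto
      qed
    qed
  qed
  have "real n \<le> P n - P 0" by (rule potential_count) (rule Pstep)
  moreover have "ln (r 0) / a \<le> P 0" by (rule Pln) simp
  moreover have "P n + 1 \<le> u n / (2 * (1 - l2))"
  proof (cases "u n \<le> 9/10 * K")
    case True
    then have "r n \<le> 1" using K by (simp add: r_def divide_simps)
    from logarithmic_phase_le_linear[OF cl rp[of n] this] True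
    have "P n + 1 \<le> r n / cl" by (simp add: P_def a_def)
    also have "r n / cl = u n / (2 * (K * cl))" by (simp add: r_def)
    finally show ?thesis using Kcl by simp
  next
    case False
    define z where "z = r n"
    have z: "0 < z" "u n = 2 * K * z" using rp[of n] K by (auto simp: z_def r_def)
    have "ln z = ln (2/5 * z * (5/4) * (2))" by (rule arg_cong[of _ _ ln]) simp
    also have "\<dots> = ln (2/5 * z * (5/4)) + ln (2)" by (rule ln_mult_pos) (use z in auto)
    also have "ln (2/5 * z * (5/4)) = ln (2/5 * z) + ln (5/4)" by (rule ln_mult_pos) (use z in auto)
    finally have "ln z = ln (2/5 * z) + ln (5/4) + ln (2)" .
    moreover have "ln (2/5 * z) \<le> 2/5 * z - 1" by (rule ln_le_minus_one) (use z in simp)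
    moreover have "ln (5/4::real) \<le> 5/4 - 1" by (rule ln_le_minus_one) simp
    ultimately have "14/10 * ln z \<le> 56/100 * z - 7/100" using l2 by (simp add: l2_def[symmetric])
    from mult_left_mono[OF this, of K] K
    have "14/10 * K * ln z - 16/10 * K + 1 \<le> 56/100 * K * z" by (simp add: right_diff_distrib)
    moreover define y where "y = u n * (105/100 + 55/100 * w n)"
    have "y \<le> u n * (105/100 + 55/100 * (1/2))"
      unfolding y_def using up[of n] wb[of n] by (intro mult_left_mono add_left_mono) auto
    then have "y \<le> 265/100 * (K * z)" using z by simp
    moreover have "0 < K * z" using K z by simp
    moreover have "P n = y + 14/10 * K * ln z - 16/10 * K"
      using False by (simp add: P_def z_def[symmetric] y_def)
    ultimately have "P n + 1 \<le> u n * (161/100)" using z by simp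
    also have "\<dots> \<le> u n * (1 / (2 * (1 - l2)))" using l2 up[of n]
      by (intro mult_left_mono) (auto simp: field_simps)
    finally show ?thesis by simp
  qed
  moreover have "u n / (2 * (1 - l2)) \<le> 1 / (2 * (1 - l2) / \<Lambda> * \<epsilon>)"
  proof -
    have "u n \<le> \<Lambda> / \<epsilon>" unfolding u_def using h[of n] eps Lam by (intro divide_left_mono) auto
    from divide_right_mono[OF this, of "2 * (1 - l2)"] l2 show ?thesis by (simp add: mult_ac)
  qed
  moreover have "ln (r 0) / a = - (ln (cl / (h 0 * (2 * (1 - l2) / \<Lambda>))) / ln (1 - cl))"
  proof -
    have "r 0 = cl / (h 0 * (2 * (1 - l2) / \<Lambda>))" using Lam by (simp add: r_def u_def K_def mult_ac)
    then show ?thesis by (simp add: a_def)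
  qed
  ultimately show ?thesis unfolding l2_def by simp
qed

section \<open>The dimensionless upper model\<close>

text \<open>
  \<open>profile \<nu> \<tau> = \<tau>\<^sup>2 \<omega>\<^sub>\<nu>(\<tau>)\<close>. In these terms the upper model is \<open>f x - t G + (e / a)\<^sup>2 profile \<nu> (a t)\<close> with
  \<open>a = M \<delta>\<close>, and the second derivative \<open>profile_curv\<close> of the profile is the extremal solution of the differential
  inequality that generalized self-concordance imposes on the curvature.
\<close>

definition profile :: "real \<Rightarrow> real \<Rightarrow> real" where
  "profile \<nu> \<tau> =
     (if \<nu> = 2 then exp \<tau> - \<tau> - 1
      else if \<nu> = 3 then - \<tau> - ln (1 - \<tau>)
      else (\<nu> - 2) / (4 - \<nu>) * ((\<nu> - 2) / (2 * (3 - \<nu>)) * ((1 - \<tau>) powr (2 * (3 - \<nu>) / (2 - \<nu>)) - 1) - \<tau>))"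

definition profile_slope :: "real \<Rightarrow> real \<Rightarrow> real" where
  "profile_slope \<nu> \<tau> =
     (if \<nu> = 2 then exp \<tau> - 1
      else (\<nu> - 2) / (4 - \<nu>) * ((1 - \<tau>) powr (- ((4 - \<nu>) / (\<nu> - 2))) - 1))"

definition profile_curv :: "real \<Rightarrow> real \<Rightarrow> real" where
  "profile_curv \<nu> \<tau> = (if \<nu> = 2 then exp \<tau> else (1 - \<tau>) powr (- (2 / (\<nu> - 2))))"

definition below_pole :: "real \<Rightarrow> real \<Rightarrow> bool" where
  "below_pole \<nu> \<tau> \<longleftrightarrow> \<nu> = 2 \<or> \<tau> < 1"

lemma below_pole_mono: "below_pole \<nu> \<tau> \<Longrightarrow> \<sigma> \<le> \<tau> \<Longrightarrow> below_pole \<nu> \<sigma>"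
  by (auto simp: below_pole_def)

lemma profile_0 [simp]: "profile \<nu> 0 = 0" and profile_slope_0 [simp]: "profile_slope \<nu> 0 = 0"
  by (auto simp: profile_def profile_slope_def)

lemma DERIV_profile:
  assumes "\<nu> \<in> {2..3}" "below_pole \<nu> \<tau>"
  shows "(profile \<nu> has_real_derivative profile_slope \<nu> \<tau>) (at \<tau>)"
proof (cases "\<nu> = 2")
  case True
  then show ?thesis unfolding profile_def[abs_def] profile_slope_def
    by (auto intro!: derivative_eq_intros)
next
  case False
  then have \<tau>: "\<tau> < 1" and \<nu>: "2 < \<nu>" using assms by (auto simp: below_pole_def)
  show ?thesis
  proof (cases "\<nu> = 3")
    case True
    have "((\<lambda>\<tau>. - \<tau> - ln (1 - \<tau>)) has_real_derivative (-1 - (-1) / (1 - \<tau>))) (at \<tau>)"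
      using \<tau> by (auto intro!: derivative_eq_intros)
    moreover have "-1 - (-1) / (1 - \<tau>) = profile_slope \<nu> \<tau>"
      using True \<tau> by (simp add: profile_slope_def powr_minus divide_inverse)
    ultimately show ?thesis using True by (simp add: profile_def[abs_def])
  next
    case ne: False
    then have \<nu>3: "\<nu> < 3" using assms by simp
    define r where "r = 2 * (3 - \<nu>) / (2 - \<nu>)"
    define k where "k = (\<nu> - 2) / (2 * (3 - \<nu>))"
    have kr: "k * r = -1"
    proof -
      have "n / d * (d / - n) = -1" if "n \<noteq> 0" "d \<noteq> 0" for n d :: real using that by simp
      from this[of "\<nu> - 2" "2 * (3 - \<nu>)"] show ?thesis using \<nu> \<nu>3 by (simp add: k_def r_def)
    qed
    have r1: "r - 1 = - ((4 - \<nu>) / (\<nu> - 2))" using \<nu> by (simp add: r_def field_simps)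
    have "((\<lambda>\<tau>. k * ((1 - \<tau>) powr r - 1) - \<tau>) has_real_derivative
        k * (r * (1 - \<tau>) powr (r - 1) * (-1)) - 1) (at \<tau>)"
      using \<tau> by (auto intro!: derivative_eq_intros simp: powr_diff)
    also have "k * (r * (1 - \<tau>) powr (r - 1) * (-1)) - 1 = - (k * r) * (1 - \<tau>) powr (r - 1) - 1"
      by simp
    finally have "((\<lambda>\<tau>. k * ((1 - \<tau>) powr r - 1) - \<tau>) has_real_derivative
        (1 - \<tau>) powr (- ((4 - \<nu>) / (\<nu> - 2))) - 1) (at \<tau>)"
      unfolding kr r1 by simp
    from DERIV_cmult[OF this, of "(\<nu> - 2) / (4 - \<nu>)"] show ?thesis
      using False ne by (simp add: profile_def[abs_def] profile_slope_def k_def r_def)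
  qed
qed

lemma DERIV_profile_slope:
  assumes "\<nu> \<in> {2..3}" "below_pole \<nu> \<tau>"
  shows "(profile_slope \<nu> has_real_derivative profile_curv \<nu> \<tau>) (at \<tau>)"
proof (cases "\<nu> = 2")
  case True
  then show ?thesis unfolding profile_slope_def[abs_def] profile_curv_def
    by (auto intro!: derivative_eq_intros)
next
  case False
  then have \<tau>: "\<tau> < 1" and \<nu>: "2 < \<nu>" "\<nu> < 4" using assms by (auto simp: below_pole_def)
  define p where "p = (4 - \<nu>) / (\<nu> - 2)"
  have p: "0 < p" "inverse p = (\<nu> - 2) / (4 - \<nu>)" "- p - 1 = - (2 / (\<nu> - 2))"
    using \<nu> by (auto simp: p_def field_simps)
  have "((\<lambda>\<tau>. inverse p * ((1 - \<tau>) powr (- p) - 1)) has_real_derivative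
      inverse p * (- p * (1 - \<tau>) powr (- p - 1) * (-1))) (at \<tau>)"
    using \<tau> by (auto intro!: derivative_eq_intros simp: powr_diff)
  also have "inverse p * (- p * (1 - \<tau>) powr (- p - 1) * (-1)) = (1 - \<tau>) powr (- p - 1)"
    using p(1) by simp
  finally show ?thesis unfolding p(3)
    using False by (simp add: profile_slope_def[abs_def] profile_curv_def p(2)) (simp add: p_def)
qed

lemma profile_curv_mono:
  assumes "\<nu> \<in> {2..3}" "below_pole \<nu> \<tau>" "\<sigma> \<le> \<tau>"
  shows "profile_curv \<nu> \<sigma> \<le> profile_curv \<nu> \<tau>"
proof (cases "\<nu> = 2")
  case False
  then show ?thesis using assms
    by (auto simp: profile_curv_def below_pole_def intro!: powr_mono2')
qed (use assms in \<open>simp add: profile_curv_def\<close>)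

lemma profile_curv_pos: "below_pole \<nu> \<tau> \<Longrightarrow> 0 < profile_curv \<nu> \<tau>"
  by (auto simp: profile_curv_def below_pole_def)

lemma profile_slope_mono:
  assumes "\<nu> \<in> {2..3}" "below_pole \<nu> \<tau>" "\<sigma> \<le> \<tau>"
  shows "profile_slope \<nu> \<sigma> \<le> profile_slope \<nu> \<tau>"
proof (rule DERIV_nonneg_imp_nondecreasing[OF assms(3)])
  fix x assume "\<sigma> \<le> x" "x \<le> \<tau>"
  then have "below_pole \<nu> x" using assms below_pole_mono by blast
  then show "\<exists>y. (profile_slope \<nu> has_real_derivative y) (at x) \<and> 0 \<le> y"
    using DERIV_profile_slope[OF assms(1)] profile_curv_pos less_imp_le by blast
qed

text \<open>
  The slope is convex and vanishes at 0, so the area below its graph is at most that of the triangle.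
\<close>

lemma profile_le_half_slope:
  assumes "\<nu> \<in> {2..3}" "below_pole \<nu> \<tau>" "0 \<le> \<tau>"
  shows "2 * profile \<nu> \<tau> \<le> \<tau> * profile_slope \<nu> \<tau>"
proof -
  have slope: "profile_slope \<nu> x \<le> x * profile_curv \<nu> x" if x: "0 \<le> x" "x \<le> \<tau>" for x
  proof (cases "x = 0")
    case False
    then have "0 < x" using x by simp
    have bp: "below_pole \<nu> y" if "y \<le> x" for y using below_pole_mono[OF assms(2)] that x by simp
    from MVT2[OF \<open>0 < x\<close>, of "profile_slope \<nu>" "profile_curv \<nu>"] bp DERIV_profile_slope[OF assms(1)]
    obtain z where z: "0 < z" "z < x" "profile_slope \<nu> x - profile_slope \<nu> 0 = (x - 0) * profile_curv \<nu> z"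
      by auto
    have "x * profile_curv \<nu> z \<le> x * profile_curv \<nu> x"
      using z x profile_curv_mono[OF assms(1) bp[of x], of z] by (intro mult_left_mono) auto
    then show ?thesis using z by simp
  qed simp
  let ?F = "\<lambda>x. x * profile_slope \<nu> x - 2 * profile \<nu> x"
  have "?F 0 \<le> ?F \<tau>"
  proof (rule DERIV_nonneg_imp_nondecreasing[OF assms(3)])
    fix x assume x: "0 \<le> x" "x \<le> \<tau>"
    then have "below_pole \<nu> x" using assms below_pole_mono by blast
    then have "(?F has_real_derivative profile_slope \<nu> x + x * profile_curv \<nu> x - 2 * profile_slope \<nu> x) (at x)"
      using DERIV_profile_slope[OF assms(1)] DERIV_profile[OF assms(1)]
      by (auto intro!: derivative_eq_intros)
    moreover have "0 \<le> profile_slope \<nu> x + x * profile_curv \<nu> x - 2 * profile_slope \<nu> x"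
      using slope[OF x] by simp
    ultimately show "\<exists>d. (?F has_real_derivative d) (at x) \<and> 0 \<le> d" by blast
  qed
  then show ?thesis by simp
qed

lemma omega_eq_profile:
  assumes "\<nu> \<in> {2..3}" "below_pole \<nu> \<tau>" "\<tau> \<noteq> 0"
  shows "omega \<nu> \<tau> = ereal (profile \<nu> \<tau> / \<tau>\<^sup>2)"
proof -
  consider "\<nu> = 2" | "\<nu> = 3" | "2 < \<nu>" "\<nu> < 3" using assms(1) by fastforce
  then show ?thesis
  proof cases
    case 3
    have "(\<nu> - 2) / (4 - \<nu>) * (1 / \<tau>) * ((\<nu> - 2) / (2 * (3 - \<nu>) * \<tau>) * Z - 1)
      = (\<nu> - 2) / (4 - \<nu>) * ((\<nu> - 2) / (2 * (3 - \<nu>)) * Z - \<tau>) / \<tau>\<^sup>2" for Z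
    proof -
      have "n / (d * \<tau>) * Z - 1 = (n / d * Z - \<tau>) / \<tau>" for n d :: real
        using assms(3) by (simp add: diff_divide_distrib)
      then show ?thesis by (simp add: power2_eq_square)
    qed
    then show ?thesis using 3 assms by (simp add: omega_def profile_def below_pole_def)
  qed (use assms in \<open>auto simp: omega_def profile_def below_pole_def\<close>)
qed

text \<open>
  \<open>C\<close> stands for a conjugate and \<open>T\<close> for its derivative, the optimal step as a function of the slope. Since \<open>T\<close> is
  increasing, \<open>C\<close> grows at least linearly beyond 1; since \<open>T\<close> is star-shaped, as a concave function with value 0 at 0 is,
  \<open>C z / z\<^sup>2\<close> is nonincreasing. Both follow by comparing \<open>C (z u)\<close> with a multiple of \<open>C u\<close> for \<open>u\<close> from 0 to 1.
\<close>

lemma conjugate_growth: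
  fixes C T :: "real \<Rightarrow> real"
  assumes C0: "C 0 = 0"
    and deriv: "\<And>y. 0 \<le> y \<Longrightarrow> (C has_real_derivative T y) (at y)"
    and mono: "\<And>x y. 0 \<le> x \<Longrightarrow> x \<le> y \<Longrightarrow> T x \<le> T y"
    and star: "\<And>x y. 0 \<le> x \<Longrightarrow> x \<le> 1 \<Longrightarrow> 0 \<le> y \<Longrightarrow> x * T y \<le> T (x * y)"
    and z: "0 \<le> z"
  shows "C 1 * min z (z\<^sup>2) \<le> C z"
proof -
  define s where "s = min z (z\<^sup>2)"
  have main: "s * T u \<le> z * T (z * u)" if u: "0 \<le> u" for u
  proof (cases "z \<le> 1")
    case True
    then have "z * z \<le> z" using z mult_left_mono[of z 1 z] by simp
    then have "s = z * z" by (simp add: s_def min_def power2_eq_square)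
    then show ?thesis using mult_left_mono[OF star[OF z True u] z] by (simp add: mult.assoc)
  next
    case False
    then have "s = z" by (simp add: s_def min_def power2_eq_square)
    moreover have "u \<le> z * u" using False u mult_right_mono[of 1 z u] by simp
    ultimately show ?thesis using mult_left_mono[OF mono[OF u] z] by simp
  qed
  let ?R = "\<lambda>u. C (z * u) - s * C u"
  have "?R 0 \<le> ?R 1"
  proof (rule DERIV_nonneg_imp_nondecreasing[where a = 0 and b = 1 and f = ?R])
    fix u :: real assume u: "0 \<le> u" "u \<le> 1"
    have "((\<lambda>u. C (z * u)) has_real_derivative T (z * u) * z) (at u)"
      using u z by (intro DERIV_chain'[where g = C] deriv) (auto intro!: derivative_eq_intros)
    then have "(?R has_real_derivative T (z * u) * z - s * T u) (at u)"
      using u by (intro DERIV_diff DERIV_cmult deriv)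
    then show "\<exists>d. (?R has_real_derivative d) (at u) \<and> 0 \<le> d" using main[OF u(1)] 
      by (intro exI[of _ "T (z * u) * z - s * T u"]) (simp add: mult.commute)
  qed simp
  then show ?thesis using C0 by (simp add: s_def mult.commute)
qed

lemma bernoulli_star:
  fixes x y :: real
  assumes "0 \<le> x" "x \<le> 1" "0 \<le> y"
  shows "(1 + y) powr x \<le> 1 + x * y"
  using powr_young[of "1 + y" x] assms by (simp add: algebra_simps)

text \<open>
  By the substitution \<open>y = exp \<tau> - 1\<close> the right-hand side is the conjugate \<open>(1 + y) ln (1 + y) - y\<close>, with value
  \<open>2 ln 2 - 1\<close> at 1.
\<close>

lemma profile_conjugate_2:
  assumes "0 \<le> \<tau>"
  shows "(2 * ln 2 - 1) * min (profile_slope 2 \<tau>) ((profile_slope 2 \<tau>)\<^sup>2)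
     \<le> \<tau> * profile_slope 2 \<tau> - profile 2 \<tau>"
proof -
  define C where "C y = (1 + y) * ln (1 + y) - y" for y :: real
  have "C 1 * min z (z\<^sup>2) \<le> C z" if "0 \<le> z" for z
  proof (rule conjugate_growth[where T = "\<lambda>y. ln (1 + y)"])
    show "(C has_real_derivative ln (1 + y)) (at y)" if "0 \<le> y" for y
      unfolding C_def[abs_def] using that by (auto intro!: derivative_eq_intros)
    show "x * ln (1 + y) \<le> ln (1 + x * y)" if "0 \<le> x" "x \<le> 1" "0 \<le> y" for x y :: real
    proof -
      have "ln ((1 + y) powr x) \<le> ln (1 + x * y)"
        using bernoulli_star[OF that] that by (subst ln_le_cancel_iff) (auto intro: add_pos_nonneg)
      then show ?thesis using that by (simp add: ln_powr)
    qed
  qed (use that in \<open>auto simp: C_def\<close>)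
  from this[of "exp \<tau> - 1"] show ?thesis using assms
    by (simp add: C_def profile_def profile_slope_def algebra_simps)
qed

text \<open>
  With \<open>z = p y\<close> for the slope \<open>y\<close> at \<open>\<tau>\<close>, \<open>p\<close> times the conjugate is
  \<open>z - p / (p - 1) ((1 + z)\<^bsup>1 - 1/p\<^esup> - 1)\<close>, whose value at \<open>z = 1\<close> is the constant \<open>gamma_tilde\<close>.
\<close>

lemma gamma_tilde_conjugate:
  assumes "2 < \<nu>" "\<nu> < 3" "0 \<le> \<tau>" "\<tau> < 1"
  defines "p \<equiv> (4 - \<nu>) / (\<nu> - 2)"
  shows "gamma_tilde \<nu> * min (profile_slope \<nu> \<tau>) (p * (profile_slope \<nu> \<tau>)\<^sup>2)
     \<le> \<tau> * profile_slope \<nu> \<tau> - profile \<nu> \<tau>" and "0 < gamma_tilde \<nu>"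
proof -
  have p: "1 < p" using assms by (simp add: p_def field_simps)
  define c where "c = (4 - \<nu>) / (2 * (3 - \<nu>))"
  have c: "c * (1 - 1 / p) = 1" "c = p / (p - 1)" "1 - 1 / p = 2 * (3 - \<nu>) / (4 - \<nu>)"
    using assms(1,2) by (simp_all add: c_def p_def divide_simps)
  define C where "C y = y - c * ((1 + y) powr (1 - 1 / p) - 1)" for y :: real
  define T where "T y = 1 - (1 + y) powr (- (1 / p))" for y :: real
  have C1: "C 1 = gamma_tilde \<nu>"
    unfolding C_def gamma_tilde_def c(3) c_def[symmetric] by (simp add: right_diff_distrib)
  have dC: "(C has_real_derivative T y) (at y)" if "0 \<le> y" for y
  proof -
    have "((\<lambda>y. y - c * ((1 + y) powr r - 1)) has_real_derivative
        1 - c * (r * (1 + y) powr (r - 1))) (at y)" for r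
      using that by (auto intro!: derivative_eq_intros simp: powr_diff)
    then have "(C has_real_derivative 1 - c * ((1 - 1 / p) * (1 + y) powr (1 - 1 / p - 1))) (at y)"
      unfolding C_def[abs_def] .
    also have "c * ((1 - 1 / p) * (1 + y) powr (1 - 1 / p - 1)) = (1 + y) powr (- (1 / p))"
      using c(1) by (simp add: mult.assoc[symmetric])
    finally show ?thesis by (simp add: T_def)
  qed
  have T_mono: "T x \<le> T y" if "0 \<le> x" "x \<le> y" for x y
    unfolding T_def using that p by (auto intro!: powr_mono2')
  have growth: "C 1 * min z (z\<^sup>2) \<le> C z" if "0 \<le> z" for z
  proof (rule conjugate_growth[where T = T])
    show "x * T y \<le> T (x * y)" if "0 \<le> x" "x \<le> 1" "0 \<le> y" for x y :: real
    proof -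
      have "(1 + x * y) powr (- (1 / p)) \<le> ((1 + y) powr x) powr (- (1 / p))"
        using bernoulli_star[OF that] p that by (intro powr_mono2') auto
      also have "\<dots> = ((1 + y) powr (- (1 / p))) powr x" by (simp add: powr_powr mult.commute)
      also have "\<dots> \<le> 1 - x + x * (1 + y) powr (- (1 / p))"
        using that by (intro powr_young) auto
      finally show ?thesis by (simp add: T_def algebra_simps)
    qed
  next
    show "C 0 = 0" by (simp add: C_def)
  qed (use that dC T_mono in auto)
  show "0 < gamma_tilde \<nu>"
  proof -
    have "C 0 < C 1"
    proof (rule DERIV_pos_imp_increasing_open[where a = 0 and b = 1 and f = C])
      fix y :: real assume y: "0 < y" "y < 1"
      have "(1 + y) powr (- (1 / p)) < (1 + y) powr 0" using y p by (intro powr_less_mono) auto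
      then have "0 < T y" using y by (simp add: T_def)
      then show "\<exists>d. (C has_real_derivative d) (at y) \<and> 0 < d" using dC[of y] y by auto
    next
      show "continuous_on {0..1} C"
        using dC by (meson atLeastAtMost_iff continuous_at_imp_continuous_on DERIV_isCont)
    qed simp
    then show ?thesis by (simp add: C1) (simp add: C_def)
  qed
  define y where "y = profile_slope \<nu> \<tau>"
  define X where "X = (1 - \<tau>) powr (1 - p)"
  have ip: "(\<nu> - 2) / (4 - \<nu>) = 1 / p" using assms(1,2) by (simp add: p_def)
  have y: "1 + p * y = (1 - \<tau>) powr (- p)"
    using assms(1) p by (simp add: y_def profile_slope_def ip) (simp add: p_def)
  have y0: "0 \<le> y" using profile_slope_mono[of \<nu> \<tau> 0] assms by (simp add: y_def below_pole_def)
  have X1: "X = (1 - \<tau>) * (1 + p * y)" unfolding y X_def using assms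
    by (simp add: powr_diff powr_minus divide_inverse)
  have X2: "(1 + p * y) powr (1 - 1 / p) = X"
    unfolding y X_def powr_powr using p by (simp add: algebra_simps)
  have expo: "2 * (3 - \<nu>) / (2 - \<nu>) = 1 - p" "(\<nu> - 2) / (2 * (3 - \<nu>)) = 1 / (p - 1)"
    using assms(1,2) by (simp_all add: p_def divide_simps) (simp_all add: algebra_simps)
  have prof: "profile \<nu> \<tau> = 1 / p * (1 / (p - 1) * (X - 1) - \<tau>)"
  proof -
    have "\<nu> \<noteq> 2" "\<nu> \<noteq> 3" using assms(1,2) by auto
    then show ?thesis unfolding profile_def ip expo X_def by simp
  qed
  have "p * (\<tau> * y - profile \<nu> \<tau>) = p * y * \<tau> - (1 / (p - 1) * (X - 1) - \<tau>)"
  proof -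
    have "p * (\<tau> * y - 1 / p * Z) = p * y * \<tau> - Z" for Z using p by (simp add: right_diff_distrib)
    then show ?thesis unfolding prof .
  qed
  also have "\<dots> = \<tau> * (1 + p * y) - (X - 1) / (p - 1)" by (simp add: distrib_left)
  also have "\<tau> * (1 + p * y) = 1 + p * y - X" by (simp add: X1 algebra_simps)
  also have "1 + p * y - X - (X - 1) / (p - 1) = p * y - c * (X - 1)"
  proof -
    have "p / (p - 1) = 1 + 1 / (p - 1)" using p by (simp add: field_simps)
    then show ?thesis unfolding c(2) by (simp add: distrib_right)
  qed
  also have "\<dots> = C (p * y)" by (simp add: C_def X2)
  finally have "C 1 * min (p * y) ((p * y)\<^sup>2) \<le> p * (\<tau> * y - profile \<nu> \<tau>)"
    using growth[of "p * y"] y0 p by simp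
  moreover have "min (p * y) ((p * y)\<^sup>2) = p * min y (p * y\<^sup>2)"
    using p by (simp add: min_mult_distrib_left power2_eq_square mult_ac)
  ultimately have "p * (C 1 * min y (p * y\<^sup>2)) \<le> p * (\<tau> * y - profile \<nu> \<tau>)" by (simp add: mult_ac)
  then show "gamma_tilde \<nu> * min (profile_slope \<nu> \<tau>) (p * (profile_slope \<nu> \<tau>)\<^sup>2)
     \<le> \<tau> * profile_slope \<nu> \<tau> - profile \<nu> \<tau>"
    using p by (simp add: C1 y_def)
qed

text \<open>
  The conjugate is \<open>y - ln (1 + y)\<close> with \<open>y = \<tau> / (1 - \<tau>)\<close>. Keeping the dependence on \<open>\<tau>\<close>, instead of
  reducing to \<open>min y y\<^sup>2\<close>, retains the gain of steps that come close to the pole.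
\<close>

lemma profile_conjugate_3:
  assumes "0 \<le> \<tau>" "\<tau> < 1"
  shows "profile_slope 3 \<tau> = \<tau> / (1 - \<tau>)"
    and "\<tau> * (\<tau> / (1 - \<tau>)) * (3 / (2 * (3 - \<tau>))) \<le> \<tau> * profile_slope 3 \<tau> - profile 3 \<tau>"
proof -
  have inv: "1 + \<tau> / (1 - \<tau>) = 1 / (1 - \<tau>)" using assms by (simp add: field_simps)
  show s: "profile_slope 3 \<tau> = \<tau> / (1 - \<tau>)" using inv assms
    by (simp add: profile_slope_def powr_minus divide_inverse)
  define y where "y = \<tau> / (1 - \<tau>)"
  have y: "0 \<le> y" "\<tau> = y / (1 + y)" using assms by (auto simp: y_def field_simps)
  have "\<tau> * profile_slope 3 \<tau> - profile 3 \<tau> = \<tau> * y + \<tau> - ln (1 + y)"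
    using assms inv by (simp add: s profile_def y_def ln_div)
  also have "\<tau> * y + \<tau> = y" using y by (simp add: field_simps)
  also have "y - ln (1 + y) \<ge> y - y * (y + 6) / (4 * y + 6)" using ln_one_plus_le_pade[OF y(1)] by simp
  also have "y - y * (y + 6) / (4 * y + 6) = \<tau> * y * (3 / (2 * (3 - \<tau>)))"
  proof -
    have d: "3 - \<tau> = (3 + 2 * y) / (1 + y)" using y by (simp add: field_simps)
    have "\<tau> * y * (3 / (2 * (3 - \<tau>))) = 3 * y\<^sup>2 / (2 * (3 + 2 * y))"
      unfolding d y(2) using y(1) by (simp add: power2_eq_square divide_simps) (simp add: algebra_simps)
    moreover have "y - y * (y + 6) / (4 * y + 6) = 3 * y\<^sup>2 / (2 * (3 + 2 * y))"
      using y(1) by (simp add: field_simps power2_eq_square)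
    ultimately show ?thesis by simp
  qed
  finally show "\<tau> * (\<tau> / (1 - \<tau>)) * (3 / (2 * (3 - \<tau>))) \<le> \<tau> * profile_slope 3 \<tau> - profile 3 \<tau>"
    by (simp add: y_def)
qed

text \<open>
  The step size formulas are the solutions of the stationarity equation of the upper model.
\<close>

lemma t_step_profile:
  assumes \<nu>: "\<nu> \<in> {2..3}" and pos: "0 < M" "0 < delta_FW f s \<nu> x" "0 < Gap f X x" "0 < e_FW f s x"
  defines "a \<equiv> M * delta_FW f s \<nu> x"
  defines "\<tau> \<equiv> a * t_step f X s \<nu> M x"
  shows "0 < \<tau>" "below_pole \<nu> \<tau>" "profile_slope \<nu> \<tau> = a * Gap f X x / (e_FW f s x)\<^sup>2"
proof -
  define G e where "G = Gap f X x" and "e = e_FW f s x"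
  have a: "0 < a" using pos by (simp add: a_def)
  define y where "y = a * G / e\<^sup>2"
  have y: "0 < y" using a pos by (simp add: y_def G_def e_def)
  have "0 < \<tau> \<and> below_pole \<nu> \<tau> \<and> profile_slope \<nu> \<tau> = y"
  proof -
    consider "\<nu> = 2" | "\<nu> = 3" | "2 < \<nu>" "\<nu> < 3" using \<nu> by fastforce
    then show ?thesis
    proof cases
      case 1
      have "\<tau> = ln (1 + y)" using 1 a pos
        by (simp add: \<tau>_def t_step_def Let_def a_def y_def G_def e_def mult_ac)
      then show ?thesis using y 1 by (simp add: below_pole_def profile_slope_def)
    next
      case 2
      have "\<tau> = y / (1 + y)"
      proof -
        have "G / (a * G + e\<^sup>2) = (G / e\<^sup>2) / (1 + y)"
          using pos by (simp add: y_def e_def divide_simps add_ac)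
        then show ?thesis using 2 by (simp add: \<tau>_def t_step_def Let_def a_def y_def G_def e_def)
      qed
      moreover from this have "1 - \<tau> = 1 / (1 + y)" using y by (simp add: divide_simps) (simp add: algebra_simps)
      ultimately have "0 < \<tau>" "\<tau> < 1" "\<tau> / (1 - \<tau>) = y" using y by simp_all
      then show ?thesis using 2 profile_conjugate_3(1)[of \<tau>] by (simp add: below_pole_def)
    next
      case 3
      define p where "p = (4 - \<nu>) / (\<nu> - 2)"
      have p: "0 < p" "(\<nu> - 2) / (4 - \<nu>) = 1 / p" using 3 by (auto simp: p_def)
      have "\<tau> = 1 - (1 + y * p) powr (- ((\<nu> - 2) / (4 - \<nu>)))" using 3 a
        by (simp add: \<tau>_def t_step_def Let_def a_def y_def G_def e_def p_def)
      then have \<tau>: "1 - \<tau> = (1 + y * p) powr (- (1 / p))" by (simp add: p(2))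
      have yp: "0 < y * p" using y p by simp
      then have "(1 + y * p) powr (- (1 / p)) < (1 + y * p) powr 0"
        using p by (intro powr_less_mono) auto
      moreover have "0 < (1 + y * p) powr (- (1 / p))" using yp by simp
      moreover have "(1 + y * p) powr 0 = 1" using yp by simp
      ultimately have "0 < \<tau>" "\<tau> < 1" using \<tau> by linarith+
      moreover have "profile_slope \<nu> \<tau> = y"
      proof -
        have "profile_slope \<nu> \<tau> = 1 / p * ((1 - \<tau>) powr (- p) - 1)"
          using 3 by (simp add: profile_slope_def p(2)) (simp add: p_def)
        also have "(1 - \<tau>) powr (- p) = 1 + y * p"
          unfolding \<tau> powr_powr using p yp by simp
        finally show ?thesis using p by simp
      qed
      ultimately show ?thesis by (simp add: below_pole_def)
    qed
  qed
  then show "0 < \<tau>" "below_pole \<nu> \<tau>" "profile_slope \<nu> \<tau> = a * Gap f X x / (e_FW f s x)\<^sup>2"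
    by (auto simp: y_def G_def e_def)
qed

section \<open>Generalized self-concordance along a segment\<close>

lemma frechet_derivative_eq_inner:
  fixes F :: "real^'n \<Rightarrow> real"
  assumes "F differentiable (at x)"
  shows "(F has_derivative (\<lambda>h. (\<chi> i. frechet_derivative F (at x) (axis i 1)) \<bullet> h)) (at x)"
proof -
  have lin: "linear (frechet_derivative F (at x))"
    using assms linear_frechet_derivative by blast
  have "(\<chi> i. frechet_derivative F (at x) (axis i 1)) \<bullet> h = frechet_derivative F (at x) h" for h
  proof -
    have "frechet_derivative F (at x) h
        = frechet_derivative F (at x) (\<Sum>i\<in>UNIV. h $ i *\<^sub>R axis i 1)"
      using basis_expansion[of h] by (simp add: scalar_mult_eq_scaleR)
    also have "\<dots> = (\<Sum>i\<in>UNIV. h $ i * frechet_derivative F (at x) (axis i 1))"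
      by (simp add: linear_sum[OF lin] linear_scale[OF lin])
    finally show ?thesis by (simp add: inner_vec_def mult.commute)
  qed
  then show ?thesis using assms by (simp add: frechet_derivative_works)
qed

lemma bounded_linear_quadratic_form:
  "bounded_linear (\<lambda>A::real^'n^'n. (A *v v) \<bullet> v)"
proof -
  have "linear (\<lambda>A::real^'n^'n. (A *v v) \<bullet> v)"
    by (rule linearI) (simp_all add: matrix_vector_mult_add_rdistrib inner_add_left scaleR_matrix_vector_assoc[symmetric])
  then show ?thesis by (simp add: linear_conv_bounded_linear)
qed

text \<open>
  For \<open>\<nu> = 2\<close> this is Gronwall; for \<open>\<nu> > 2\<close> the function \<open>p\<^bsup>-k\<^esup>\<close> with \<open>k = (\<nu> - 2) / 2\<close> decreases at most
  linearly.
\<close>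

lemma curvature_growth:
  fixes p p' :: "real \<Rightarrow> real"
  assumes \<nu>: "\<nu> \<in> {2..3}" and t: "0 \<le> t" and C: "0 \<le> C"
    and deriv: "\<And>s. 0 \<le> s \<Longrightarrow> s \<le> t \<Longrightarrow> (p has_real_derivative p' s) (at s)"
    and pos: "\<And>s. 0 \<le> s \<Longrightarrow> s \<le> t \<Longrightarrow> 0 < p s"
    and le: "\<And>s. 0 \<le> s \<Longrightarrow> s \<le> t \<Longrightarrow> p' s \<le> C * p s * rpow (sqrt (p s)) (\<nu> - 2)"
    and a: "a = (if \<nu> = 2 then C else (\<nu> - 2) / 2 * C * rpow (sqrt (p 0)) (\<nu> - 2))"
    and pole: "below_pole \<nu> (a * t)"
  shows "p t \<le> p 0 * profile_curv \<nu> (a * t)"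
proof (cases "\<nu> = 2")
  case True
  let ?q = "\<lambda>s. - (p s * exp (- (C * s)))"
  have "?q 0 \<le> ?q t"
  proof (rule DERIV_nonneg_imp_nondecreasing[OF t])
    fix s assume s: "0 \<le> s" "s \<le> t"
    have "(?q has_real_derivative (C * p s - p' s) * exp (- (C * s))) (at s)"
      by (rule derivative_eq_intros deriv[OF s] refl | simp add: algebra_simps)+
    moreover have "0 \<le> (C * p s - p' s) * exp (- (C * s))" using le[OF s] True by (simp add: rpow_def)
    ultimately show "\<exists>d. (?q has_real_derivative d) (at s) \<and> 0 \<le> d" by blast
  qed
  then show ?thesis using True a by (simp add: profile_curv_def exp_minus field_simps)
next
  case False
  define k where "k = (\<nu> - 2) / 2"
  have k: "0 < k" "\<nu> - 2 = 2 * k" using False \<nu> by (auto simp: k_def)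
  have rp: "rpow (sqrt z) (\<nu> - 2) = z powr k" if "0 < z" for z
    using k that by (simp add: rpow_def powr_half_sqrt[symmetric] powr_powr)
  have a': "a = k * C * p 0 powr k" using a False rp pos[of 0] t by (simp add: k_def)
  have at: "a * t < 1" using pole False by (simp add: below_pole_def)
  let ?q = "\<lambda>s. p s powr (- k) + k * C * s"
  have "?q 0 \<le> ?q t"
  proof (rule DERIV_nonneg_imp_nondecreasing[OF t])
    fix s assume s: "0 \<le> s" "s \<le> t"
    have "((\<lambda>s. p s powr (- k)) has_real_derivative (- k * p s powr (- k - 1) * p' s)) (at s)"
      using pos[OF s] by (rule has_real_derivative_powr[THEN DERIV_chain2]) (rule deriv[OF s])
    then have "(?q has_real_derivative (- k * p s powr (- k - 1) * p' s + k * C)) (at s)"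
      by (rule DERIV_add) (auto intro!: derivative_eq_intros)
    moreover have "0 \<le> - k * p s powr (- k - 1) * p' s + k * C"
    proof -
      have "p s powr (- k - 1) * p' s \<le> p s powr (- k - 1) * (C * p s * p s powr k)"
        using le[OF s] rp[OF pos[OF s]] by (intro mult_left_mono) auto
      also have "\<dots> = C * (p s powr (- k - 1) * (p s powr 1 * p s powr k))" using pos[OF s] by simp
      also have "\<dots> = C" using pos[OF s] unfolding powr_add[symmetric] by simp
      finally show ?thesis using k mult_left_mono[of _ C k] by (simp add: mult.assoc)
    qed
    ultimately show "\<exists>d. (?q has_real_derivative d) (at s) \<and> 0 \<le> d" by blast
  qed
  then have "p 0 powr (- k) - k * C * t \<le> p t powr (- k)" by simp
  moreover have "p 0 powr (- k) - k * C * t = p 0 powr (- k) * (1 - a * t)"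
    using pos[of 0] t by (simp add: a' right_diff_distrib powr_minus)
  ultimately have "(p t powr (- k)) powr (- (1 / k)) \<le> (p 0 powr (- k) * (1 - a * t)) powr (- (1 / k))"
    using k pos[of 0] t at by (intro powr_mono2') auto
  then have "p t \<le> p 0 * (1 - a * t) powr (- (1 / k))"
    using k pos[of 0] pos[of t] t at by (simp add: powr_mult powr_powr)
  moreover have "1 / k = 2 / (\<nu> - 2)" by (simp add: k_def)
  ultimately show ?thesis using False by (simp add: profile_curv_def)
qed

lemma second_order_comparison:
  fixes \<phi> \<phi>' p :: "real \<Rightarrow> real"
  assumes \<nu>: "\<nu> \<in> {2..3}" and t: "0 \<le> t" and a: "0 < a" and pole: "below_pole \<nu> (a * t)"
    and d1: "\<And>s. 0 \<le> s \<Longrightarrow> s \<le> t \<Longrightarrow> (\<phi> has_real_derivative \<phi>' s) (at s)"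
    and d2: "\<And>s. 0 \<le> s \<Longrightarrow> s \<le> t \<Longrightarrow> (\<phi>' has_real_derivative p s) (at s)"
    and p: "\<And>s. 0 \<le> s \<Longrightarrow> s \<le> t \<Longrightarrow> p s \<le> E * profile_curv \<nu> (a * s)"
  shows "\<phi> t \<le> \<phi> 0 + t * \<phi>' 0 + E / a\<^sup>2 * profile \<nu> (a * t)"
proof -
  have bp: "below_pole \<nu> (a * s)" if "s \<le> t" for s
    using below_pole_mono[OF pole] that a by (simp add: mult_left_mono)
  have scale: "((\<lambda>s. h (a * s)) has_real_derivative d * a) (at s)"
    if "(h has_real_derivative d) (at (a * s))" for h d s
    by (rule DERIV_chain2[where g = "\<lambda>s. a * s", OF that]) (auto intro!: derivative_eq_intros)
  let ?d = "\<lambda>s. \<phi>' 0 + E / a * profile_slope \<nu> (a * s) - \<phi>' s"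
  let ?F = "\<lambda>s. \<phi> 0 + s * \<phi>' 0 + E / a\<^sup>2 * profile \<nu> (a * s) - \<phi> s"
  have slope: "0 \<le> ?d s" if s: "0 \<le> s" "s \<le> t" for s
  proof -
    have "?d 0 \<le> ?d s"
    proof (rule DERIV_nonneg_imp_nondecreasing[OF s(1)])
      fix r assume r: "0 \<le> r" "r \<le> s"
      then have rt: "r \<le> t" using s by simp
      have "(?d has_real_derivative 0 + E / a * (profile_curv \<nu> (a * r) * a) - p r) (at r)"
        using r rt by (intro DERIV_diff DERIV_add DERIV_const DERIV_cmult scale d2
            DERIV_profile_slope \<nu> bp) auto
      moreover have "0 \<le> 0 + E / a * (profile_curv \<nu> (a * r) * a) - p r" using p[OF r(1) rt] a by simp
      ultimately show "\<exists>d. (?d has_real_derivative d) (at r) \<and> 0 \<le> d" by blast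
    qed
    then show ?thesis by simp
  qed
  have "?F 0 \<le> ?F t"
  proof (rule DERIV_nonneg_imp_nondecreasing[OF t])
    fix r assume r: "0 \<le> r" "r \<le> t"
    have "(?F has_real_derivative 0 + 1 * \<phi>' 0 + E / a\<^sup>2 * (profile_slope \<nu> (a * r) * a) - \<phi>' r) (at r)"
      using r by (intro DERIV_diff DERIV_add DERIV_const DERIV_cmult DERIV_cmult_right DERIV_ident scale d1
          DERIV_profile \<nu> bp) auto
    moreover have "E / a\<^sup>2 * (profile_slope \<nu> (a * r) * a) = E / a * profile_slope \<nu> (a * r)"
      using a by (simp add: power2_eq_square)
    ultimately show "\<exists>d. (?F has_real_derivative d) (at r) \<and> 0 \<le> d" using slope[OF r] by auto
  qed
  then show ?thesis by simp
qed

text \<open>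
  Lower semicontinuity carries a bound to the end point of a segment; this is how the domain is seen to
  contain the whole step.
\<close>

lemma lower_semicont_at_left_bound:
  fixes f :: "'a::real_normed_vector \<Rightarrow> ereal"
  assumes lsc: "lower_semicont f" and "0 < t" "v \<noteq> 0"
    and bound: "\<And>s. 0 \<le> s \<Longrightarrow> s < t \<Longrightarrow> f (x + s *\<^sub>R v) \<le> c"
  shows "f (x + t *\<^sub>R v) \<le> c"
proof (rule ccontr)
  assume "\<not> ?thesis"
  then have "c < Liminf (at (x + t *\<^sub>R v)) f"
    using lsc unfolding lower_semicont_def by (meson le_less_trans not_le order_less_le_trans)
  then have "eventually (\<lambda>y. c < f y) (at (x + t *\<^sub>R v))" by (rule less_LiminfD)
  moreover have "filterlim (\<lambda>s. x + s *\<^sub>R v) (at (x + t *\<^sub>R v)) (at_left t)"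
  proof (rule filterlim_atI)
    show "((\<lambda>s. x + s *\<^sub>R v) \<longlongrightarrow> x + t *\<^sub>R v) (at_left t)" by (intro tendsto_intros)
    show "eventually (\<lambda>s. x + s *\<^sub>R v \<noteq> x + t *\<^sub>R v) (at_left t)"
      using \<open>v \<noteq> 0\<close> by (auto simp: eventually_at_filter)
  qed
  ultimately have "eventually (\<lambda>s. c < f (x + s *\<^sub>R v)) (at_left t)"
    by (rule eventually_compose_filterlim)
  moreover have "eventually (\<lambda>s. s \<in> {0<..<t}) (at_left t)"
    by (rule eventually_at_leftI[of 0]) (use \<open>0 < t\<close> in auto)
  ultimately have "eventually (\<lambda>s. False) (at_left t)"
    by eventually_elim (use bound in \<open>force simp: not_le[symmetric]\<close>)
  then show False by simp
qed

locale gsc_problem =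
  fixes f :: "real^'n \<Rightarrow> ereal" and X :: "(real^'n) set" and \<nu> Mf :: real
  assumes nu: "\<nu> \<in> {2..3}" and gsc: "f \<in> gsc_class Mf \<nu>"
    and conv_X: "convex X" and comp_X: "compact X"
    and cont_hess: "continuous_on (X \<inter> effdom f) (hess f)"
    and posdef: "\<forall>y \<in> X \<inter> effdom f. \<forall>u. u \<noteq> 0 \<longrightarrow> (hess f y *v u) \<bullet> u > 0"
begin

abbreviation F :: "real^'n \<Rightarrow> real" where "F y \<equiv> real_of_ereal (f y)"

lemma not_minf: "f y \<noteq> -\<infinity>" and lsc: "lower_semicont f" and open_dom: "open (effdom f)"
  and C3: "C3_on (effdom f) f"
  using gsc by (auto simp: gsc_class_def)

lemma f_eq: "y \<in> effdom f \<Longrightarrow> f y = ereal (F y)"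
  using not_minf[of y] by (cases "f y") (auto simp: effdom_def)

lemma convex_dom: "convex (effdom f)"
proof (rule convexI)
  fix x y u v assume xy: "x \<in> effdom f" "y \<in> effdom f" and uv: "0 \<le> u" "0 \<le> v" "u + v = (1::real)"
  have "f ((1 - v) *\<^sub>R x + v *\<^sub>R y) \<le> ereal (1 - v) * f x + ereal v * f y"
    using gsc uv by (auto simp: gsc_class_def ereal_convex_def)
  also have "\<dots> < \<infinity>"
  proof -
    obtain a b where "f x = ereal a" "f y = ereal b" using f_eq xy by blast
    then show ?thesis by simp
  qed
  finally have "f ((1 - v) *\<^sub>R x + v *\<^sub>R y) < \<infinity>" .
  moreover have "1 - v = u" using uv by simp
  ultimately show "u *\<^sub>R x + v *\<^sub>R y \<in> effdom f" by (simp add: effdom_def)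
qed

lemma F_deriv: "y \<in> effdom f \<Longrightarrow> (F has_derivative (\<lambda>h. grad f y \<bullet> h)) (at y)"
  unfolding grad_def using C3 open_dom
  by (intro frechet_derivative_eq_inner) (auto simp: C3_on_def differentiable_on_eq_differentiable_at)

lemma grad_deriv: "y \<in> effdom f \<Longrightarrow> (grad f has_derivative (\<lambda>h. hess f y *v h)) (at y)"
  unfolding hess_def jacobian_works[symmetric] using C3 open_dom
  by (auto simp: C3_on_def differentiable_on_eq_differentiable_at)

lemma hess_deriv: "y \<in> effdom f \<Longrightarrow> (hess f has_derivative D3 f y) (at y)"
proof -
  assume "y \<in> effdom f"
  then have "hess f differentiable (at y)" using C3 open_dom
    by (auto simp: C3_on_def differentiable_on_eq_differentiable_at)
  then have "(hess f has_derivative frechet_derivative (hess f) (at y)) (at y)"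
    by (simp add: frechet_derivative_works)
  moreover have "frechet_derivative (hess f) (at y) = D3 f y" by (auto simp: D3_def)
  ultimately show ?thesis by simp
qed

lemma line_deriv:
  assumes "x + t *\<^sub>R v \<in> effdom f"
  shows "((\<lambda>t. F (x + t *\<^sub>R v)) has_real_derivative grad f (x + t *\<^sub>R v) \<bullet> v) (at t)"
    and "((\<lambda>t. grad f (x + t *\<^sub>R v) \<bullet> v) has_real_derivative (hess f (x + t *\<^sub>R v) *v v) \<bullet> v) (at t)"
    and "((\<lambda>t. (hess f (x + t *\<^sub>R v) *v v) \<bullet> v) has_real_derivative (D3 f (x + t *\<^sub>R v) v *v v) \<bullet> v) (at t)"
proof -
  let ?z = "x + t *\<^sub>R v"
  have g: "((\<lambda>t. x + t *\<^sub>R v) has_derivative (\<lambda>h. h *\<^sub>R v)) (at t)"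
    by (auto intro!: derivative_eq_intros)
  have "((\<lambda>t. F (x + t *\<^sub>R v)) has_derivative (\<lambda>h. grad f ?z \<bullet> (h *\<^sub>R v))) (at t)"
    using has_derivative_compose[OF g F_deriv[OF assms]] by simp
  then show "((\<lambda>t. F (x + t *\<^sub>R v)) has_real_derivative grad f ?z \<bullet> v) (at t)"
    unfolding has_field_derivative_def by (rule has_derivative_eq_rhs) (simp add: fun_eq_iff mult.commute)
  have "((\<lambda>t. grad f (x + t *\<^sub>R v)) has_derivative (\<lambda>h. hess f ?z *v (h *\<^sub>R v))) (at t)"
    using has_derivative_compose[OF g grad_deriv[OF assms]] by simp
  from has_derivative_inner_left[OF this, of v]
  show "((\<lambda>t. grad f (x + t *\<^sub>R v) \<bullet> v) has_real_derivative (hess f ?z *v v) \<bullet> v) (at t)"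
    unfolding has_field_derivative_def
    by (rule has_derivative_eq_rhs) (simp add: fun_eq_iff matrix_vector_mult_scaleR mult.commute)
  have "((\<lambda>t. hess f (x + t *\<^sub>R v)) has_derivative (\<lambda>h. D3 f ?z (h *\<^sub>R v))) (at t)"
    using has_derivative_compose[OF g hess_deriv[OF assms]] by simp
  from bounded_linear.has_derivative[OF bounded_linear_quadratic_form this, of v]
  have "((\<lambda>t. (hess f (x + t *\<^sub>R v) *v v) \<bullet> v) has_derivative (\<lambda>h. (D3 f ?z (h *\<^sub>R v) *v v) \<bullet> v)) (at t)" .
  moreover have "linear (D3 f ?z)" using hess_deriv[OF assms] has_derivative_linear by blast
  then have "(\<lambda>h. (D3 f ?z (h *\<^sub>R v) *v v) \<bullet> v) = (*) ((D3 f ?z v *v v) \<bullet> v)"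
    by (simp add: fun_eq_iff linear_scale scaleR_matrix_vector_assoc[symmetric] mult.commute)
  ultimately show "((\<lambda>t. (hess f (x + t *\<^sub>R v) *v v) \<bullet> v) has_real_derivative (D3 f ?z v *v v) \<bullet> v) (at t)"
    unfolding has_field_derivative_def by simp
qed

lemma local_norm_sq:
  assumes "y \<in> X" "y \<in> effdom f"
  shows "(local_norm f y u)\<^sup>2 = (hess f y *v u) \<bullet> u"
proof -
  have "0 \<le> (hess f y *v u) \<bullet> u" using posdef assms by (cases "u = 0") (auto intro: less_imp_le)
  then show ?thesis by (simp add: local_norm_def)
qed

lemma local_norm_pos: "y \<in> X \<Longrightarrow> y \<in> effdom f \<Longrightarrow> u \<noteq> 0 \<Longrightarrow> 0 < local_norm f y u"
  using posdef by (simp add: local_norm_def)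

lemma segment_in_X:
  assumes "x \<in> X" "d \<in> X" "0 \<le> t" "t \<le> 1"
  shows "x + t *\<^sub>R (d - x) \<in> X"
  using convexD_alt[OF conv_X assms] by (simp add: algebra_simps)

text \<open>
  The Hessian is positive semidefinite on the segment, so the slope of \<open>f\<close> along it is nondecreasing.
\<close>

lemma gradient_inequality:
  assumes "x \<in> X \<inter> effdom f" "y \<in> X \<inter> effdom f"
  shows "F x - F y \<le> grad f x \<bullet> (x - y)"
proof -
  let ?v = "y - x"
  have seg: "x + t *\<^sub>R ?v \<in> X \<inter> effdom f" if "0 \<le> t" "t \<le> 1" for t
    using segment_in_X[of x y t] convexD_alt[OF convex_dom, of x y t] assms that
    by (simp add: algebra_simps)
  have "\<exists>z. 0 < z \<and> z < 1 \<and> F (x + 1 *\<^sub>R ?v) - F (x + 0 *\<^sub>R ?v) = (1 - 0) * (grad f (x + z *\<^sub>R ?v) \<bullet> ?v)"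
    using seg by (intro MVT2 line_deriv(1)) auto
  then obtain z where z: "0 < z" "z < 1" "F y - F x = grad f (x + z *\<^sub>R ?v) \<bullet> ?v" by auto
  have "grad f (x + 0 *\<^sub>R ?v) \<bullet> ?v \<le> grad f (x + z *\<^sub>R ?v) \<bullet> ?v"
  proof (rule DERIV_nonneg_imp_nondecreasing[where a = 0 and b = z and f = "\<lambda>r. grad f (x + r *\<^sub>R ?v) \<bullet> ?v"])
    fix r assume "0 \<le> r" "r \<le> z"
    then have r: "x + r *\<^sub>R ?v \<in> X \<inter> effdom f" using seg z by simp
    have "0 \<le> (hess f (x + r *\<^sub>R ?v) *v ?v) \<bullet> ?v"
      using local_norm_sq[of "x + r *\<^sub>R ?v" ?v] r zero_le_power2 by (metis IntD1 IntD2)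
    then show "\<exists>d. ((\<lambda>r. grad f (x + r *\<^sub>R ?v) \<bullet> ?v) has_real_derivative d) (at r) \<and> 0 \<le> d"
      using line_deriv(2) r by blast
  qed (use z in simp)
  then show ?thesis using z by (simp add: inner_diff_right)
qed

text \<open>
  If the segment left the domain, there would be a first exit point. Up to it the integrated curvature bound keeps \<open>f\<close>
  bounded, so lower semicontinuity puts the exit point into the domain, a contradiction.
\<close>

lemma gsc_line_bound:
  assumes x: "x \<in> X \<inter> effdom f" and d: "d \<in> X" "d \<noteq> x" and T: "0 < T" "T \<le> 1"
    and M: "0 < M" "Mf \<le> M"
  defines "v \<equiv> d - x"
  defines "e \<equiv> local_norm f x v"
  defines "a \<equiv> M * (if \<nu> = 2 then norm v else (\<nu> - 2) / 2 * rpow (norm v) (3 - \<nu>) * rpow e (\<nu> - 2))"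
  assumes pole: "below_pole \<nu> (a * T)"
  shows "x + T *\<^sub>R v \<in> effdom f"
    and "F (x + T *\<^sub>R v) \<le> F x + T * (grad f x \<bullet> v) + e\<^sup>2 / a\<^sup>2 * profile \<nu> (a * T)"
proof -
  have v: "v \<noteq> 0" using d by (simp add: v_def)
  have e: "0 < e" unfolding e_def using local_norm_pos x v by blast
  have rpow_pos: "0 < rpow z p" if "0 < z" for z p using that by (simp add: rpow_def)
  have a: "0 < a" unfolding a_def using M v e nu by (auto intro!: mult_pos_pos rpow_pos)
  define C where "C = M * rpow (norm v) (3 - \<nu>)"
  have C: "0 \<le> C" unfolding C_def using M rpow_pos[of "norm v"] v by (simp add: less_imp_le)
  have e_eq: "e = sqrt ((hess f (x + 0 *\<^sub>R v) *v v) \<bullet> v)" by (simp add: e_def local_norm_def)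
  have a_eq: "a = (if \<nu> = 2 then C else (\<nu> - 2) / 2 * C * rpow (sqrt ((hess f (x + 0 *\<^sub>R v) *v v) \<bullet> v)) (\<nu> - 2))"
    unfolding e_eq[symmetric] by (auto simp: a_def C_def rpow_def)
  have inX: "x + s *\<^sub>R v \<in> X" if "0 \<le> s" "s \<le> T" for s
    using segment_in_X[of x d s] x d T that by (simp add: v_def)
  have bp: "below_pole \<nu> (a * s)" if "s \<le> T" for s
    using below_pole_mono[OF pole] that a by (simp add: mult_left_mono)
  have bound: "F (x + t *\<^sub>R v) \<le> F x + t * (grad f x \<bullet> v) + e\<^sup>2 / a\<^sup>2 * profile \<nu> (a * t)"
    if t: "0 \<le> t" "t \<le> T" and dom: "\<And>s. 0 \<le> s \<Longrightarrow> s \<le> t \<Longrightarrow> x + s *\<^sub>R v \<in> effdom f" for t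
  proof -
    let ?p = "\<lambda>s. (hess f (x + s *\<^sub>R v) *v v) \<bullet> v"
    have growth: "?p s \<le> e\<^sup>2 * profile_curv \<nu> (a * s)" if s: "0 \<le> s" "s \<le> t" for s
    proof -
      have "?p s \<le> ?p 0 * profile_curv \<nu> (a * s)"
      proof (rule curvature_growth[OF nu s(1) C, where p' = "\<lambda>s. (D3 f (x + s *\<^sub>R v) v *v v) \<bullet> v"])
        fix r assume "0 \<le> r" "r \<le> s"
        then have r: "x + r *\<^sub>R v \<in> effdom f" "x + r *\<^sub>R v \<in> X" using dom inX s t by auto
        show "(?p has_real_derivative (D3 f (x + r *\<^sub>R v) v *v v) \<bullet> v) (at r)"
          by (rule line_deriv(3)[OF r(1)])
        show "0 < ?p r" using posdef r v by blast
        have "\<bar>(D3 f (x + r *\<^sub>R v) v *v v) \<bullet> v\<bar> \<le> Mf * (local_norm f (x + r *\<^sub>R v) v)\<^sup>2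
            * rpow (local_norm f (x + r *\<^sub>R v) v) (\<nu> - 2) * rpow (norm v) (3 - \<nu>)"
          using gsc r(1) by (auto simp: gsc_class_def)
        also have "\<dots> \<le> M * (local_norm f (x + r *\<^sub>R v) v)\<^sup>2
            * rpow (local_norm f (x + r *\<^sub>R v) v) (\<nu> - 2) * rpow (norm v) (3 - \<nu>)"
          using M(2) rpow_pos[OF local_norm_pos[OF r(2,1) v]] rpow_pos[of "norm v"] v
          by (intro mult_right_mono) (auto intro: less_imp_le)
        finally show "(D3 f (x + r *\<^sub>R v) v *v v) \<bullet> v \<le> C * ?p r * rpow (sqrt (?p r)) (\<nu> - 2)"
          unfolding local_norm_sq[OF r(2,1)] by (simp add: C_def local_norm_def mult_ac)
      qed (use a_eq bp s t in auto)
      then show ?thesis using local_norm_sq[of x v] x by (simp add: e_def)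
    qed
    have "F (x + t *\<^sub>R v) \<le> F (x + 0 *\<^sub>R v) + t * (grad f (x + 0 *\<^sub>R v) \<bullet> v) + e\<^sup>2 / a\<^sup>2 * profile \<nu> (a * t)"
      by (rule second_order_comparison[OF nu t(1) a bp[OF t(2)],
            where \<phi>' = "\<lambda>s. grad f (x + s *\<^sub>R v) \<bullet> v" and p = ?p])
        (use line_deriv dom growth in auto)
    then show ?thesis by simp
  qed
  have dom_all: "x + t *\<^sub>R v \<in> effdom f" if t: "0 \<le> t" "t \<le> T" for t
  proof (rule ccontr)
    assume nt: "x + t *\<^sub>R v \<notin> effdom f"
    define S where "S = {0..T} \<inter> (\<lambda>s. x + s *\<^sub>R v) -` (- effdom f)"
    have "closed S" unfolding S_def using open_dom
      by (intro continuous_on_closed_vimage[THEN iffD1, rule_format] closed_Int closed_vimage)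
         (auto intro!: continuous_intros)
    then have "compact S" unfolding S_def using bounded_closed_interval
      by (meson Int_lower1 bounded_subset compact_eq_bounded_closed compact_Icc)
    moreover have "t \<in> S" using nt t by (simp add: S_def)
    ultimately obtain r where r: "r \<in> S" "\<And>s. s \<in> S \<Longrightarrow> r \<le> s"
      using compact_attains_inf[of S] by blast
    have r0: "0 < r" using r(1) x by (cases "r = 0") (auto simp: S_def)
    have rT: "r \<le> T" using r(1) by (simp add: S_def)
    have before: "x + s *\<^sub>R v \<in> effdom f" if "0 \<le> s" "s < r" for s
      using r(2)[of s] that rT by (auto simp: S_def)
    define c where "c = F x + T * \<bar>grad f x \<bullet> v\<bar> + e\<^sup>2 / a\<^sup>2 * profile \<nu> (a * T)"
    have "f (x + r *\<^sub>R v) \<le> ereal c"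
    proof (rule lower_semicont_at_left_bound[OF lsc r0 v])
      fix s assume s: "0 \<le> s" "s < r"
      then have sT: "s \<le> T" using rT by simp
      have "F (x + s *\<^sub>R v) \<le> F x + s * (grad f x \<bullet> v) + e\<^sup>2 / a\<^sup>2 * profile \<nu> (a * s)"
        using bound[OF s(1) sT] before s by auto
      moreover have "s * (grad f x \<bullet> v) \<le> T * \<bar>grad f x \<bullet> v\<bar>"
        using s sT T by (intro order_trans[OF mult_left_mono[OF abs_ge_self] mult_right_mono]) auto
      moreover have "profile \<nu> (a * s) \<le> profile \<nu> (a * T)"
      proof (rule DERIV_nonneg_imp_nondecreasing[where f = "profile \<nu>"])
        show "a * s \<le> a * T" using a sT by simp
        fix y assume y: "a * s \<le> y" "y \<le> a * T"
        then have "0 \<le> y" using a s by (meson mult_nonneg_nonneg less_imp_le order_trans)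
        moreover have "below_pole \<nu> y" using below_pole_mono[OF pole y(2)] .
        ultimately show "\<exists>d. (profile \<nu> has_real_derivative d) (at y) \<and> 0 \<le> d"
          using DERIV_profile[OF nu] profile_slope_mono[OF nu, of y 0] by auto
      qed
      then have "e\<^sup>2 / a\<^sup>2 * profile \<nu> (a * s) \<le> e\<^sup>2 / a\<^sup>2 * profile \<nu> (a * T)"
        by (intro mult_left_mono) auto
      ultimately have "F (x + s *\<^sub>R v) \<le> c" by (simp add: c_def)
      then show "f (x + s *\<^sub>R v) \<le> ereal c" by (subst f_eq[OF before[OF s]]) simp
    qed
    then have "x + r *\<^sub>R v \<in> effdom f" by (auto simp: effdom_def)
    then show False using r(1) by (simp add: S_def)
  qed
  show "x + T *\<^sub>R v \<in> effdom f" using dom_all T by simp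
  show "F (x + T *\<^sub>R v) \<le> F x + T * (grad f x \<bullet> v) + e\<^sup>2 / a\<^sup>2 * profile \<nu> (a * T)"
    using bound[of T] dom_all T by simp
qed

end

section \<open>Symmetry and the largest eigenvalue of the Hessian\<close>

text \<open>
  Schwarz's theorem from differentiability of the gradient field at a single point.
\<close>

lemma gradient_field_derivative_symmetric:
  fixes F :: "'a::euclidean_space \<Rightarrow> real" and g :: "'a \<Rightarrow> 'a"
  assumes U: "open U" "x \<in> U"
    and F: "\<And>z. z \<in> U \<Longrightarrow> (F has_derivative (\<lambda>h. g z \<bullet> h)) (at z)"
    and g: "(g has_derivative H) (at x)"
  shows "H u \<bullet> w = H w \<bullet> u"
proof -
  have lin: "linear H" using g has_derivative_linear by blast
  define N where "N = norm u + norm w + 1"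
  have N: "norm u \<le> N" "norm w \<le> N" "0 < N" "norm u + norm w \<le> N" by (auto simp: N_def add_nonneg_pos)
  have est: "\<bar>H u \<bullet> w - H w \<bullet> u\<bar> \<le> 4 * N\<^sup>2 * \<eta>" if eta: "0 < \<eta>" for \<eta>
  proof -
    obtain d1 where d1: "0 < d1" "\<And>z. norm (z - x) < d1 \<Longrightarrow> norm (g z - g x - H (z - x)) \<le> \<eta> * norm (z - x)"
      using has_derivative_at_alt[THEN iffD1, OF g, THEN conjunct2, rule_format, OF eta] by metis
    obtain d2 where d2: "0 < d2" "ball x d2 \<subseteq> U" using U open_contains_ball by blast
    define s where "s = min d1 d2 / (2 * N)"
    have s: "0 < s" "s * N < d1" "s * N < d2"
      using d1(1) d2(1) N(3) by (auto simp: s_def min_def divide_simps)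
    have near: "norm (\<theta> *\<^sub>R a + r *\<^sub>R b) \<le> s * N"
      if "0 \<le> \<theta>" "\<theta> \<le> s" "0 \<le> r" "r \<le> s" "norm a + norm b \<le> N" for \<theta> r and a b :: 'a
    proof -
      have "norm (\<theta> *\<^sub>R a + r *\<^sub>R b) \<le> \<theta> * norm a + r * norm b"
        using norm_triangle_ineq[of "\<theta> *\<^sub>R a" "r *\<^sub>R b"] that by simp
      also have "\<dots> \<le> s * norm a + s * norm b" using that by (intro add_mono mult_right_mono) auto
      also have "\<dots> \<le> s * N" unfolding distrib_left[symmetric] using that s by (intro mult_left_mono) auto
      finally show ?thesis .
    qed
    have inU: "x + (\<theta> *\<^sub>R a + r *\<^sub>R b) \<in> U"
      if "0 \<le> \<theta>" "\<theta> \<le> s" "0 \<le> r" "r \<le> s" "norm a + norm b \<le> N" for \<theta> r and a b :: 'a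
    proof -
      have "norm (\<theta> *\<^sub>R a + r *\<^sub>R b) < d2" using near[OF that] s by linarith
      moreover have "dist x (x + p) = norm p" for p :: 'a
        using norm_minus_cancel[of p] by (simp add: dist_norm del: norm_minus_cancel)
      ultimately have "x + (\<theta> *\<^sub>R a + r *\<^sub>R b) \<in> ball x d2" by (simp only: mem_ball)
      then show ?thesis using d2(2) by blast
    qed
    have approx: "norm (g (x + (\<theta> *\<^sub>R a + r *\<^sub>R b)) - g x - H (\<theta> *\<^sub>R a + r *\<^sub>R b)) \<le> \<eta> * (s * N)"
      if "0 \<le> \<theta>" "\<theta> \<le> s" "0 \<le> r" "r \<le> s" "norm a + norm b \<le> N" for \<theta> r and a b :: 'a
    proof -
      have n: "norm (\<theta> *\<^sub>R a + r *\<^sub>R b) \<le> s * N" by (rule near[OF that])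
      then have "norm (g (x + (\<theta> *\<^sub>R a + r *\<^sub>R b)) - g x - H (\<theta> *\<^sub>R a + r *\<^sub>R b))
          \<le> \<eta> * norm (\<theta> *\<^sub>R a + r *\<^sub>R b)"
        using d1(2)[of "x + (\<theta> *\<^sub>R a + r *\<^sub>R b)"] s by simp
      also have "\<dots> \<le> \<eta> * (s * N)" using n \<open>0 < \<eta>\<close> by (intro mult_left_mono) auto
      finally show ?thesis .
    qed
    \<comment> \<open>The second difference is symmetric in the two directions; the mean value theorem
      evaluates it through the derivative of the gradient field.\<close>
    define \<Delta> where "\<Delta> a b = F (x + (s *\<^sub>R a + s *\<^sub>R b)) - F (x + s *\<^sub>R a) - F (x + s *\<^sub>R b) + F x" for a b
    have diff: "\<bar>\<Delta> a b - s\<^sup>2 * (H b \<bullet> a)\<bar> \<le> 2 * s\<^sup>2 * N\<^sup>2 * \<eta>"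
      if ab: "norm a + norm b \<le> N" for a b
    proof -
      let ?k = "\<lambda>\<theta>. F (x + (\<theta> *\<^sub>R a + s *\<^sub>R b)) - F (x + (\<theta> *\<^sub>R a + 0 *\<^sub>R b))"
      let ?k' = "\<lambda>\<theta>. (g (x + (\<theta> *\<^sub>R a + s *\<^sub>R b)) - g (x + (\<theta> *\<^sub>R a + 0 *\<^sub>R b))) \<bullet> a"
      have dF: "((\<lambda>\<theta>. F (x + (\<theta> *\<^sub>R a + r *\<^sub>R b))) has_real_derivative g (x + (\<theta> *\<^sub>R a + r *\<^sub>R b)) \<bullet> a) (at \<theta>)"
        if "0 \<le> \<theta>" "\<theta> \<le> s" "0 \<le> r" "r \<le> s" for \<theta> r
      proof -
        have "((\<lambda>\<theta>. x + (\<theta> *\<^sub>R a + r *\<^sub>R b)) has_derivative (\<lambda>h. h *\<^sub>R a)) (at \<theta>)"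
          by (auto intro!: derivative_eq_intros)
        from has_derivative_compose[OF this F[OF inU[OF that ab]]] show ?thesis
          unfolding has_field_derivative_def
          by (rule has_derivative_eq_rhs) (simp add: fun_eq_iff mult.commute)
      qed
      have "\<exists>z. 0 < z \<and> z < s \<and> ?k s - ?k 0 = (s - 0) * ?k' z"
      proof (rule MVT2[OF s(1)])
        fix \<theta> assume "0 \<le> \<theta>" "\<theta> \<le> s"
        then show "(?k has_real_derivative ?k' \<theta>) (at \<theta>)"
          unfolding inner_diff_left using s by (intro DERIV_diff dF) auto
      qed
      then obtain z where z: "0 < z" "z < s" and mv: "?k s - ?k 0 = s * ?k' z" by auto
      have D: "\<Delta> a b = s * ?k' z" using mv by (simp add: \<Delta>_def)
      let ?r1 = "g (x + (z *\<^sub>R a + s *\<^sub>R b)) - g x - H (z *\<^sub>R a + s *\<^sub>R b)"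
      let ?r2 = "g (x + (z *\<^sub>R a + 0 *\<^sub>R b)) - g x - H (z *\<^sub>R a + 0 *\<^sub>R b)"
      have "g (x + (z *\<^sub>R a + s *\<^sub>R b)) - g (x + (z *\<^sub>R a + 0 *\<^sub>R b)) = s *\<^sub>R H b + (?r1 - ?r2)"
        by (simp add: linear_add[OF lin] linear_scale[OF lin])
      then have "\<Delta> a b - s\<^sup>2 * (H b \<bullet> a) = s * ((?r1 - ?r2) \<bullet> a)"
        unfolding D by (simp add: inner_add_left power2_eq_square algebra_simps)
      moreover have "\<bar>(?r1 - ?r2) \<bullet> a\<bar> \<le> (\<eta> * (s * N) + \<eta> * (s * N)) * N"
      proof -
        have "norm (?r1 - ?r2) \<le> norm ?r1 + norm ?r2" by (rule norm_triangle_ineq4)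
        also have "\<dots> \<le> \<eta> * (s * N) + \<eta> * (s * N)" using z s ab by (intro add_mono approx) auto
        finally have "norm (?r1 - ?r2) \<le> \<eta> * (s * N) + \<eta> * (s * N)" .
        moreover have "norm a \<le> N" using ab norm_ge_zero[of b] by linarith
        ultimately have "norm (?r1 - ?r2) * norm a \<le> (\<eta> * (s * N) + \<eta> * (s * N)) * N"
          using \<open>0 < \<eta>\<close> s N by (intro mult_mono) auto
        then show ?thesis using Cauchy_Schwarz_ineq2[of "?r1 - ?r2" a] by linarith
      qed
      ultimately have "\<bar>\<Delta> a b - s\<^sup>2 * (H b \<bullet> a)\<bar> \<le> s * ((\<eta> * (s * N) + \<eta> * (s * N)) * N)"
        using s by (simp add: abs_mult)
      also have "\<dots> = 2 * s\<^sup>2 * N\<^sup>2 * \<eta>" by (simp add: power2_eq_square)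
      finally show ?thesis .
    qed
    have "\<Delta> w u = \<Delta> u w" by (simp add: \<Delta>_def add.commute)
    moreover have "\<bar>\<Delta> w u - s\<^sup>2 * (H u \<bullet> w)\<bar> \<le> 2 * s\<^sup>2 * N\<^sup>2 * \<eta>"
      "\<bar>\<Delta> u w - s\<^sup>2 * (H w \<bullet> u)\<bar> \<le> 2 * s\<^sup>2 * N\<^sup>2 * \<eta>"
      using diff[of w u] diff[of u w] N(4) by (auto simp: add.commute)
    ultimately have "\<bar>s\<^sup>2 * (H u \<bullet> w) - s\<^sup>2 * (H w \<bullet> u)\<bar> \<le> 4 * s\<^sup>2 * N\<^sup>2 * \<eta>" by linarith
    then have "s\<^sup>2 * \<bar>H u \<bullet> w - H w \<bullet> u\<bar> \<le> s\<^sup>2 * (4 * N\<^sup>2 * \<eta>)"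
      unfolding right_diff_distrib[symmetric] abs_mult by (simp add: mult_ac)
    then show ?thesis using s by simp
  qed
  have "\<bar>H u \<bullet> w - H w \<bullet> u\<bar> \<le> 0"
  proof (rule field_le_epsilon)
    fix e :: real assume "0 < e"
    then show "\<bar>H u \<bullet> w - H w \<bullet> u\<bar> \<le> 0 + e"
      using est[of "e / (4 * N\<^sup>2)"] N by simp
  qed
  then show ?thesis by simp
qed

text \<open>
  The form \<open>l \<bar>v\<bar>\<^sup>2 - A v \<bullet> v\<close> is nonnegative and vanishes at a maximizer \<open>z\<close> of the Rayleigh quotient; a nonnegative
  quadratic function of \<open>r\<close> without constant term, here the form at \<open>z + r w\<close>, has no linear term.
\<close>

lemma rayleigh_maximum_eigenvalue:
  fixes A :: "real^'n^'n"
  assumes sym: "\<And>u w. (A *v u) \<bullet> w = (A *v w) \<bullet> u"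
  obtains l z where "z \<noteq> 0" "A *v z = l *\<^sub>R z" "\<And>v. (A *v v) \<bullet> v \<le> l * (norm v)\<^sup>2"
proof -
  let ?S = "sphere (0::real^'n) 1"
  have cont: "continuous_on ?S (\<lambda>v. (A *v v) \<bullet> v)"
    by (intro continuous_intros linear_continuous_on) simp
  have "?S \<noteq> {}" by simp
  from continuous_attains_sup[OF compact_sphere this cont] obtain z where z: "z \<in> ?S" "\<And>v. v \<in> ?S \<Longrightarrow> (A *v v) \<bullet> v \<le> (A *v z) \<bullet> z"
    by blast
  define l where "l = (A *v z) \<bullet> z"
  have nz: "norm z = 1" using z by simp
  have bound: "(A *v v) \<bullet> v \<le> l * (norm v)\<^sup>2" for v
  proof (cases "v = 0")
    case False
    have "(A *v (inverse (norm v) *\<^sub>R v)) \<bullet> (inverse (norm v) *\<^sub>R v) \<le> l"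
      unfolding l_def using False by (intro z(2)) simp
    then have "(A *v v) \<bullet> v / (norm v)\<^sup>2 \<le> l"
      by (simp add: matrix_vector_mult_scaleR power2_eq_square divide_inverse mult_ac)
    then show ?thesis using False by (simp add: divide_le_eq)
  qed simp
  have "(A *v z) \<bullet> w = l * (z \<bullet> w)" for w
  proof -
    define c where "c = l * (z \<bullet> w) - (A *v z) \<bullet> w"
    define k where "k = l * (w \<bullet> w) - (A *v w) \<bullet> w"
    have k0: "0 \<le> k" using bound[of w] by (simp add: k_def power2_norm_eq_inner)
    have q: "0 \<le> 2 * r * c + r\<^sup>2 * k" for r
    proof -
      have "(A *v (z + r *\<^sub>R w)) \<bullet> (z + r *\<^sub>R w) = l + 2 * r * ((A *v z) \<bullet> w) + r\<^sup>2 * ((A *v w) \<bullet> w)"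
        using sym[of w z] by (simp add: matrix_vector_right_distrib matrix_vector_mult_scaleR
            inner_add_left inner_add_right l_def power2_eq_square algebra_simps)
      moreover have "(norm (z + r *\<^sub>R w))\<^sup>2 = 1 + 2 * r * (z \<bullet> w) + r\<^sup>2 * (w \<bullet> w)"
        using nz unfolding norm_eq_1 power2_norm_eq_inner
        by (simp add: inner_add_left inner_add_right inner_commute power2_eq_square algebra_simps)
      ultimately show ?thesis using bound[of "z + r *\<^sub>R w"]
        by (simp add: c_def k_def algebra_simps)
    qed
    have "c = 0"
    proof (rule ccontr)
      assume "c \<noteq> 0"
      \<comment> \<open>The shift by 1 keeps the nearly optimal \<open>r\<close> well-defined for \<open>k = 0\<close>.\<close>
      have "2 * (- c / (k + 1)) * c + (- c / (k + 1))\<^sup>2 * k = - (c\<^sup>2 * (k + 2)) / (k + 1)\<^sup>2"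
        using k0 by (simp add: power2_eq_square divide_simps) (simp add: algebra_simps)
      moreover have "0 < c\<^sup>2 * (k + 2) / (k + 1)\<^sup>2" using k0 \<open>c \<noteq> 0\<close> by simp
      ultimately show False using q[of "- c / (k + 1)"] by simp
    qed
    then show ?thesis by (simp add: c_def)
  qed
  then have "\<And>w. (A *v z - l *\<^sub>R z) \<bullet> w = 0" by (simp add: inner_diff_left)
  then have "A *v z - l *\<^sub>R z = 0" by (metis inner_eq_zero_iff)
  then show ?thesis using that[of z l] bound nz by force
qed

context gsc_problem
begin

lemma hess_symmetric:
  assumes "y \<in> effdom f"
  shows "(hess f y *v u) \<bullet> w = (hess f y *v w) \<bullet> u"
  using open_dom assms F_deriv grad_deriv[OF assms]
  by (rule gradient_field_derivative_symmetric)

lemma compact_sublevel: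
  assumes "f x0 < \<infinity>"
  shows "compact (sublevel f X x0)"
proof -
  have "closed {y. f y \<le> f x0}"
  proof (rule closed_sequential_limits[THEN iffD2], intro allI impI, elim conjE)
    fix y l assume y: "\<forall>n. y n \<in> {y. f y \<le> f x0}" "y \<longlonglongrightarrow> l"
    show "l \<in> {y. f y \<le> f x0}"
    proof (rule ccontr)
      assume "l \<notin> {y. f y \<le> f x0}"
      then have less: "f x0 < f l" by simp
      then have "f x0 < Liminf (at l) f"
        using lsc unfolding lower_semicont_def by (meson order_less_le_trans)
      then have "eventually (\<lambda>z. f x0 < f z) (at l)" by (rule less_LiminfD)
      then have "eventually (\<lambda>z. f x0 < f z) (nhds l)"
        using less by (auto simp: eventually_at_filter elim: eventually_mono)
      then have "eventually (\<lambda>n. f x0 < f (y n)) sequentially"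
        using y(2) by (rule eventually_compose_filterlim)
      then show False using y(1) by (auto simp: not_le[symmetric])
    qed
  qed
  moreover have "sublevel f X x0 = X \<inter> {y. f y \<le> f x0}"
    using assms by (auto simp: sublevel_def effdom_def)
  ultimately show ?thesis using comp_X by auto
qed

text \<open>
  The suprema in \<open>lambda_max\<close> and \<open>L_grad\<close> are meaningful only if the eigenvalues are bounded and exist. Boundedness on the
  compact sublevel set comes from continuity of the quadratic form on its product with the unit sphere, existence
  from symmetry of the Hessian.
\<close>

lemma local_norm_le_L_grad:
  assumes x0: "f x0 < \<infinity>" and y: "y \<in> sublevel f X x0"
  shows "(local_norm f y v)\<^sup>2 \<le> L_grad f X x0 * (norm v)\<^sup>2"
proof -
  let ?S = "sublevel f X x0"
  have S: "?S \<subseteq> X \<inter> effdom f" by (auto simp: sublevel_def)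
  have "continuous_on (?S \<times> sphere 0 1) (\<lambda>q. (hess f (fst q) *v snd q) \<bullet> snd q)"
  proof -
    have h: "continuous_on (?S \<times> sphere 0 1) (\<lambda>q. hess f (fst q) $ i $ j)" for i j
      by (intro continuous_on_component continuous_on_compose2[OF cont_hess])
         (use S in \<open>auto intro!: continuous_intros\<close>)
    show ?thesis unfolding inner_vec_def matrix_vector_mult_def
      by (auto intro!: continuous_intros h)
  qed
  moreover have "compact (?S \<times> sphere (0::real^'n) 1)"
    by (intro compact_Times compact_sublevel[OF x0] compact_sphere)
  ultimately have "bounded ((\<lambda>q. (hess f (fst q) *v snd q) \<bullet> snd q) ` (?S \<times> sphere 0 1))"
    by (intro compact_imp_bounded compact_continuous_image)
  then obtain B where B: "\<And>z u. z \<in> ?S \<Longrightarrow> norm u = 1 \<Longrightarrow> \<bar>(hess f z *v u) \<bullet> u\<bar> \<le> B"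
    unfolding bounded_iff by (force simp: )
  have eigen_le: "l \<le> B" if z: "z \<in> ?S" and l: "u \<noteq> 0" "hess f z *v u = l *\<^sub>R u" for z l u
  proof -
    define e where "e = inverse (norm u) *\<^sub>R u"
    have "hess f z *v e = l *\<^sub>R e" using l by (simp add: e_def matrix_vector_mult_scaleR)
    moreover have "norm e = 1" using l by (simp add: e_def)
    moreover from this have "e \<bullet> e = 1" by (simp only: norm_eq_1)
    ultimately show ?thesis using B[OF z, of e] by simp
  qed
  have ex: "\<exists>l u. u \<noteq> 0 \<and> hess f z *v u = l *\<^sub>R u \<and> (\<forall>v. (hess f z *v v) \<bullet> v \<le> l * (norm v)\<^sup>2)"
    if "z \<in> ?S" for z
    using rayleigh_maximum_eigenvalue[of "hess f z"] hess_symmetric that S by (metis Int_iff subsetD)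
  let ?E = "\<lambda>z. {l. \<exists>u. u \<noteq> 0 \<and> hess f z *v u = l *\<^sub>R u}"
  have bddE: "bdd_above (?E z)" if "z \<in> ?S" for z
    using eigen_le[OF that] by (auto intro!: bdd_aboveI[of _ B])
  have "lambda_max (hess f z) \<le> B" if "z \<in> ?S" for z
    unfolding lambda_max_def using ex[OF that] eigen_le[OF that] by (intro cSup_least) auto
  then have "lambda_max (hess f y) \<le> L_grad f X x0"
    unfolding L_grad_def using y by (intro cSUP_upper bdd_aboveI[of _ B]) auto
  moreover obtain l u where l: "u \<noteq> 0" "hess f y *v u = l *\<^sub>R u" "\<And>v. (hess f y *v v) \<bullet> v \<le> l * (norm v)\<^sup>2"
    using ex[OF y] by blast
  moreover have "l \<le> lambda_max (hess f y)"
    unfolding lambda_max_def using l bddE[OF y] by (intro cSup_upper) auto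
  ultimately have "l * (norm v)\<^sup>2 \<le> L_grad f X x0 * (norm v)\<^sup>2" by (intro mult_right_mono) auto
  moreover have "(local_norm f y v)\<^sup>2 = (hess f y *v v) \<bullet> v"
    using local_norm_sq[of y v] y by (simp add: sublevel_def)
  ultimately show ?thesis using l(3)[of v] by simp
qed

end

section \<open>The model decrease of one Frank-Wolfe step\<close>

lemma c1_le_half: "c1 L D M \<nu> \<le> 1 / 2"
  unfolding c1_def by (simp only: min.cobounded1 split: if_split) simp

locale fw_problem = gsc_problem f X \<nu> Mf
  for f :: "real^'n \<Rightarrow> ereal" and X \<nu> Mf +
  fixes s :: "real^'n \<Rightarrow> real^'n"
  assumes lmo: "lin_oracle f X s"
begin

lemma lmo_minimal:
  assumes "x \<in> X \<inter> effdom f"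
  shows "s x \<in> X" and "d \<in> X \<Longrightarrow> grad f x \<bullet> s x \<le> grad f x \<bullet> d"
  using lmo assms unfolding lin_oracle_def is_arg_min_def by (force simp: not_less)+

lemma Gap_eq:
  assumes "x \<in> X \<inter> effdom f"
  shows "Gap f X x = - (grad f x \<bullet> v_FW s x)"
proof -
  have "Gap f X x = grad f x \<bullet> (x - s x)"
    unfolding Gap_def using lmo_minimal[OF assms]
    by (intro cSup_eq_maximum) (auto simp: inner_diff_right)
  then show ?thesis by (simp add: v_FW_def inner_diff_right)
qed

lemma primal_gap_le_Gap:
  assumes "x \<in> X \<inter> effdom f" "y \<in> X \<inter> effdom f"
  shows "F x - F y \<le> Gap f X x"
  using gradient_inequality[OF assms] lmo_minimal(2)[OF assms(1), of y] assms
  by (simp add: Gap_eq v_FW_def inner_diff_right)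

lemma rpow_pos: "0 < z \<Longrightarrow> 0 < rpow z p"
  by (simp add: rpow_def)

lemma direction_pos:
  assumes x: "x \<in> X \<inter> effdom f" and G: "0 < Gap f X x"
  shows "v_FW s x \<noteq> 0" "s x \<noteq> x" "0 < e_FW f s x" "0 < beta_FW s x" "0 < delta_FW f s \<nu> x"
proof -
  show v: "v_FW s x \<noteq> 0" using G unfolding Gap_eq[OF x] by auto
  then show "s x \<noteq> x" by (simp add: v_FW_def)
  show e: "0 < e_FW f s x" unfolding e_FW_def using local_norm_pos x v by blast
  show b: "0 < beta_FW s x" using v by (simp add: beta_FW_def)
  show "0 < delta_FW f s \<nu> x" using nu b e
    by (auto simp: delta_FW_def intro!: mult_pos_pos rpow_pos)
qed

definition model_decrease :: "real \<Rightarrow> real^'n \<Rightarrow> real" where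
  "model_decrease M x =
     alpha_step f X s \<nu> M x * Gap f X x
       - (e_FW f s x)\<^sup>2 / (M * delta_FW f s \<nu> x)\<^sup>2
          * profile \<nu> (M * delta_FW f s \<nu> x * alpha_step f X s \<nu> M x)"

lemma step_size_bounds:
  assumes x: "x \<in> X \<inter> effdom f" and G: "0 < Gap f X x" and M: "0 < M"
  shows "0 < alpha_step f X s \<nu> M x" "alpha_step f X s \<nu> M x \<le> 1"
    "below_pole \<nu> (M * delta_FW f s \<nu> x * alpha_step f X s \<nu> M x)"
proof -
  note p = direction_pos[OF x G]
  note t = t_step_profile[OF nu M p(5) G p(3)]
  have a: "0 < M * delta_FW f s \<nu> x" using M p by simp
  have "0 < t_step f X s \<nu> M x" using t(1) a by (simp add: zero_less_mult_iff)
  then show "0 < alpha_step f X s \<nu> M x" "alpha_step f X s \<nu> M x \<le> 1"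
    by (auto simp: alpha_step_def)
  show "below_pole \<nu> (M * delta_FW f s \<nu> x * alpha_step f X s \<nu> M x)"
    using a by (intro below_pole_mono[OF t(2)] mult_left_mono) (auto simp: alpha_step_def)
qed

lemma Q_model_eq:
  assumes x: "x \<in> X \<inter> effdom f" and G: "0 < Gap f X x" and M: "0 < M"
  shows "Q_model f X s \<nu> x (alpha_step f X s \<nu> M x) M = ereal (F x - model_decrease M x)"
proof -
  define \<alpha> a e where "\<alpha> = alpha_step f X s \<nu> M x" and "a = M * delta_FW f s \<nu> x" and "e = e_FW f s x"
  have a: "0 < a" using M direction_pos[OF x G] by (simp add: a_def)
  have \<alpha>: "0 < \<alpha>" "below_pole \<nu> (a * \<alpha>)"
    using step_size_bounds[OF x G M] by (auto simp: \<alpha>_def a_def)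
  have "omega \<nu> (\<alpha> * M * delta_FW f s \<nu> x) = ereal (profile \<nu> (a * \<alpha>) / (a * \<alpha>)\<^sup>2)"
  proof -
    have eq: "\<alpha> * M * delta_FW f s \<nu> x = a * \<alpha>" by (simp add: a_def)
    have "a * \<alpha> \<noteq> 0" using a \<alpha>(1) by simp
    then show ?thesis unfolding eq by (rule omega_eq_profile[OF nu \<alpha>(2)])
  qed
  then have "ereal (\<alpha>\<^sup>2 * e\<^sup>2) * omega \<nu> (\<alpha> * M * delta_FW f s \<nu> x)
      = ereal (\<alpha>\<^sup>2 * e\<^sup>2 * (profile \<nu> (a * \<alpha>) / (a * \<alpha>)\<^sup>2))" by simp
  also have "\<alpha>\<^sup>2 * e\<^sup>2 * (profile \<nu> (a * \<alpha>) / (a * \<alpha>)\<^sup>2) = e\<^sup>2 / a\<^sup>2 * profile \<nu> (a * \<alpha>)"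
    using \<alpha>(1) by (simp add: power_mult_distrib)
  finally have om: "ereal (\<alpha>\<^sup>2 * e\<^sup>2) * omega \<nu> (\<alpha> * M * delta_FW f s \<nu> x) = ereal (e\<^sup>2 / a\<^sup>2 * profile \<nu> (a * \<alpha>))" .
  obtain r where r: "f x = ereal r" using f_eq x by blast
  show ?thesis
    using om unfolding Q_model_def \<alpha>_def[symmetric] e_def[symmetric]
    by (simp add: r model_decrease_def \<alpha>_def[symmetric] a_def[symmetric] e_def[symmetric])
qed

lemma accepted_step:
  assumes x: "x \<in> X \<inter> effdom f" and G: "0 < Gap f X x" and M: "0 < M"
    and acc: "\<not> reject_step f X s \<nu> x M"
  defines "y \<equiv> x + alpha_step f X s \<nu> M x *\<^sub>R v_FW s x"
  shows "y \<in> X \<inter> effdom f" "F y \<le> F x - model_decrease M x"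
proof -
  have y: "y \<in> effdom f" "f y \<le> Q_model f X s \<nu> x (alpha_step f X s \<nu> M x) M"
    using acc by (auto simp: reject_step_def Let_def y_def not_less)
  have "y \<in> X" unfolding y_def v_FW_def
    using segment_in_X[of x "s x" "alpha_step f X s \<nu> M x"] lmo_minimal(1)[OF x] x
      step_size_bounds[OF x G M] by simp
  with y show "y \<in> X \<inter> effdom f" by simp
  obtain r where r: "f y = ereal r" using f_eq y(1) by blast
  show "F y \<le> F x - model_decrease M x" using y(2) unfolding Q_model_eq[OF x G M] by (simp add: r)
qed

text \<open>
  For \<open>M \<ge> Mf\<close> the upper model with parameter \<open>M\<close> is valid, so the acceptance test succeeds.
\<close>

lemma accept_large_parameter:
  assumes x: "x \<in> X \<inter> effdom f" and G: "0 < Gap f X x" and M: "0 < M" "Mf \<le> M"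
  shows "\<not> reject_step f X s \<nu> x M"
proof -
  define \<alpha> where "\<alpha> = alpha_step f X s \<nu> M x"
  note p = direction_pos[OF x G] and b = step_size_bounds[OF x G M(1)]
  have \<delta>: "delta_FW f s \<nu> x = (if \<nu> = 2 then norm (s x - x)
      else (\<nu> - 2) / 2 * rpow (norm (s x - x)) (3 - \<nu>) * rpow (local_norm f x (s x - x)) (\<nu> - 2))"
    by (simp add: delta_FW_def beta_FW_def e_FW_def v_FW_def)
  have line: "x + \<alpha> *\<^sub>R (s x - x) \<in> effdom f"
    "F (x + \<alpha> *\<^sub>R (s x - x)) \<le> F x + \<alpha> * (grad f x \<bullet> (s x - x))
       + (local_norm f x (s x - x))\<^sup>2 / (M * delta_FW f s \<nu> x)\<^sup>2 * profile \<nu> (M * delta_FW f s \<nu> x * \<alpha>)"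
    using gsc_line_bound[OF x lmo_minimal(1)[OF x] p(2) _ _ M, of \<alpha>] b
    unfolding \<delta>[symmetric] \<alpha>_def by auto
  obtain r where r: "f (x + \<alpha> *\<^sub>R (s x - x)) = ereal r" using f_eq line(1) by blast
  have "f (x + \<alpha> *\<^sub>R v_FW s x) \<le> Q_model f X s \<nu> x \<alpha> M"
    using line(2) unfolding \<alpha>_def Q_model_eq[OF x G M(1)]
    unfolding \<alpha>_def[symmetric] v_FW_def r
    by (simp add: r model_decrease_def Gap_eq[OF x] \<alpha>_def[symmetric] e_FW_def v_FW_def)
  then show ?thesis using line(1) by (simp add: reject_step_def Let_def \<alpha>_def v_FW_def not_less)
qed

text \<open>
  A rejected parameter is below \<open>Mf\<close>, so one enlargement stays below \<open>\<gamma>u Mf\<close>; geometric growth makes the loop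
  stop. The induction is on the number of enlargements after which \<open>Mf\<close> is certainly exceeded.
\<close>

lemma backtrack_result:
  assumes x: "x \<in> X \<inter> effdom f" and G: "0 < Gap f X x" and M: "0 < M" and \<gamma>: "1 < \<gamma>u"
  defines "M' \<equiv> backtrack f X s \<nu> \<gamma>u x M"
  shows "\<not> reject_step f X s \<nu> x M'" "0 < M'" "M' \<le> max (\<gamma>u * Mf) M"
proof -
  have loop: "\<not> reject_step f X s \<nu> x (backtrack f X s \<nu> \<gamma>u x m)
      \<and> 0 < backtrack f X s \<nu> \<gamma>u x m \<and> backtrack f X s \<nu> \<gamma>u x m \<le> max (\<gamma>u * Mf) m"
    if "0 < m" "Mf \<le> \<gamma>u ^ n * m" for n m
    using that
  proof (induction n arbitrary: m)
    case 0
    then have "\<not> reject_step f X s \<nu> x m" using accept_large_parameter[OF x G] by simp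
    then show ?case using 0 by (simp add: backtrack_def while_unfold)
  next
    case (Suc n)
    show ?case
    proof (cases "reject_step f X s \<nu> x m")
      case False
      then show ?thesis using Suc.prems by (simp add: backtrack_def while_unfold)
    next
      case True
      then have "m < Mf" using accept_large_parameter[OF x G Suc.prems(1)] by force
      then have "\<gamma>u * m \<le> \<gamma>u * Mf" using \<gamma> by simp
      moreover have "backtrack f X s \<nu> \<gamma>u x m = backtrack f X s \<nu> \<gamma>u x (\<gamma>u * m)"
        unfolding backtrack_def by (subst while_unfold) (simp add: True)
      moreover have "0 < \<gamma>u * m" "Mf \<le> \<gamma>u ^ n * (\<gamma>u * m)" using Suc.prems \<gamma> by (auto simp: mult_ac)
      ultimately show ?thesis using Suc.IH[of "\<gamma>u * m"] by auto
    qed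
  qed
  obtain n where "Mf / M < \<gamma>u ^ n" using real_arch_pow[OF \<gamma>] by blast
  then have "Mf \<le> \<gamma>u ^ n * M" using M by (simp add: divide_less_eq)
  from loop[OF M this] show "\<not> reject_step f X s \<nu> x M'" "0 < M'" "M' \<le> max (\<gamma>u * Mf) M"
    by (auto simp: M'_def)
qed

text \<open>
  If the maximizer of the model lies beyond 1, then the slope of the penalty at the full step is at most \<open>G\<close>, and
  by \<open>profile_le_half_slope\<close> the penalty itself is at most \<open>G / 2\<close>.
\<close>

lemma model_decrease_full_step:
  assumes x: "x \<in> X \<inter> effdom f" and G: "0 < Gap f X x" and M: "0 < M"
    and full: "1 \<le> t_step f X s \<nu> M x"
  shows "Gap f X x / 2 \<le> model_decrease M x"
proof -
  define a e where "a = M * delta_FW f s \<nu> x" and "e = e_FW f s x"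
  note p = direction_pos[OF x G]
  note t = t_step_profile[OF nu M p(5) G p(3)]
  have a: "0 < a" "0 < e" using M p by (simp_all add: a_def e_def)
  have al: "alpha_step f X s \<nu> M x = 1" using full by (simp add: alpha_step_def)
  have bp: "below_pole \<nu> a" using step_size_bounds(3)[OF x G M] by (simp add: al a_def)
  have "profile_slope \<nu> a \<le> a * Gap f X x / e\<^sup>2"
    using profile_slope_mono[OF nu t(2), of a] t(3) a full mult_left_mono[OF full, of a]
    by (simp add: a_def e_def)
  then have "a * profile_slope \<nu> a \<le> a * (a * Gap f X x / e\<^sup>2)" using a by (intro mult_left_mono) auto
  then have "2 * profile \<nu> a \<le> a\<^sup>2 * Gap f X x / e\<^sup>2"
    using profile_le_half_slope[OF nu bp] a by (simp add: power2_eq_square)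
  then have "e\<^sup>2 / a\<^sup>2 * (2 * profile \<nu> a) \<le> e\<^sup>2 / a\<^sup>2 * (a\<^sup>2 * Gap f X x / e\<^sup>2)"
    by (intro mult_left_mono) auto
  also have "\<dots> = Gap f X x" using a by simp
  finally have "2 * (e\<^sup>2 / a\<^sup>2 * profile \<nu> a) \<le> Gap f X x" by (simp only: mult.left_commute[of 2])
  moreover have "model_decrease M x = Gap f X x - e\<^sup>2 / a\<^sup>2 * profile \<nu> a"
    unfolding model_decrease_def al a_def[symmetric] e_def[symmetric] by (simp only: mult_1_left mult_1_right)
  ultimately show ?thesis by linarith
qed

text \<open>
  At an interior maximizer the gain is the conjugate of the profile, expressed through its slope.
\<close>

lemma model_decrease_short_step:
  assumes x: "x \<in> X \<inter> effdom f" and G: "0 < Gap f X x" and M: "0 < M"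
    and short: "t_step f X s \<nu> M x < 1"
  defines "a \<equiv> M * delta_FW f s \<nu> x"
  defines "\<tau> \<equiv> a * t_step f X s \<nu> M x"
  shows "model_decrease M x = (e_FW f s x)\<^sup>2 / a\<^sup>2 * (\<tau> * profile_slope \<nu> \<tau> - profile \<nu> \<tau>)"
    and "0 \<le> model_decrease M x"
proof -
  define e where "e = e_FW f s x"
  note p = direction_pos[OF x G]
  note t = t_step_profile[OF nu M p(5) G p(3), folded a_def, folded \<tau>_def, folded e_def]
  have a: "0 < a" "0 < e" using M p by (simp_all add: a_def e_def)
  have al: "alpha_step f X s \<nu> M x = t_step f X s \<nu> M x" using short by (simp add: alpha_step_def)
  have "e\<^sup>2 / a\<^sup>2 * (\<tau> * (a * Gap f X x / e\<^sup>2)) = t_step f X s \<nu> M x * Gap f X x"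
    using a by (simp add: \<tau>_def power2_eq_square)
  then show eq: "model_decrease M x = (e_FW f s x)\<^sup>2 / a\<^sup>2 * (\<tau> * profile_slope \<nu> \<tau> - profile \<nu> \<tau>)"
    unfolding model_decrease_def al a_def[symmetric] e_def[symmetric] \<tau>_def[symmetric] t(3)
    by (simp only: right_diff_distrib)
  have "0 \<le> profile_slope \<nu> \<tau>" using t(3) a G by simp
  then have "0 \<le> \<tau> * profile_slope \<nu> \<tau>" using t(1) by simp
  then have "0 \<le> \<tau> * profile_slope \<nu> \<tau> - profile \<nu> \<tau>"
    using profile_le_half_slope[OF nu t(2)] t(1) by simp
  then show "0 \<le> model_decrease M x" unfolding eq by simp
qed

lemma model_decrease_nonneg:
  assumes x: "x \<in> X \<inter> effdom f" and G: "0 < Gap f X x" and M: "0 < M"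
  shows "0 \<le> model_decrease M x"
  using model_decrease_full_step[OF assms] model_decrease_short_step(2)[OF assms] G
  by (cases "1 \<le> t_step f X s \<nu> M x") auto

text \<open>
  The linear and the quadratic branch of the conjugate are weakest for the largest possible pole rate
  \<open>M \<delta>\<close> and the largest possible \<open>e\<^sup>2 = L D\<^sup>2\<close>; these extremes are the denominators of \<open>c1\<close> and \<open>c2\<close>.
\<close>

lemma model_decrease_ge_min:
  assumes x: "x \<in> X \<inter> effdom f" and G: "0 < Gap f X x" and M: "0 < M" "M \<le> Mbar"
    and \<nu>3: "\<nu> < 3" and L: "0 < L" "(e_FW f s x)\<^sup>2 \<le> L * (beta_FW s x)\<^sup>2"
    and D: "0 < D" "beta_FW s x \<le> D"
  shows "min (c1 L D Mbar \<nu> * Gap f X x) (c2 L D Mbar \<nu> * (Gap f X x)\<^sup>2) \<le> model_decrease M x"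
proof (cases "1 \<le> t_step f X s \<nu> M x")
  case True
  have "c1 L D Mbar \<nu> * Gap f X x \<le> 1 / 2 * Gap f X x"
    using G c1_le_half by (intro mult_right_mono) auto
  then show ?thesis using model_decrease_full_step[OF x G M(1) True] by simp
next
  case False
  then have short: "t_step f X s \<nu> M x < 1" by simp
  define a e g \<beta> where "a = M * delta_FW f s \<nu> x" and "e = e_FW f s x" and "g = Gap f X x" and "\<beta> = beta_FW s x"
  define \<tau> where "\<tau> = a * t_step f X s \<nu> M x"
  note p = direction_pos[OF x G]
  note t = t_step_profile[OF nu M(1) p(5) G p(3), folded a_def, folded \<tau>_def e_def g_def]
  have a: "0 < a" "0 < e" "0 < g" "0 < \<beta>" using M p G by (simp_all add: a_def e_def g_def \<beta>_def)
  have dec: "model_decrease M x = e\<^sup>2 / a\<^sup>2 * (\<tau> * profile_slope \<nu> \<tau> - profile \<nu> \<tau>)"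
    using model_decrease_short_step(1)[OF x G M(1) short] by (simp add: a_def e_def \<tau>_def)
  have eL: "e\<^sup>2 \<le> L * D\<^sup>2"
  proof -
    have "L * \<beta>\<^sup>2 \<le> L * D\<^sup>2" using L D a by (intro mult_left_mono power_mono) (auto simp: \<beta>_def)
    then show ?thesis using L(2) unfolding e_def \<beta>_def by linarith
  qed
  \<comment> \<open>The slope at \<open>\<tau>\<close> is \<open>a g / e\<^sup>2\<close>, so multiplication by \<open>(e / a)\<^sup>2\<close> turns a linear term in the slope into
    one in \<open>g\<close> with factor \<open>1 / a\<close> and a quadratic term into one in \<open>g\<^sup>2\<close> with factor \<open>1 / e\<^sup>2\<close>.\<close>
  have scale: "min (k / A * g) (k * q / (L * D\<^sup>2) * g\<^sup>2) \<le> model_decrease M x"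
    if k: "0 < k" "0 < q" and A: "a \<le> A"
      and conj: "k * min (profile_slope \<nu> \<tau>) (q * (profile_slope \<nu> \<tau>)\<^sup>2)
        \<le> \<tau> * profile_slope \<nu> \<tau> - profile \<nu> \<tau>" for k q A
  proof -
    define y where "y = profile_slope \<nu> \<tau>"
    have y: "y = a * g / e\<^sup>2" using t(3) by (simp add: y_def)
    have "k / A * g \<le> k / a * g" using k a A by (intro mult_right_mono divide_left_mono) auto
    also have "\<dots> = e\<^sup>2 / a\<^sup>2 * (k * y)" using a by (simp add: y power2_eq_square)
    finally have 1: "k / A * g \<le> e\<^sup>2 / a\<^sup>2 * (k * y)" .
    have "k * q / (L * D\<^sup>2) * g\<^sup>2 \<le> k * q / e\<^sup>2 * g\<^sup>2"
      using k a eL L D by (intro mult_right_mono divide_left_mono) auto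
    also have "\<dots> = e\<^sup>2 / a\<^sup>2 * (k * (q * y\<^sup>2))" using a by (simp add: y power2_eq_square)
    finally have 2: "k * q / (L * D\<^sup>2) * g\<^sup>2 \<le> e\<^sup>2 / a\<^sup>2 * (k * (q * y\<^sup>2))" .
    have "min (k / A * g) (k * q / (L * D\<^sup>2) * g\<^sup>2) \<le> e\<^sup>2 / a\<^sup>2 * (k * min y (q * y\<^sup>2))"
      using 1 2 by (auto simp: min_def)
    also have "\<dots> \<le> model_decrease M x"
      unfolding dec using conj by (intro mult_left_mono) (auto simp: y_def)
    finally show ?thesis .
  qed
  consider "\<nu> = 2" | "2 < \<nu>" using nu by fastforce
  then show ?thesis
  proof cases
    case 1
    have "a \<le> Mbar * D" unfolding a_def using 1 M D p by (auto simp: delta_FW_def intro!: mult_mono)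
    moreover have "0 < 2 * ln 2 - (1::real)" using ln2_ge_two_thirds by simp
    ultimately have "min ((2 * ln 2 - 1) / (Mbar * D) * g) ((2 * ln 2 - 1) * 1 / (L * D\<^sup>2) * g\<^sup>2)
        \<le> model_decrease M x"
      using profile_conjugate_2[of \<tau>] t(1) 1 by (intro scale) auto
    moreover have "c1 L D Mbar \<nu> * g \<le> (2 * ln 2 - 1) / (Mbar * D) * g"
      using a 1 by (intro mult_right_mono) (auto simp: c1_def)
    moreover have "c2 L D Mbar \<nu> = (2 * ln 2 - 1) * 1 / (L * D\<^sup>2)" using 1 by (simp add: c2_def)
    ultimately show ?thesis unfolding g_def[symmetric] by (auto simp: min_def split: if_splits)
  next
    case 2
    define q where "q = (4 - \<nu>) / (\<nu> - 2)"
    have q: "0 < q" using 2 \<nu>3 by (simp add: q_def)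
    have \<tau>1: "\<tau> < 1" using t(2) 2 by (simp add: below_pole_def)
    define A where "A = D * (\<nu> / 2 - 1) * Mbar * L powr ((\<nu> - 2) / 2)"
    have "a \<le> A"
    proof -
      have "e \<le> sqrt L * D" using eL a D L real_le_rsqrt[OF eL] by (simp add: real_sqrt_mult)
      then have "e powr (\<nu> - 2) \<le> (sqrt L * D) powr (\<nu> - 2)" using a 2 by (intro powr_mono2) auto
      also have "\<dots> = L powr ((\<nu> - 2) / 2) * D powr (\<nu> - 2)"
        using L D by (simp add: powr_mult powr_half_sqrt[symmetric] powr_powr)
      finally have e1: "e powr (\<nu> - 2) \<le> L powr ((\<nu> - 2) / 2) * D powr (\<nu> - 2)" .
      have b1: "\<beta> powr (3 - \<nu>) \<le> D powr (3 - \<nu>)" using a D \<nu>3 by (intro powr_mono2) (auto simp: \<beta>_def)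
      have "a = M * ((\<nu> - 2) / 2 * (\<beta> powr (3 - \<nu>) * e powr (\<nu> - 2)))"
        using 2 \<nu>3 by (simp add: a_def delta_FW_def rpow_def \<beta>_def e_def)
      also have "\<dots> \<le> Mbar * ((\<nu> - 2) / 2 * (D powr (3 - \<nu>) * (L powr ((\<nu> - 2) / 2) * D powr (\<nu> - 2))))"
        using e1 b1 M 2 by (intro mult_mono mult_nonneg_nonneg) auto
      also have "\<dots> = Mbar * ((\<nu> - 2) / 2 * ((D powr (3 - \<nu>) * D powr (\<nu> - 2)) * L powr ((\<nu> - 2) / 2)))"
        by (simp only: mult_ac)
      also have "D powr (3 - \<nu>) * D powr (\<nu> - 2) = D" using D by (simp add: powr_add[symmetric])
      also have "Mbar * ((\<nu> - 2) / 2 * (D * L powr ((\<nu> - 2) / 2))) = A"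
        by (simp add: A_def diff_divide_distrib mult_ac)
      finally show ?thesis .
    qed
    then have "min (gamma_tilde \<nu> / A * g) (gamma_tilde \<nu> * q / (L * D\<^sup>2) * g\<^sup>2) \<le> model_decrease M x"
      using gamma_tilde_conjugate[OF 2 \<nu>3 _ \<tau>1] t(1) q by (intro scale) (auto simp: q_def)
    moreover have "c1 L D Mbar \<nu> * g \<le> gamma_tilde \<nu> / A * g"
      using a 2 \<nu>3 by (intro mult_right_mono) (auto simp: c1_def A_def)
    moreover have "c2 L D Mbar \<nu> = gamma_tilde \<nu> * q / (L * D\<^sup>2)"
    proof -
      have "- 1 / b_const \<nu> = q" using 2 \<nu>3 by (simp add: b_const_def q_def field_simps)
      then show ?thesis using 2 \<nu>3 by (simp add: c2_def)
    qed
    ultimately show ?thesis unfolding g_def[symmetric] by (auto simp: min_def split: if_splits)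
  qed
qed

text \<open>
  For \<open>\<nu> = 3\<close> and a short step, the stationarity equation determines the gap as \<open>e\<^sup>2 t / (1 - \<tau>)\<close>. The gain is kept
  relative to \<open>t G\<close>, the form in which it enters the potential of \<open>iteration_count_with_spread\<close>.
\<close>

lemma model_decrease_3:
  assumes x: "x \<in> X \<inter> effdom f" and G: "0 < Gap f X x" and M: "0 < M"
    and \<nu>3: "\<nu> = 3" and short: "t_step f X s \<nu> M x < 1"
  defines "t \<equiv> t_step f X s \<nu> M x"
  defines "\<tau> \<equiv> M * (e_FW f s x / 2) * t"
  shows "0 < \<tau>" "\<tau> < 1" "Gap f X x * (1 - \<tau>) = (e_FW f s x)\<^sup>2 * t"
    "t * Gap f X x * (3 / (2 * (3 - \<tau>))) \<le> model_decrease M x"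
proof -
  define a e g where "a = M * delta_FW f s \<nu> x" and "e = e_FW f s x" and "g = Gap f X x"
  note p = direction_pos[OF x G]
  have d: "delta_FW f s \<nu> x = e / 2" using \<nu>3 p by (simp add: delta_FW_def rpow_def e_def)
  have \<tau>: "\<tau> = a * t" by (simp add: \<tau>_def a_def d e_def)
  note ts = t_step_profile[OF nu M p(5) G p(3), folded a_def t_def, folded \<tau> e_def g_def]
  show \<tau>b: "0 < \<tau>" "\<tau> < 1" using ts(1,2) \<nu>3 by (auto simp: below_pole_def)
  have a: "0 < a" "0 < e" "0 < g" using M p G by (simp_all add: a_def e_def g_def)
  have sl: "\<tau> / (1 - \<tau>) = a * g / e\<^sup>2" using ts(3) profile_conjugate_3(1)[of \<tau>] \<tau>b \<nu>3 by simp
  then have "a * g * (1 - \<tau>) = \<tau> * e\<^sup>2" using \<tau>b a by (simp add: frac_eq_eq)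
  then have "a * (g * (1 - \<tau>)) = a * (e\<^sup>2 * t)" unfolding \<tau> by (simp add: mult_ac)
  then show "Gap f X x * (1 - \<tau>) = (e_FW f s x)\<^sup>2 * t" using a by (simp add: g_def e_def)
  have "t * g * (3 / (2 * (3 - \<tau>))) = e\<^sup>2 / a\<^sup>2 * (\<tau> * (\<tau> / (1 - \<tau>)) * (3 / (2 * (3 - \<tau>))))"
  proof -
    have "e\<^sup>2 / a\<^sup>2 * (\<tau> * (\<tau> / (1 - \<tau>)) * Z) = t * g * Z" for Z
      unfolding sl unfolding \<tau> using a by (simp add: power2_eq_square)
    from this[symmetric] show ?thesis .
  qed
  also have "\<dots> \<le> e\<^sup>2 / a\<^sup>2 * (\<tau> * profile_slope 3 \<tau> - profile 3 \<tau>)"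
    using \<tau>b by (intro mult_left_mono profile_conjugate_3(2)) auto
  also have "\<dots> = model_decrease M x"
    using model_decrease_short_step(1)[OF x G M short] \<nu>3 by (simp add: a_def e_def \<tau> t_def)
  finally show "t * Gap f X x * (3 / (2 * (3 - \<tau>))) \<le> model_decrease M x" by (simp add: g_def)
qed

end

section \<open>The iteration count of a run\<close>

locale fw_run = fw_problem f X \<nu> Mf s
  for f :: "real^'n \<Rightarrow> ereal" and X \<nu> Mf s +
  fixes x0 xstar :: "real^'n" and x :: "nat \<Rightarrow> real^'n" and \<mu> :: "nat \<Rightarrow> real"
    and \<gamma>u \<gamma>d \<mu>init \<epsilon> :: real
  assumes xstar: "is_arg_min f (\<lambda>y. y \<in> X) xstar"
    and x0: "x0 \<in> X \<inter> effdom f"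
    and params: "0 < \<mu>init" "1 < \<gamma>u" "0 < \<epsilon>"
    and run: "MBTFWGSC_run f X s \<nu> \<gamma>u \<gamma>d \<mu>init \<epsilon> x0 x \<mu>"
begin

abbreviation L :: real where "L \<equiv> L_grad f X x0"
abbreviation D :: real where "D \<equiv> diameter X"
abbreviation Mbar :: real where "Mbar \<equiv> max (\<gamma>u * Mf) \<mu>init"
abbreviation h :: "nat \<Rightarrow> real" where "h k \<equiv> F (x k) - F xstar"

lemma xstar_dom: "xstar \<in> X \<inter> effdom f"
proof -
  have "xstar \<in> X" "\<not> f x0 < f xstar" using xstar x0 by (auto simp: is_arg_min_def)
  then show ?thesis using x0 by (auto simp: effdom_def not_less intro: le_less_trans)
qed

lemma iteration_step:
  assumes xk: "x k \<in> X \<inter> effdom f" and mu: "0 < \<mu> k" "\<mu> k \<le> Mbar" and G: "\<epsilon> < Gap f X (x k)"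
  shows "x (Suc k) = x k + alpha_step f X s \<nu> (\<mu> (Suc k)) (x k) *\<^sub>R v_FW s (x k)"
    and "x (Suc k) \<in> X \<inter> effdom f"
    and "F (x (Suc k)) \<le> F (x k) - model_decrease (\<mu> (Suc k)) (x k)"
    and "0 < \<mu> (Suc k)" "\<mu> (Suc k) \<le> Mbar"
proof -
  have "\<exists>M>0. M \<in> {\<gamma>d * \<mu> k .. \<mu> k} \<and> \<mu> (Suc k) = backtrack f X s \<nu> \<gamma>u (x k) M \<and>
      x (Suc k) = x k + alpha_step f X s \<nu> (\<mu> (Suc k)) (x k) *\<^sub>R v_FW s (x k)"
    using run[unfolded MBTFWGSC_run_def, THEN conjunct2, THEN conjunct2, THEN spec[of _ k]] G
    by (simp only: if_True)
  then obtain M where MM: "0 < M \<and> M \<in> {\<gamma>d * \<mu> k .. \<mu> k} \<and> \<mu> (Suc k) = backtrack f X s \<nu> \<gamma>u (x k) M \<and>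
      x (Suc k) = x k + alpha_step f X s \<nu> (\<mu> (Suc k)) (x k) *\<^sub>R v_FW s (x k)" by (rule exE)
  then have M: "0 < M" "M \<le> \<mu> k" "\<mu> (Suc k) = backtrack f X s \<nu> \<gamma>u (x k) M"
    and step: "x (Suc k) = x k + alpha_step f X s \<nu> (\<mu> (Suc k)) (x k) *\<^sub>R v_FW s (x k)"
    unfolding atLeastAtMost_iff by blast+
  have G0: "0 < Gap f X (x k)" using G params by simp
  note b = backtrack_result[OF xk G0 M(1) params(2), folded M(3)]
  show "x (Suc k) = x k + alpha_step f X s \<nu> (\<mu> (Suc k)) (x k) *\<^sub>R v_FW s (x k)" by (rule step)
  show "x (Suc k) \<in> X \<inter> effdom f"
    and "F (x (Suc k)) \<le> F (x k) - model_decrease (\<mu> (Suc k)) (x k)"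
    using accepted_step[OF xk G0 b(2,1)] by (simp_all add: step)
  show "0 < \<mu> (Suc k)" by (rule b(2))
  show "\<mu> (Suc k) \<le> Mbar" using b(3) M(2) mu by auto
qed

text \<open>
  After the stopping test the sequences are constant, so the invariant holds for every index.
\<close>

lemma invariant:
  "x k \<in> X \<inter> effdom f \<and> F (x k) \<le> F x0 \<and> 0 < \<mu> k \<and> \<mu> k \<le> Mbar"
proof (induction k)
  case 0
  then show ?case using run x0 params by (auto simp: MBTFWGSC_run_def)
next
  case (Suc k)
  show ?case
  proof (cases "\<epsilon> < Gap f X (x k)")
    case True
    have G0: "0 < Gap f X (x k)" using True params by simp
    note s = iteration_step[of k, OF _ _ _ True]
    then show ?thesis using Suc model_decrease_nonneg[OF _ G0, of "\<mu> (Suc k)"] by fastforce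
  next
    case False
    then show ?thesis using Suc run by (auto simp: MBTFWGSC_run_def)
  qed
qed

lemma iterate_in_sublevel: "x k \<in> sublevel f X x0"
proof -
  obtain r r0 where "f (x k) = ereal r" "f x0 = ereal r0" using f_eq x0 invariant[of k] by blast
  then show ?thesis using invariant[of k] by (simp add: sublevel_def)
qed

lemma local_norm_bound: "(e_FW f s (x k))\<^sup>2 \<le> L * (beta_FW s (x k))\<^sup>2"
  unfolding e_FW_def beta_FW_def
  using x0 by (intro local_norm_le_L_grad iterate_in_sublevel) (auto simp: effdom_def)

lemma dist_le_D: "y \<in> X \<Longrightarrow> z \<in> X \<Longrightarrow> norm (y - z) \<le> D"
  using diameter_bounded_bound[of X y z] comp_X by (simp add: compact_imp_bounded dist_norm)

lemma beta_le_D: "beta_FW s (x k) \<le> D"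
  using dist_le_D lmo_minimal(1) invariant[of k] by (simp add: beta_FW_def v_FW_def)

lemma h_le_Gap: "h k \<le> Gap f X (x k)"
  using primal_gap_le_Gap xstar_dom invariant by blast

lemma constants_pos:
  assumes "0 < Gap f X (x k)"
  shows "0 < L" "0 < D" "0 < Mbar"
proof -
  have xk: "x k \<in> X \<inter> effdom f" using invariant by blast
  note p = direction_pos[OF xk assms]
  have "0 < L * (beta_FW s (x k))\<^sup>2" using local_norm_bound[of k] p(3) by (meson order_less_le_trans zero_less_power)
  then show "0 < L" using p(4) by (simp add: zero_less_mult_iff)
  show "0 < D" using p(4) beta_le_D[of k] by linarith
  show "0 < Mbar" using params by simp
qed

lemma count_nu_less_3:
  assumes \<nu>3: "\<nu> < 3" and h: "\<And>k. k \<le> n \<Longrightarrow> \<epsilon> < h k"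
  shows "real (Suc n) \<le> ln (c1 L D Mbar \<nu> / (h 0 * c2 L D Mbar \<nu>)) / ln (1 - c1 L D Mbar \<nu>)
           + 1 / (c2 L D Mbar \<nu> * \<epsilon>)"
proof (rule iteration_count_min_decrease)
  have Ge: "\<epsilon> < Gap f X (x k)" if "k \<le> n" for k using h[OF that] h_le_Gap[of k] by simp
  have c: "0 < L" "0 < D" "0 < Mbar" using constants_pos[of 0] Ge[of 0] params(3) by auto
  have k2: "0 < 2 * ln 2 - (1::real)" using ln2_ge_two_thirds by simp
  have kg: "2 < \<nu> \<Longrightarrow> 0 < gamma_tilde \<nu>" using gamma_tilde_conjugate(2)[of \<nu> 0] \<nu>3 by simp
  have kb: "2 < \<nu> \<Longrightarrow> 0 < - 1 / b_const \<nu>" using \<nu>3 by (auto simp: b_const_def divide_simps)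
  have two: "\<nu> = 2 \<or> 2 < \<nu>" using nu by auto
  then show c1: "0 < c1 L D Mbar \<nu>"
    using c \<nu>3 k2 kg by (auto simp: c1_def intro!: divide_pos_pos mult_pos_pos)
  show c2: "0 < c2 L D Mbar \<nu>"
  proof (cases "\<nu> = 2")
    case False
    then have "c2 L D Mbar \<nu> = - 1 / b_const \<nu> * (gamma_tilde \<nu> / (L * D\<^sup>2))"
      using \<nu>3 unfolding c2_def by simp
    moreover have "0 < gamma_tilde \<nu> / (L * D\<^sup>2)" "2 < \<nu>" using False two kg c by auto
    ultimately show ?thesis using mult_pos_pos[OF kb] by (simp only:)
  qed (use k2 c in \<open>simp add: c2_def\<close>)
  show "c1 L D Mbar \<nu> \<le> 1 / 2" by (rule c1_le_half)
  show "0 < \<epsilon>" by (rule params(3))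
  show "\<epsilon> < h k" if "k \<le> n" for k using h that .
  fix k assume "k < n"
  then have k: "\<epsilon> < h k" "\<epsilon> < Gap f X (x k)" using h Ge by auto
  then have G0: "0 < Gap f X (x k)" using params by simp
  have h0: "0 < h k" using k params by simp
  have inv: "x k \<in> X \<inter> effdom f" "0 < \<mu> k" "\<mu> k \<le> Mbar" using invariant[of k] by auto
  note st = iteration_step[OF inv k(2)]
  have "min (c1 L D Mbar \<nu> * h k) (c2 L D Mbar \<nu> * (h k)\<^sup>2)
      \<le> min (c1 L D Mbar \<nu> * Gap f X (x k)) (c2 L D Mbar \<nu> * (Gap f X (x k))\<^sup>2)"
    using c1 c2 h_le_Gap[of k] h0 by (intro min.mono mult_left_mono power_mono) auto
  also have "\<dots> \<le> model_decrease (\<mu> (Suc k)) (x k)"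
    by (rule model_decrease_ge_min[OF inv(1) G0 st(4,5) \<nu>3 c(1) local_norm_bound c(2) beta_le_D])
  finally show "h (Suc k) \<le> h k - min (c1 L D Mbar \<nu> * h k) (c2 L D Mbar \<nu> * (h k)\<^sup>2)"
    using st(3) by simp
qed

text \<open>
  The numbers \<open>w\<close> follow the variance recursion for convex combinations. The distance bound \<open>(1 - w) D\<^sup>2\<close> is propagated by
  Stewart's identity for the distance from a point \<open>d\<close> to \<open>(1 - t) x + t s\<close>: the distance from \<open>d\<close> to \<open>x\<close> is
  bounded by the induction hypothesis, the one from \<open>d\<close> to \<open>s\<close> by the diameter.
\<close>

lemma count_nu_3:
  assumes \<nu>3: "\<nu> = 3" and h: "\<And>k. k \<le> n \<Longrightarrow> \<epsilon> < h k"
  shows "real (Suc n) \<le> ln (c1 L D Mbar \<nu> / (h 0 * c2 L D Mbar \<nu>)) / ln (1 - c1 L D Mbar \<nu>)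
           + 1 / (c2 L D Mbar \<nu> * \<epsilon>)"
proof -
  define cl where "cl = c1 L D Mbar \<nu>"
  define t where "t k = alpha_step f X s \<nu> (\<mu> (Suc k)) (x k)" for k
  define m where "m k = (beta_FW s (x k))\<^sup>2 / D\<^sup>2" for k
  define w where "w = rec_nat 0 (\<lambda>k wk. (1 - t k) * (wk + t k * m k))"
  have w0: "w 0 = 0" and wS: "w (Suc k) = (1 - t k) * (w k + t k * m k)" for k by (simp_all add: w_def)
  have Ge: "\<epsilon> < Gap f X (x k)" if "k \<le> n" for k using h[OF that] h_le_Gap[of k] by simp
  have c: "0 < L" "0 < D" "0 < Mbar" using constants_pos[of 0] Ge[of 0] params(3) by auto
  have l2: "0 < 1 - ln (2::real)" using ln2_le_25_over_36 by simp
  have cl_eq: "cl = min (1/2) (2 * (1 - ln 2) / (Mbar * sqrt L * D))" using \<nu>3 by (simp add: cl_def c1_def)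
  have cl: "0 < cl" "cl \<le> 1 / 2" "cl * (Mbar * sqrt L * D / 2) \<le> 1 - ln 2"
  proof -
    have d: "0 < Mbar * sqrt L * D" using c by simp
    have "0 < 2 * (1 - ln 2) / (Mbar * sqrt L * D)" using d l2 by (intro divide_pos_pos) auto
    then show "0 < cl" unfolding cl_eq by (simp only: min_less_iff_conj) simp
    show "cl \<le> 1 / 2" unfolding cl_eq by (rule min.cobounded1)
    have "cl \<le> 2 * (1 - ln 2) / (Mbar * sqrt L * D)" unfolding cl_eq by (rule min.cobounded2)
    then show "cl * (Mbar * sqrt L * D / 2) \<le> 1 - ln 2" using d by (simp add: pos_le_divide_eq)
  qed
  have c2_eq: "c2 L D Mbar \<nu> = 2 * (1 - ln 2) / (L * D\<^sup>2)" using \<nu>3 by (simp add: c2_def)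
  have inv: "x k \<in> X \<inter> effdom f" "0 < \<mu> k" "\<mu> k \<le> Mbar" for k using invariant[of k] by auto
  have G0: "0 < Gap f X (x k)" if "k \<le> n" for k using Ge[OF that] params by simp
  note st = iteration_step[OF inv Ge]
  have tb: "0 < t k \<and> t k \<le> 1" if "k < n" for k
    using step_size_bounds[OF inv(1) G0 inv(2)] that by (simp add: t_def)
  have spread: "(norm (d - x k))\<^sup>2 \<le> D\<^sup>2 * (1 - w k)" if "k \<le> n" "d \<in> X" for k d
    using that
  proof (induction k arbitrary: d)
    case 0
    then show ?case using dist_le_D[of d "x 0"] inv(1)[of 0] by (simp add: w0 power_mono)
  next
    case (Suc k)
    then have k: "k < n" "k \<le> n" by auto
    let ?s = "s (x k)" and ?t = "t k"
    have sX: "?s \<in> X" using lmo_minimal(1) inv by blast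
    have xS: "x (Suc k) = x k + ?t *\<^sub>R (?s - x k)" using st(1)[of k] k by (simp add: t_def v_FW_def)
    have mD: "D\<^sup>2 * m k = (norm (?s - x k))\<^sup>2" using c by (simp add: m_def beta_FW_def v_FW_def)
    have "(norm (d - x (Suc k)))\<^sup>2 = (1 - ?t) * (norm (d - x k))\<^sup>2 + ?t * (norm (d - ?s))\<^sup>2
        - ?t * (1 - ?t) * (norm (?s - x k))\<^sup>2"
      unfolding xS power2_norm_eq_inner
      by (simp add: inner_diff_left inner_diff_right inner_add_left inner_add_right inner_commute algebra_simps)
    also have "\<dots> \<le> (1 - ?t) * (D\<^sup>2 * (1 - w k)) + ?t * D\<^sup>2 - ?t * (1 - ?t) * (D\<^sup>2 * m k)"
      unfolding mD using Suc.IH[of d] Suc.prems k tb[OF k(1)] dist_le_D[OF _ sX, of d]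
      by (intro diff_mono add_mono mult_left_mono power_mono order_refl) auto
    also have "\<dots> = D\<^sup>2 * (1 - w (Suc k))" unfolding wS by (simp add: algebra_simps)
    finally show ?case .
  qed
  have mb: "0 \<le> m k \<and> m k \<le> 1 - w k" if "k < n" for k
  proof -
    have "(beta_FW s (x k))\<^sup>2 \<le> D\<^sup>2 * (1 - w k)"
      using spread[of k "s (x k)"] that lmo_minimal(1) inv by (simp add: beta_FW_def v_FW_def)
    then show ?thesis using c by (simp add: m_def pos_divide_le_eq mult.commute)
  qed
  show ?thesis unfolding c2_eq cl_def[symmetric]
  proof (rule iteration_count_with_spread[where t = t and m = m and w = w, OF cl(1,2) _ params(3) h w0 tb mb wS])
    show "0 < L * D\<^sup>2" using c by simp
  next
    fix k assume k: "k < n" "t k = 1"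
    then have kn: "k \<le> n" by simp
    have "1 \<le> t_step f X s \<nu> (\<mu> (Suc k)) (x k)" using k(2) by (simp add: t_def alpha_step_def min_def split: if_splits)
    from model_decrease_full_step[OF inv(1) G0[OF kn] inv(2) this]
    have "Gap f X (x k) / 2 \<le> model_decrease (\<mu> (Suc k)) (x k)" .
    then show "h (Suc k) \<le> h k / 2" using st(3)[OF kn] h_le_Gap[of k] by simp
  next
    fix k assume k: "k < n" "t k < 1"
    then have kn: "k \<le> n" by simp
    define M e where "M = \<mu> (Suc k)" and "e = e_FW f s (x k)"
    have M: "0 < M" "M \<le> Mbar" using inv by (auto simp: M_def)
    have short: "t_step f X s \<nu> M (x k) < 1" and teq: "t_step f X s \<nu> M (x k) = t k"
      using k(2) by (auto simp: t_def alpha_step_def M_def min_def split: if_splits)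
    define \<tau> where "\<tau> = M * (e / 2) * t k"
    note d3 = model_decrease_3[OF inv(1) G0[OF kn] M(1) \<nu>3 short, unfolded teq, folded e_def, folded \<tau>_def]
    have e: "0 < e" using direction_pos(3)[OF inv(1) G0[OF kn]] by (simp add: e_def)
    define q where "q = e\<^sup>2 / (L * D\<^sup>2)"
    have q: "0 < q" "L * D\<^sup>2 * q = e\<^sup>2" using e c by (simp_all add: q_def)
    have "q \<le> L * (beta_FW s (x k))\<^sup>2 / (L * D\<^sup>2)"
      unfolding q_def e_def using c by (intro divide_right_mono local_norm_bound) auto
    then have qm: "q \<le> m k" using c by (simp add: m_def)
    have sq: "sqrt q * (sqrt L * D) = e" using e c by (simp add: q_def real_sqrt_divide real_sqrt_mult)
    have "cl * (M * (sqrt L * D / 2)) \<le> cl * (Mbar * (sqrt L * D / 2))"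
      using M c cl by (intro mult_left_mono mult_right_mono) auto
    also have "\<dots> \<le> 1 - ln 2" using cl(3) by (simp add: mult.assoc)
    finally have K: "M * (sqrt L * D / 2) \<le> (1 - ln 2) / cl" using cl by (simp add: pos_le_divide_eq mult.commute)
    have "\<tau> = M * (sqrt L * D / 2) * sqrt q * t k" unfolding \<tau>_def sq[symmetric] by simp
    also have "\<dots> \<le> (1 - ln 2) / cl * sqrt q * t k"
      using K tb[OF k(1)] q by (intro mult_right_mono) auto
    finally have \<tau>K: "\<tau> \<le> (1 - ln 2) / cl * sqrt q * t k" .
    have "h k * (1 - \<tau>) \<le> Gap f X (x k) * (1 - \<tau>)"
      using h_le_Gap[of k] d3(2) by (intro mult_right_mono) auto
    also have "\<dots> = L * D\<^sup>2 * (q * t k)" unfolding d3(3) using q by simp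
    finally have hq: "h k * (1 - \<tau>) \<le> L * D\<^sup>2 * (q * t k)" .
    have "t k * h k * (3 / (2 * (3 - \<tau>))) \<le> t k * Gap f X (x k) * (3 / (2 * (3 - \<tau>)))"
      using h_le_Gap[of k] d3(2) tb[OF k(1)] by (intro mult_right_mono mult_left_mono) auto
    also note d3(4)
    finally have "h (Suc k) \<le> h k - t k * h k * (3 / (2 * (3 - \<tau>)))"
      using st(3)[OF kn] unfolding M_def by linarith
    moreover have "H - T * H * Z = H * (1 - T * Z)" for H T Z :: real by (simp add: algebra_simps)
    ultimately have "h (Suc k) \<le> h k * (1 - t k * (3 / (2 * (3 - \<tau>))))" by (simp only:)
    then show "\<exists>q \<tau>. 0 < q \<and> q \<le> m k \<and> 0 < \<tau> \<and> \<tau> < 1 \<and> \<tau> \<le> (1 - ln 2) / cl * sqrt q * t k \<and>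
        h k * (1 - \<tau>) \<le> L * D\<^sup>2 * (q * t k) \<and> h (Suc k) \<le> h k * (1 - t k * (3 / (2 * (3 - \<tau>))))"
      using q(1) qm d3(1,2) \<tau>K hq by blast
  qed
qed

lemma N_eps_bound:
  "(h 0 \<le> \<epsilon> \<longrightarrow> N_eps f xstar x \<epsilon> = 0) \<and>
   (\<epsilon> < h 0 \<longrightarrow>
     ereal_of_enat (N_eps f xstar x \<epsilon>)
       \<le> ereal (ln (c1 L D Mbar \<nu> / (h 0 * c2 L D Mbar \<nu>)) / ln (1 - c1 L D Mbar \<nu>)
                + 1 / (c2 L D Mbar \<nu> * \<epsilon>)))" (is "_ \<and> (_ \<longrightarrow> _ \<le> ereal ?B)")
proof -
  have hg: "h_gap f xstar x k = ereal (h k)" for k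
  proof -
    obtain r r' where "f (x k) = ereal r" "f xstar = ereal r'" using f_eq xstar_dom invariant[of k] by blast
    then show ?thesis by (simp add: h_gap_def)
  qed
  let ?S = "{k. h k \<le> \<epsilon>}"
  have N: "N_eps f xstar x \<epsilon> = Inf (enat ` ?S)" by (simp add: N_eps_def hg)
  have count: "real (Suc n) \<le> ?B" if "\<And>k. k \<le> n \<Longrightarrow> \<epsilon> < h k" for n
    using count_nu_less_3[OF _ that] count_nu_3[OF _ that] nu by (cases "\<nu> = 3") auto
  have le: "N_eps f xstar x \<epsilon> \<le> enat k" if "h k \<le> \<epsilon>" for k
    unfolding N using that by (intro Inf_lower) auto
  have "ereal_of_enat (N_eps f xstar x \<epsilon>) \<le> ereal ?B" if h0: "\<epsilon> < h 0"
  proof -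
    obtain n where n: "?B < real n" using reals_Archimedean2 by blast
    have "\<exists>k. h k \<le> \<epsilon>"
    proof (rule ccontr)
      assume "\<nexists>k. h k \<le> \<epsilon>"
      then have "real (Suc n) \<le> ?B" by (intro count) (auto simp: not_le)
      then show False using n by simp
    qed
    then obtain k where k: "h k \<le> \<epsilon>" "\<And>j. j < k \<Longrightarrow> \<not> h j \<le> \<epsilon>"
      using exists_least_iff[of "\<lambda>k. h k \<le> \<epsilon>"] by blast
    then have "k \<noteq> 0" using h0 by (cases k) auto
    then obtain j where j: "k = Suc j" by (cases k) auto
    have "real (Suc j) \<le> ?B" using k(2) by (intro count) (auto simp: j not_le less_Suc_eq_le)
    moreover have "ereal_of_enat (N_eps f xstar x \<epsilon>) \<le> ereal_of_enat (enat k)"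
      using le[OF k(1)] by (simp only: ereal_of_enat_le_iff)
    ultimately show ?thesis unfolding j by (auto intro: order_trans)
  qed
  moreover have "N_eps f xstar x \<epsilon> = 0" if "h 0 \<le> \<epsilon>"
    using le[OF that] by (simp add: zero_enat_def[symmetric])
  ultimately show ?thesis by blast
qed

end

theorem theorem4p11:
  fixes f :: "real^'n \<Rightarrow> ereal" and X :: "(real^'n) set" and s :: "real^'n \<Rightarrow> real^'n"
    and x0 xstar :: "real^'n" and x :: "nat \<Rightarrow> real^'n" and \<mu> :: "nat \<Rightarrow> real"
    and \<nu> Mf \<gamma>u \<gamma>d \<mu>init \<epsilon> L D Mbar h0 :: real
  assumes "\<nu> \<in> {2..3}" and "Mf \<ge> 0" and "f \<in> gsc_class Mf \<nu>"
    and "convex X" and "compact X"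
    and "is_arg_min f (\<lambda>y. y \<in> X) xstar"
    and "continuous_on (X \<inter> effdom f) (hess f)"
    and "\<forall>y \<in> X \<inter> effdom f. \<forall>u. u \<noteq> 0 \<longrightarrow> (hess f y *v u) \<bullet> u > 0"
    and "lin_oracle f X s"
    and "x0 \<in> X \<inter> effdom f"
    and "\<mu>init > 0" and "\<gamma>u > 1" and "\<gamma>d < 1" and "\<epsilon> > 0"
    and "MBTFWGSC_run f X s \<nu> \<gamma>u \<gamma>d \<mu>init \<epsilon> x0 x \<mu>"
  defines "L \<equiv> L_grad f X x0" and "D \<equiv> diameter X"
    and "Mbar \<equiv> max (\<gamma>u * Mf) \<mu>init"
    and "h0 \<equiv> real_of_ereal (h_gap f xstar x 0)"
  shows "(h0 \<le> \<epsilon> \<longrightarrow> N_eps f xstar x \<epsilon> = 0) \<and>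
         (\<epsilon> < h0 \<longrightarrow>
           ereal_of_enat (N_eps f xstar x \<epsilon>)
             \<le> ereal (ln (c1 L D Mbar \<nu> / (h0 * c2 L D Mbar \<nu>)) / ln (1 - c1 L D Mbar \<nu>)
                      + 1 / (c2 L D Mbar \<nu> * \<epsilon>)))"
proof -
  interpret fw_run f X \<nu> Mf s x0 xstar x \<mu> \<gamma>u \<gamma>d \<mu>init \<epsilon>
    using assms(1-15) by unfold_locales auto
  have "h0 = F (x 0) - F xstar"
  proof -
    obtain r r' where "f (x 0) = ereal r" "f xstar = ereal r'" using f_eq xstar_dom invariant[of 0] by blast
    then show ?thesis by (simp add: h0_def h_gap_def)
  qed
  then show ?thesis unfolding L_def D_def Mbar_def using N_eps_bound by simp
qed

end
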